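(* Let $\Omega\subset\mathbb{R}^N$, $N\ge2$, be a smooth bounded domain, let $g\in L^\infty(\Omega)$ with $g\ge0$, let $1\le l<p$, $\alpha,s>0$ and $m\ge0$. Suppose that $u_m\in W_0^{1,p}(\Omega)$ is a positive weak solution to the Dirichlet problem $$-\Delta_p u=mu^{l-1}e^{\alpha u^s}+g(x)\ \text{ in }\Omega,\qquad u=0\ \text{ on }\partial\Omega.$$ Then $$m<\lambda_p\left(\frac{p-l}{\alpha se}\right)^{\frac{p-l}{s}}.$$
   Context: $\Delta_p u:=\operatorname{div}(|\nabla u|^{p-2}\nabla u)$. $\lambda_p:=\inf\{\|\nabla v\|_p^p/\|v\|_p^p: v\in W_0^{1,p}(\Omega)\setminus\{0\}\}$ is the first eigenvalue of the Dirichlet $p$-Laplacian on $\Omega$, where $\|\cdot\|_p$ is the $L^p(\Omega)$ norm. Here $e$ in the estimate is Euler's number. A weak solution of $-\Delta_p u=f(x,u)$ in $\Omega$, $u=0$ on $\partial\Omega$, is a function $u\in W_0^{1,p}(\Omega)$ with $\int_\Omega|\nabla u|^{p-2}\nabla u\cdot\nabla\varphi\,dx=\int_\Omega f(x,u)\varphi\,dx$ for all $\varphi\in W_0^{1,p}(\Omega)$ (the right-hand integrand being integrable). *)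

theory Defs
  imports "HOL-Analysis.Analysis"
begin

text \<open>Intended for open \<open>S\<close>: all iterated directional derivatives of order at most \<open>k\<close> exist and
  are continuous on \<open>S\<close>. (Continuity of the derivatives of lower order follows from their
  differentiability.)\<close>

primrec Ck_on :: "nat \<Rightarrow> 'a::euclidean_space set \<Rightarrow> ('a \<Rightarrow> real) \<Rightarrow> bool" where
  "Ck_on 0 S f \<longleftrightarrow> continuous_on S f"
| "Ck_on (Suc k) S f \<longleftrightarrow>
     (\<forall>x\<in>S. f differentiable (at x)) \<and>
     (\<forall>v. Ck_on k S (\<lambda>x. frechet_derivative f (at x) v))"

definition smooth_on :: "'a::euclidean_space set \<Rightarrow> ('a \<Rightarrow> real) \<Rightarrow> bool" where
  "smooth_on S f \<longleftrightarrow> (\<forall>k. Ck_on k S f)"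

text \<open>Near each boundary point, after a choice of orthonormal coordinates whose last axis is \<open>e\<close>,
  the set is the region strictly above the graph of a smooth function of the remaining coordinates.
  The projection \<open>y - (y \<bullet> e) *\<^sub>R e\<close> carries these remaining coordinates; a smooth function on the
  hyperplane orthogonal to \<open>e\<close> is the same as the restriction of a smooth function on the whole
  space.\<close>

definition smooth_boundary :: "'a::euclidean_space set \<Rightarrow> bool" where
  "smooth_boundary \<Omega> \<longleftrightarrow>
     (\<forall>x\<in>frontier \<Omega>. \<exists>e r \<gamma>. norm e = 1 \<and> r > 0 \<and> smooth_on UNIV \<gamma> \<and>
        \<Omega> \<inter> ball x r = {y \<in> ball x r. \<gamma> (y - (y \<bullet> e) *\<^sub>R e) < y \<bullet> e})"

definition smooth_bounded_domain :: "'a::euclidean_space set \<Rightarrow> bool" where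
  "smooth_bounded_domain \<Omega> \<longleftrightarrow>
     open \<Omega> \<and> connected \<Omega> \<and> \<Omega> \<noteq> {} \<and> bounded \<Omega> \<and> smooth_boundary \<Omega>"

text \<open>Elements of the function spaces below are everywhere defined functions, of which only the
  values almost everywhere in \<open>\<Omega>\<close> matter; no quotient is taken.\<close>

definition Lp_space ::
  "real \<Rightarrow> 'a::euclidean_space set \<Rightarrow> ('a \<Rightarrow> 'b::euclidean_space) set" where
  "Lp_space p \<Omega> = {f. f \<in> borel_measurable (lebesgue_on \<Omega>) \<and>
     integrable (lebesgue_on \<Omega>) (\<lambda>x. norm (f x) powr p)}"

definition Lp_norm ::
  "real \<Rightarrow> 'a::euclidean_space set \<Rightarrow> ('a \<Rightarrow> 'b::euclidean_space) \<Rightarrow> real" where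
  "Lp_norm p \<Omega> f = (LINT x|lebesgue_on \<Omega>. norm (f x) powr p) powr (1 / p)"

definition Linfty_space :: "'a::euclidean_space set \<Rightarrow> ('a \<Rightarrow> real) set" where
  "Linfty_space \<Omega> = {f. f \<in> borel_measurable (lebesgue_on \<Omega>) \<and>
     (\<exists>C. AE x in lebesgue_on \<Omega>. \<bar>f x\<bar> \<le> C)}"

definition locally_integrable_on ::
  "('a::euclidean_space \<Rightarrow> 'b::euclidean_space) \<Rightarrow> 'a set \<Rightarrow> bool" where
  "locally_integrable_on f \<Omega> \<longleftrightarrow>
     (\<forall>K. compact K \<and> K \<subseteq> \<Omega> \<longrightarrow> f absolutely_integrable_on K)"

definition test_functions :: "'a::euclidean_space set \<Rightarrow> ('a \<Rightarrow> real) set" where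
  "test_functions \<Omega> = {\<phi>. smooth_on UNIV \<phi> \<and>
     compact (closure {x. \<phi> x \<noteq> 0}) \<and> closure {x. \<phi> x \<noteq> 0} \<subseteq> \<Omega>}"

definition weak_gradient ::
  "'a::euclidean_space set \<Rightarrow> ('a \<Rightarrow> real) \<Rightarrow> ('a \<Rightarrow> 'a) \<Rightarrow> bool" where
  "weak_gradient \<Omega> u G \<longleftrightarrow>
     locally_integrable_on u \<Omega> \<and> locally_integrable_on G \<Omega> \<and>
     (\<forall>\<phi>\<in>test_functions \<Omega>. \<forall>b\<in>Basis.
        (LINT x|lebesgue_on \<Omega>. u x * frechet_derivative \<phi> (at x) b) =
        - (LINT x|lebesgue_on \<Omega>. (G x \<bullet> b) * \<phi> x))"

text \<open>The weak gradient is unique up to null sets; a representative is chosen.\<close>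

definition wgrad :: "'a::euclidean_space set \<Rightarrow> ('a \<Rightarrow> real) \<Rightarrow> 'a \<Rightarrow> 'a" where
  "wgrad \<Omega> u = (SOME G. weak_gradient \<Omega> u G)"

definition W1p :: "real \<Rightarrow> 'a::euclidean_space set \<Rightarrow> ('a \<Rightarrow> real) set" where
  "W1p p \<Omega> = {u \<in> Lp_space p \<Omega>. \<exists>G. weak_gradient \<Omega> u G \<and> G \<in> Lp_space p \<Omega>}"

definition W1p_norm :: "real \<Rightarrow> 'a::euclidean_space set \<Rightarrow> ('a \<Rightarrow> real) \<Rightarrow> real" where
  "W1p_norm p \<Omega> u =
     (Lp_norm p \<Omega> u powr p + Lp_norm p \<Omega> (wgrad \<Omega> u) powr p) powr (1 / p)"

definition W1p0 :: "real \<Rightarrow> 'a::euclidean_space set \<Rightarrow> ('a \<Rightarrow> real) set" where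
  "W1p0 p \<Omega> = {u \<in> W1p p \<Omega>. \<exists>\<phi> :: nat \<Rightarrow> 'a \<Rightarrow> real.
     (\<forall>n. \<phi> n \<in> test_functions \<Omega>) \<and>
     (\<lambda>n. W1p_norm p \<Omega> (\<lambda>x. u x - \<phi> n x)) \<longlonglongrightarrow> 0}"

definition first_eigenvalue :: "real \<Rightarrow> 'a::euclidean_space set \<Rightarrow> real" where
  "first_eigenvalue p \<Omega> =
     Inf {Lp_norm p \<Omega> (wgrad \<Omega> v) powr p / Lp_norm p \<Omega> v powr p | v.
            v \<in> W1p0 p \<Omega> \<and> \<not> (AE x in lebesgue_on \<Omega>. v x = 0)}"

text \<open>For \<open>p < 2\<close> the factor \<open>norm (wgrad \<Omega> u x) powr (p - 2)\<close> is \<open>0\<close> where the gradient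
  vanishes, so the flux is \<open>0\<close> there, as usual.\<close>

definition weak_solution ::
  "real \<Rightarrow> 'a::euclidean_space set \<Rightarrow> ('a \<Rightarrow> real \<Rightarrow> real) \<Rightarrow> ('a \<Rightarrow> real) \<Rightarrow> bool" where
  "weak_solution p \<Omega> f u \<longleftrightarrow>
     u \<in> W1p0 p \<Omega> \<and>
     (\<forall>\<phi>\<in>W1p0 p \<Omega>.
        integrable (lebesgue_on \<Omega>) (\<lambda>x. f x (u x) * \<phi> x) \<and>
        (LINT x|lebesgue_on \<Omega>.
            (norm (wgrad \<Omega> u x) powr (p - 2) *\<^sub>R wgrad \<Omega> u x) \<bullet> wgrad \<Omega> \<phi> x) =
        (LINT x|lebesgue_on \<Omega>. f x (u x) * \<phi> x))"

end

theory Submission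
  imports Defs "HOL-Real_Asymp.Real_Asymp"
begin

text \<open>Minimizing \<open>exp (\<alpha> * t powr s) / t powr (p - l)\<close> over \<open>t > 0\<close>, with unique minimizer \<open>t\<^sub>0\<close>, shows
  \<open>m * t powr (l - 1) * exp (\<alpha> * t powr s) \<ge> L * t powr (p - 1)\<close>, where \<open>L\<close> is \<open>m\<close> divided by the
  factor of the eigenvalue in the claim. So \<open>u\<close> is a supersolution of the eigenvalue equation with
  parameter \<open>L\<close>, strict wherever \<open>u x \<noteq> t\<^sub>0\<close>. Suppose that the first eigenvalue is at most \<open>L\<close> and take a
  normalized minimizing sequence \<open>\<psi>\<close> of nonnegative test functions. Testing the equation with
  \<open>\<psi>^p / u^(p - 1)\<close> (Picone) shows that \<open>\<psi>\<close> tends to \<open>0\<close> almost everywhere on \<open>u x \<noteq> t\<^sub>0\<close> and that the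
  Picone remainder of \<open>\<nabla>\<psi>\<close> and \<open>(\<psi> / u) \<nabla>u\<close> tends to \<open>0\<close>. As \<open>\<nabla>u = 0\<close> almost everywhere on the level set
  \<open>u x = t\<^sub>0\<close>, the second argument tends to \<open>0\<close> almost everywhere, hence so does \<open>\<nabla>\<psi>\<close>. Then \<open>\<psi>\<close> tends to
  \<open>0\<close> in the mean by the Poincare inequality, and also in the \<open>p\<close>-norm because the gradients are
  bounded, which contradicts the normalization.\<close>

section \<open>Smooth functions\<close>

text \<open>Strictness is the difficulty. With a minimizer of the Rayleigh quotient the equality
  case of Picone's inequality would settle it, but none is constructed here. The equality case is
  therefore used in quantified form: the Picone remainder and the excess of the nonlinearity are
  both nonnegative, and along a minimizing sequence their integrals tend to 0. The level set
  \<open>u x = t\<^sub>0\<close>, where the excess vanishes, may a priori have positive measure, so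
  the excess alone does not control \<open>\<psi>\<close>. The quotient
  \<open>\<psi>^p / u^(p - 1)\<close> is not an admissible test function: \<open>u\<close> is not
  smooth and has no positive lower bound. It is replaced by \<open>((\<psi> + \<epsilon>)^p -
  \<epsilon>^p) / (u + \<delta>)^(p - 1)\<close>, with \<open>u\<close> in turn approximated by test
  functions. The price is an error of order \<open>(\<epsilon> / \<delta>)^p\<close>, which is why
  \<open>\<epsilon>\<close> is later taken as the square of \<open>\<delta>\<close>. Euler's number
  comes from the minimizer: there \<open>\<alpha> * s * t powr s = p - l\<close>, so the exponential
  equals \<open>exp ((p - l) / s)\<close>.\<close>

lemma Ck_on_SucI:
  assumes "\<And>x. (f has_derivative f' x) (at x)"
    and "\<And>v. Ck_on k UNIV (\<lambda>x. f' x v)"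
  shows "Ck_on (Suc k) UNIV f"
proof -
  have "frechet_derivative f (at x) = f' x" for x
    using assms(1) by (metis frechet_derivative_at)
  then show ?thesis
    using assms by (auto simp: differentiable_def)
qed

lemma Ck_on_Suc_derivative:
  assumes "Ck_on (Suc k) UNIV f"
  shows "(f has_derivative frechet_derivative f (at x)) (at x)"
  using assms by (auto simp: frechet_derivative_works)

lemma Ck_on_SucD: "Ck_on (Suc k) UNIV f \<Longrightarrow> Ck_on k UNIV f"
proof (induction k arbitrary: f)
  case 0
  then have "\<And>x. isCont f x"
    by (auto intro: differentiable_imp_continuous_within)
  then show ?case by (simp add: continuous_at_imp_continuous_on)
qed auto

lemma Ck_on_const: "Ck_on k UNIV (\<lambda>x. c)"
proof (induction k arbitrary: c)
  case (Suc k)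
  show ?case by (rule Ck_on_SucI[where f'="\<lambda>x v. 0"]) (auto intro: Suc)
qed simp

lemma Ck_on_add: "Ck_on k UNIV f \<Longrightarrow> Ck_on k UNIV g \<Longrightarrow> Ck_on k UNIV (\<lambda>x. f x + g x)"
proof (induction k arbitrary: f g)
  case (Suc k)
  show ?case
    by (rule Ck_on_SucI[OF has_derivative_add[OF Ck_on_Suc_derivative Ck_on_Suc_derivative]])
       (use Suc in auto)
qed (auto intro: continuous_on_add)

lemma Ck_on_mult: "Ck_on k UNIV f \<Longrightarrow> Ck_on k UNIV g \<Longrightarrow> Ck_on k UNIV (\<lambda>x. f x * g x)"
proof (induction k arbitrary: f g)
  case (Suc k)
  have "Ck_on k UNIV f" "Ck_on k UNIV g"
    using Suc.prems by (blast intro: Ck_on_SucD)+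
  then show ?case
    by (intro Ck_on_SucI[OF has_derivative_mult[OF Ck_on_Suc_derivative Ck_on_Suc_derivative]]
        Ck_on_add Suc.IH) (use Suc.prems in auto)
qed (auto intro: continuous_on_mult)

text \<open>The exponent is generalized in the induction because each derivative lowers it by
  one.\<close>

lemma Ck_on_powr:
  "Ck_on k UNIV f \<Longrightarrow> (\<And>x. f x > 0) \<Longrightarrow> Ck_on k UNIV (\<lambda>x. f x powr a)"
proof (induction k arbitrary: f a)
  case (Suc k)
  have f: "Ck_on k UNIV f"
    using Suc.prems by (blast intro: Ck_on_SucD)
  have "((\<lambda>x. f x powr a) has_derivative
      (\<lambda>v. a * f x powr (a - 1) * frechet_derivative f (at x) v)) (at x)" for x
  proof -
    have "((\<lambda>t. t powr a) has_real_derivative a * f x powr (a - 1)) (at (f x))"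
      using Suc.prems(2) by (intro has_real_derivative_powr) auto
    from has_derivative_compose[OF Ck_on_Suc_derivative[OF Suc.prems(1)]
        this[unfolded has_field_derivative_def]]
    show ?thesis by simp
  qed
  then show ?case
    by (rule Ck_on_SucI) (use Suc f in \<open>auto intro!: Ck_on_mult Ck_on_const\<close>)
qed (auto intro!: continuous_on_powr simp: less_imp_neq[symmetric])

lemma smooth_on_const: "smooth_on UNIV (\<lambda>x. c)"
  and smooth_on_add: "smooth_on UNIV f \<Longrightarrow> smooth_on UNIV g \<Longrightarrow> smooth_on UNIV (\<lambda>x. f x + g x)"
  and smooth_on_mult: "smooth_on UNIV f \<Longrightarrow> smooth_on UNIV g \<Longrightarrow> smooth_on UNIV (\<lambda>x. f x * g x)"
  and smooth_on_powr: "smooth_on UNIV f \<Longrightarrow> (\<And>x. f x > 0) \<Longrightarrow> smooth_on UNIV (\<lambda>x. f x powr a)"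
  unfolding smooth_on_def by (auto intro: Ck_on_const Ck_on_add Ck_on_mult Ck_on_powr)

lemma smooth_on_diff:
  assumes "smooth_on UNIV f" "smooth_on UNIV g"
  shows "smooth_on UNIV (\<lambda>x. f x - g x)"
  using smooth_on_add[OF assms(1) smooth_on_mult[OF smooth_on_const[of "-1"] assms(2)]] by simp

lemma smooth_on_prod:
  assumes "finite I" "\<And>i. i \<in> I \<Longrightarrow> smooth_on UNIV (f i)"
  shows "smooth_on UNIV (\<lambda>x. \<Prod>i\<in>I. f i x)"
  using assms by (induction I) (auto intro: smooth_on_const smooth_on_mult)

section \<open>Smooth cutoffs built from \<open>exp (- 1 / t)\<close>\<close>

definition flat_exp :: "nat \<Rightarrow> real \<Rightarrow> real" where
  "flat_exp n t = (if t > 0 then (1 / t) ^ n * exp (- 1 / t) else 0)"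

text \<open>Why the family carries the powers of \<open>1 / t\<close>: its span is closed under
  differentiation, so that a single induction over the order gives smoothness of all its
  members.\<close>

lemma has_derivative_flat_exp:
  "(flat_exp n has_real_derivative flat_exp (n + 2) t - real n * flat_exp (n + 1) t) (at t)"
proof (cases t "0 :: real" rule: linorder_cases)
  case less
  have "((\<lambda>t. 0) has_real_derivative 0) (at t)" by simp
  then have "(flat_exp n has_real_derivative 0) (at t)"
    by (rule has_field_derivative_transform_within_open[where S="{..<0}"])
       (use less in \<open>auto simp: flat_exp_def\<close>)
  then show ?thesis using less by (simp add: flat_exp_def)
next
  case greater
  have "((\<lambda>t. 1 / t) has_real_derivative - (1 / t)\<^sup>2) (at t)"
    using greater by (auto intro!: derivative_eq_intros simp: power2_eq_square)
  from DERIV_mult[OF DERIV_power[OF this, of n] DERIV_chain2[OF DERIV_exp DERIV_minus[OF this]]]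
  have "((\<lambda>t. (1 / t) ^ n * exp (- 1 / t)) has_real_derivative
      (real n * ((1 / t) ^ (n - Suc 0) * - (1 / t)\<^sup>2)) * exp (- 1 / t)
        + exp (- 1 / t) * (1 / t)\<^sup>2 * (1 / t) ^ n) (at t)"
    by (simp add: mult_ac)
  also have "(real n * ((1 / t) ^ (n - Suc 0) * - (1 / t)\<^sup>2)) * exp (- 1 / t)
        + exp (- 1 / t) * (1 / t)\<^sup>2 * (1 / t) ^ n
      = flat_exp (n + 2) t - real n * flat_exp (n + 1) t"
    using greater by (cases n) (simp_all add: flat_exp_def power_add power2_eq_square mult_ac)
  finally have "((\<lambda>t. (1 / t) ^ n * exp (- 1 / t)) has_real_derivative
      flat_exp (n + 2) t - real n * flat_exp (n + 1) t) (at t)" .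
  then show ?thesis
    by (rule has_field_derivative_transform_within_open[where S="{0<..}"])
       (use greater in \<open>auto simp: flat_exp_def\<close>)
next
  case equal
  \<comment> \<open>At 0 only the difference quotient from the right is not constantly 0; dividing
    by \<open>h\<close> raises the power of \<open>1 / h\<close> by one, and the exponential still
    wins.\<close>
  have "((\<lambda>h. (1 / h) ^ Suc n * exp (- 1 / h)) \<longlongrightarrow> 0) (at_right (0::real))"
    by real_asymp
  then have r: "((\<lambda>h. flat_exp n h / h) \<longlongrightarrow> 0) (at_right 0)"
    by (rule Lim_transform_eventually)
       (auto simp: eventually_at_filter flat_exp_def)
  have "((\<lambda>h. 0) \<longlongrightarrow> 0) (at_left (0::real))" by simp
  then have l: "((\<lambda>h. flat_exp n h / h) \<longlongrightarrow> 0) (at_left 0)"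
    by (rule Lim_transform_eventually)
       (auto simp: eventually_at_filter flat_exp_def)
  have "((\<lambda>h. flat_exp n h / h) \<longlongrightarrow> 0) (at 0)"
    using l r by (simp add: filterlim_split_at)
  then show ?thesis
    using equal by (simp add: DERIV_def flat_exp_def)
qed

text \<open>For an affine inner function the chain rule contributes only a constant factor, so the
  induction never leaves the class.\<close>

lemma Ck_on_flat_exp_affine:
  "Ck_on k UNIV (\<lambda>x::'a::euclidean_space. flat_exp n (c * (x \<bullet> b) + d))"
proof (induction k arbitrary: n)
  case 0
  have "continuous_on UNIV (flat_exp n)"
    by (rule continuous_at_imp_continuous_on) (rule ballI, rule DERIV_isCont, rule has_derivative_flat_exp)
  then show ?case
    by (simp, rule continuous_on_compose2) (auto intro!: continuous_intros)
next
  case (Suc k)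
  have "((\<lambda>x::'a. flat_exp n (c * (x \<bullet> b) + d)) has_derivative
      (\<lambda>v. (flat_exp (n + 2) (c * (x \<bullet> b) + d) + (- real n) * flat_exp (n + 1) (c * (x \<bullet> b) + d))
        * (c * (v \<bullet> b)))) (at x)" for x
  proof -
    have "((\<lambda>x::'a. c * (x \<bullet> b) + d) has_derivative (\<lambda>v. c * (v \<bullet> b))) (at x)"
      by (auto intro!: derivative_eq_intros)
    from has_derivative_compose[where f="\<lambda>x. c * (x \<bullet> b) + d" and g="flat_exp n", OF this
        has_derivative_flat_exp[of n "c * (x \<bullet> b) + d", unfolded has_field_derivative_def]]
    show ?thesis by simp
  qed
  then show ?case
    by (rule Ck_on_SucI) (intro Ck_on_mult Ck_on_add Ck_on_const Suc.IH)
qed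

text \<open>The functions below are roots of order \<open>j\<close> of one fixed bump function.\<close>

lemma smooth_approximation_of_box:
  fixes a b :: "'a::euclidean_space"
  obtains \<rho> :: "nat \<Rightarrow> 'a \<Rightarrow> real" where
    "\<And>j. smooth_on UNIV (\<rho> j)" "\<And>j x. 0 \<le> \<rho> j x" "\<And>j x. \<rho> j x \<le> 1"
    "\<And>j x. x \<notin> box a b \<Longrightarrow> \<rho> j x = 0" "\<And>x. (\<lambda>j. \<rho> j x) \<longlonglongrightarrow> indicator (box a b) x"
proof -
  define \<rho> where "\<rho> j x = (\<Prod>i\<in>Basis. flat_exp 0 (real (Suc j) * (x \<bullet> i) + (- real (Suc j) * (a \<bullet> i)))
      * flat_exp 0 (- real (Suc j) * (x \<bullet> i) + real (Suc j) * (b \<bullet> i)))" for j and x :: 'a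
  have e: "flat_exp 0 t = (if t > 0 then exp (- 1 / t) else 0)" for t
    by (simp add: flat_exp_def)
  have e01: "0 \<le> flat_exp 0 t" "flat_exp 0 t \<le> 1" for t
    by (auto simp: e)
  have lim: "(\<lambda>j. flat_exp 0 (real (Suc j) * t)) \<longlonglongrightarrow> (if t > 0 then 1 else 0)" for t
  proof (cases "t > 0")
    case True
    then have "(\<lambda>j. exp (- 1 / (real (Suc j) * t))) \<longlonglongrightarrow> 1" by real_asymp
    then show ?thesis using True by (simp add: e zero_less_mult_iff)
  next
    case False
    then show ?thesis by (simp add: e zero_less_mult_iff)
  qed
  have r: "\<rho> j x = (\<Prod>i\<in>Basis. flat_exp 0 (real (Suc j) * (x \<bullet> i - a \<bullet> i))
      * flat_exp 0 (real (Suc j) * (b \<bullet> i - x \<bullet> i)))" for j x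
    by (simp add: \<rho>_def algebra_simps)
  show ?thesis
  proof
    show "smooth_on UNIV (\<rho> j)" for j
      unfolding \<rho>_def smooth_on_def[of _ "\<lambda>x. flat_exp _ _"]
      by (intro smooth_on_prod smooth_on_mult)
         (auto simp: smooth_on_def intro: Ck_on_flat_exp_affine)
    show "0 \<le> \<rho> j x" for j x
      unfolding r by (intro prod_nonneg) (auto simp: e01)
    show "\<rho> j x \<le> 1" for j x
      unfolding r by (intro prod_le_1) (auto simp: e01 mult_le_one)
    show "\<rho> j x = 0" if "x \<notin> box a b" for j x
    proof -
      have "\<exists>i\<in>Basis. \<not> (a \<bullet> i < x \<bullet> i \<and> x \<bullet> i < b \<bullet> i)"
        using that unfolding mem_box(1) by (rule contrapos_np) simp
      then obtain i where "i \<in> Basis" "\<not> (a \<bullet> i < x \<bullet> i \<and> x \<bullet> i < b \<bullet> i)" ..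
      then show ?thesis
        unfolding r by (intro prod_zero) (auto simp: e zero_less_mult_iff intro!: bexI[of _ i])
    qed
    show "(\<lambda>j. \<rho> j x) \<longlonglongrightarrow> indicator (box a b) x" for x
    proof -
      have "(\<lambda>j. \<rho> j x) \<longlonglongrightarrow> (\<Prod>i\<in>Basis. (if x \<bullet> i - a \<bullet> i > 0 then 1 else 0)
          * (if b \<bullet> i - x \<bullet> i > 0 then 1 else 0))"
        unfolding r by (intro tendsto_prod tendsto_mult lim)
      also have "(\<Prod>i\<in>Basis. (if x \<bullet> i - a \<bullet> i > 0 then 1 else 0)
          * (if b \<bullet> i - x \<bullet> i > 0 then 1 else 0)) = (indicator (box a b) x :: real)"
        by (auto simp: indicator_def mem_box prod_eq_1_iff)
      finally show ?thesis .
    qed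
  qed
qed

section \<open>Gradients of test functions\<close>

definition grad :: "('a::euclidean_space \<Rightarrow> real) \<Rightarrow> 'a \<Rightarrow> 'a" where
  "grad \<phi> x = (\<Sum>b\<in>Basis. frechet_derivative \<phi> (at x) b *\<^sub>R b)"

lemma grad_eqI:
  assumes "(\<phi> has_derivative (\<lambda>v. g \<bullet> v)) (at x)"
  shows "grad \<phi> x = g"
  unfolding grad_def frechet_derivative_at[OF assms, symmetric]
  by (rule euclidean_representation)

lemma smooth_on_has_derivative:
  assumes "smooth_on UNIV \<phi>"
  shows "(\<phi> has_derivative (\<lambda>v. grad \<phi> x \<bullet> v)) (at x)"
proof -
  have "Ck_on (Suc 0) UNIV \<phi>"
    using assms unfolding smooth_on_def by blast
  then have d: "(\<phi> has_derivative frechet_derivative \<phi> (at x)) (at x)"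
    by (rule Ck_on_Suc_derivative)
  interpret linear "frechet_derivative \<phi> (at x)"
    using has_derivative_linear[OF d] .
  have "frechet_derivative \<phi> (at x) v = grad \<phi> x \<bullet> v" for v
  proof -
    have "frechet_derivative \<phi> (at x) v = frechet_derivative \<phi> (at x) (\<Sum>b\<in>Basis. (v \<bullet> b) *\<^sub>R b)"
      by (simp add: euclidean_representation)
    also have "\<dots> = grad \<phi> x \<bullet> v"
      by (simp add: sum scale grad_def inner_sum_left mult.commute inner_commute[of v])
    finally show ?thesis .
  qed
  then have "frechet_derivative \<phi> (at x) = (\<lambda>v. grad \<phi> x \<bullet> v)" by auto
  with d show ?thesis by simp
qed

lemma frechet_derivative_eq_grad:
  "smooth_on UNIV \<phi> \<Longrightarrow> frechet_derivative \<phi> (at x) v = grad \<phi> x \<bullet> v"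
  using frechet_derivative_at[OF smooth_on_has_derivative, symmetric] by metis

lemma continuous_on_grad:
  assumes "smooth_on UNIV \<phi>"
  shows "continuous_on UNIV (grad \<phi>)"
proof -
  have "Ck_on (Suc 0) UNIV \<phi>"
    using assms unfolding smooth_on_def by blast
  then show ?thesis
    unfolding grad_def by (auto intro!: continuous_intros)
qed

lemma continuous_on_smooth: "smooth_on UNIV \<phi> \<Longrightarrow> continuous_on UNIV \<phi>"
  unfolding smooth_on_def using Ck_on.simps(1) by blast

lemma borel_measurable_smooth:
  assumes "smooth_on UNIV \<phi>"
  shows "\<phi> \<in> borel_measurable borel" "grad \<phi> \<in> borel_measurable borel"
  using assms
  by (auto intro: borel_measurable_continuous_onI continuous_on_smooth continuous_on_grad)

lemma grad_mult:
  assumes "smooth_on UNIV \<phi>" "smooth_on UNIV \<psi>"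
  shows "grad (\<lambda>x. \<phi> x * \<psi> x) x = \<phi> x *\<^sub>R grad \<psi> x + \<psi> x *\<^sub>R grad \<phi> x"
  using has_derivative_mult[OF assms[THEN smooth_on_has_derivative]]
  by (intro grad_eqI) (simp add: inner_add_left mult.commute)

lemma grad_compose:
  assumes "smooth_on UNIV \<phi>" "(h has_real_derivative D) (at (\<phi> x))"
  shows "grad (\<lambda>x. h (\<phi> x)) x = D *\<^sub>R grad \<phi> x"
  using has_derivative_compose[OF smooth_on_has_derivative[OF assms(1)]
      assms(2)[unfolded has_field_derivative_def]]
  by (intro grad_eqI) simp

lemma has_real_derivative_along_line:
  assumes "smooth_on UNIV \<phi>"
  shows "((\<lambda>t. \<phi> (x + t *\<^sub>R y)) has_real_derivative grad \<phi> (x + t *\<^sub>R y) \<bullet> y) (at t)"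
proof -
  have "((\<lambda>t. x + t *\<^sub>R y) has_derivative (\<lambda>h. h *\<^sub>R y)) (at t)"
    by (auto intro!: derivative_eq_intros)
  from has_derivative_compose[OF this smooth_on_has_derivative[OF assms]]
  show ?thesis by (simp add: has_field_derivative_def mult_commute_abs)
qed

section \<open>Supports, bounds and integrability of test functions\<close>

lemma test_functions_smooth: "\<phi> \<in> test_functions \<Omega> \<Longrightarrow> smooth_on UNIV \<phi>"
  by (simp add: test_functions_def)

lemma test_functionsI:
  assumes "\<phi> \<in> test_functions \<Omega>" "smooth_on UNIV \<psi>" "\<And>x. \<phi> x = 0 \<Longrightarrow> \<psi> x = 0"
  shows "\<psi> \<in> test_functions \<Omega>"
proof -
  have "closure {x. \<psi> x \<noteq> 0} \<subseteq> closure {x. \<phi> x \<noteq> 0}"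
    using assms(3) by (intro closure_mono) auto
  then show ?thesis
    using assms(1,2) compact_Int_closed[of "closure {x. \<phi> x \<noteq> 0}" "closure {x. \<psi> x \<noteq> 0}"]
    unfolding test_functions_def by (auto simp: Int_absorb1)
qed

lemma test_functions_mult:
  "\<phi> \<in> test_functions \<Omega> \<Longrightarrow> smooth_on UNIV \<psi> \<Longrightarrow> (\<lambda>x. \<phi> x * \<psi> x) \<in> test_functions \<Omega>"
  by (rule test_functionsI) (auto intro: smooth_on_mult test_functions_smooth)

lemma test_functions_support:
  assumes "\<phi> \<in> test_functions \<Omega>"
  obtains K where "compact K" "K \<subseteq> \<Omega>" "\<And>x. x \<notin> K \<Longrightarrow> \<phi> x = 0" "\<And>x. x \<notin> K \<Longrightarrow> grad \<phi> x = 0"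
proof
  let ?K = "closure {x. \<phi> x \<noteq> 0}"
  show "compact ?K" "?K \<subseteq> \<Omega>"
    using assms by (auto simp: test_functions_def)
  show z: "\<phi> x = 0" if "x \<notin> ?K" for x
    using that closure_subset[of "{x. \<phi> x \<noteq> 0}"] by auto
  show "grad \<phi> x = 0" if "x \<notin> ?K" for x
  proof (rule grad_eqI)
    have "((\<lambda>_. 0) has_derivative (\<lambda>v. 0)) (at x)" by simp
    then have "(\<phi> has_derivative (\<lambda>v. 0)) (at x)"
      by (rule has_derivative_transform_within_open[where s="- ?K"]) (use that in \<open>auto intro: z\<close>)
    then show "(\<phi> has_derivative (\<lambda>v. 0 \<bullet> v)) (at x)" by simp
  qed
qed

lemma test_functions_zero_outside:
  assumes "\<phi> \<in> test_functions \<Omega>" "x \<notin> \<Omega>"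
  shows "\<phi> x = 0" "grad \<phi> x = 0"
  using test_functions_support[OF assms(1)] assms(2) by (metis subsetD)+

lemma integrable_continuous_compact_support:
  fixes f :: "'a::euclidean_space \<Rightarrow> 'b::{banach,second_countable_topology}"
  assumes "continuous_on UNIV f" "compact K" "\<And>x. x \<notin> K \<Longrightarrow> f x = 0"
  shows "integrable lborel f"
proof -
  have "integrable lborel (\<lambda>x. indicator K x *\<^sub>R f x)"
    using assms by (intro borel_integrable_compact) (auto intro: continuous_on_subset)
  also have "(\<lambda>x. indicator K x *\<^sub>R f x) = f"
    using assms(3) by (auto simp: indicator_def)
  finally show ?thesis .
qed

lemma bounded_continuous_compact_support:
  fixes f :: "'a::euclidean_space \<Rightarrow> 'b::real_normed_vector"
  assumes "continuous_on UNIV f" "compact K" "\<And>x. x \<notin> K \<Longrightarrow> f x = 0"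
  obtains B where "B \<ge> 0" "\<And>x. norm (f x) \<le> B"
proof -
  have "bounded (f ` K)"
    using assms by (intro compact_imp_bounded compact_continuous_image)
      (auto intro: continuous_on_subset)
  then obtain B where B: "B > 0" "\<forall>x\<in>K. norm (f x) \<le> B"
    by (auto simp: bounded_pos)
  then have "norm (f x) \<le> B" for x
    using assms(3)[of x] by (cases "x \<in> K") auto
  with B show ?thesis by (intro that[of B]) auto
qed

lemma test_functions_bounded:
  assumes "\<phi> \<in> test_functions \<Omega>"
  obtains B where "B \<ge> 0" "\<And>x. \<bar>\<phi> x\<bar> \<le> B" "\<And>x. norm (grad \<phi> x) \<le> B"
proof -
  obtain K where K: "compact K" "\<And>x. x \<notin> K \<Longrightarrow> \<phi> x = 0" "\<And>x. x \<notin> K \<Longrightarrow> grad \<phi> x = 0"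
    using test_functions_support[OF assms] by metis
  note s = test_functions_smooth[OF assms]
  obtain B1 where "B1 \<ge> 0" "\<And>x. norm (\<phi> x) \<le> B1"
    using bounded_continuous_compact_support[OF continuous_on_smooth[OF s] K(1,2)] by blast
  moreover obtain B2 where "B2 \<ge> 0" "\<And>x. norm (grad \<phi> x) \<le> B2"
    using bounded_continuous_compact_support[OF continuous_on_grad[OF s] K(1,3)] by blast
  ultimately show ?thesis
    by (intro that[of "max B1 B2"]) (auto simp: le_max_iff_disj)
qed

lemma integrable_test_powr:
  assumes "\<phi> \<in> test_functions \<Omega>" "p > 0"
  shows "integrable lborel (\<lambda>x. \<bar>\<phi> x\<bar> powr p)" "integrable lborel (\<lambda>x. norm (grad \<phi> x) powr p)"
proof -
  obtain K where K: "compact K" "\<And>x. x \<notin> K \<Longrightarrow> \<phi> x = 0" "\<And>x. x \<notin> K \<Longrightarrow> grad \<phi> x = 0"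
    using test_functions_support[OF assms(1)] by metis
  have c: "continuous_on UNIV \<phi>" "continuous_on UNIV (grad \<phi>)"
    using assms test_functions_smooth continuous_on_smooth continuous_on_grad by blast+
  show "integrable lborel (\<lambda>x. \<bar>\<phi> x\<bar> powr p)"
    by (rule integrable_continuous_compact_support[OF _ K(1)])
       (use assms(2) K c in \<open>auto intro!: continuous_intros continuous_on_powr'\<close>)
  show "integrable lborel (\<lambda>x. norm (grad \<phi> x) powr p)"
    by (rule integrable_continuous_compact_support[OF _ K(1)])
       (use assms(2) K c in \<open>auto intro!: continuous_intros continuous_on_powr'\<close>)
qed

lemma lebesgue_on_eq_lborel:
  fixes f :: "'a::euclidean_space \<Rightarrow> 'b::{banach,second_countable_topology}"
  assumes "open \<Omega>" "f \<in> borel_measurable borel" "\<And>x. x \<notin> \<Omega> \<Longrightarrow> f x = 0"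
  shows "integrable (lebesgue_on \<Omega>) f \<longleftrightarrow> integrable lborel f"
    and "integral\<^sup>L (lebesgue_on \<Omega>) f = integral\<^sup>L lborel f"
proof -
  have S: "\<Omega> \<inter> space lebesgue \<in> sets lebesgue"
    using assms(1) by auto
  have e: "(\<lambda>x. indicator \<Omega> x *\<^sub>R f x) = f"
    using assms(3) by (auto simp: indicator_def)
  show "integrable (lebesgue_on \<Omega>) f \<longleftrightarrow> integrable lborel f"
    unfolding integrable_restrict_space[OF S] e using assms(2) by (intro integrable_completion) simp
  show "integral\<^sup>L (lebesgue_on \<Omega>) f = integral\<^sup>L lborel f"
    unfolding integral_restrict_space[OF S] e using assms(2) by (intro integral_completion) simp
qed

text \<open>The graph of the convex function \<open>t powr p\<close> lies above its tangent at
  \<open>a\<close>; in this form it is Young's inequality. It takes the place of Jensen's inequality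
  below and also gives the sign of the Picone remainder.\<close>

lemma powr_tangent:
  fixes a b p :: real
  assumes "p \<ge> 1" "a \<ge> 0" "b \<ge> 0"
  shows "p * a powr (p - 1) * b \<le> (p - 1) * a powr p + b powr p"
proof (cases "p = 1")
  case True
  then show ?thesis using assms by auto
next
  case False
  define q where "q = p / (p - 1)"
  have "1 / p + 1 / q = 1" "q > 1"
    using False assms by (auto simp: q_def field_simps)
  then have "b * a powr (p - 1) \<le> b powr p / p + (a powr (p - 1)) powr q / q"
    using False assms by (intro Youngs_inequality) auto
  also have "(a powr (p - 1)) powr q = a powr p"
    using False by (simp add: powr_powr q_def)
  finally show ?thesis
    using False assms by (simp add: q_def field_simps)
qed

section \<open>Translations and difference quotients\<close>

lemma lborel_translation:
  fixes f :: "'a::euclidean_space \<Rightarrow> real"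
  assumes "f \<in> borel_measurable borel"
  shows "(\<integral>x. f (c + x) \<partial>lborel) = (\<integral>x. f x \<partial>lborel)"
    and "integrable lborel (\<lambda>x. f (c + x)) \<longleftrightarrow> integrable lborel f"
proof -
  have "(\<integral>x. f x \<partial>distr lborel borel ((+) c)) = (\<integral>x. f (c + x) \<partial>lborel)"
    using assms by (intro integral_distr) auto
  then show "(\<integral>x. f (c + x) \<partial>lborel) = (\<integral>x. f x \<partial>lborel)"
    by (simp add: lborel_distr_plus)
  have "integrable (distr lborel borel ((+) c)) f \<longleftrightarrow> integrable lborel (\<lambda>x. f (c + x))"
    using assms by (intro integrable_distr_eq) auto
  then show "integrable lborel (\<lambda>x. f (c + x)) \<longleftrightarrow> integrable lborel f"
    by (simp add: lborel_distr_plus)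
qed

lemma nn_integral_lborel_translation:
  fixes f :: "'a::euclidean_space \<Rightarrow> ennreal"
  assumes "f \<in> borel_measurable borel"
  shows "(\<integral>\<^sup>+x. f (c + x) \<partial>lborel) = (\<integral>\<^sup>+x. f x \<partial>lborel)"
proof -
  have "(\<integral>\<^sup>+x. f x \<partial>distr lborel borel ((+) c)) = (\<integral>\<^sup>+x. f (c + x) \<partial>lborel)"
    using assms by (intro nn_integral_distr) auto
  then show ?thesis by (simp add: lborel_distr_plus)
qed

text \<open>Jensen's inequality for the mean of \<open>D\<close> over the unit interval, obtained by
  integrating the tangent inequality at the point \<open>a\<close>. The right-hand side is a
  nonnegative extended integral so that it can be integrated over a parameter without checking
  integrability.\<close>

lemma powr_increment_le:
  fixes F D :: "real \<Rightarrow> real"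
  assumes "p \<ge> 1" and F: "\<And>t. (F has_real_derivative D t) (at t)" and D: "continuous_on UNIV D"
  shows "ennreal (\<bar>F 1 - F 0\<bar> powr p) \<le> (\<integral>\<^sup>+t. ennreal (indicator {0..1} t * \<bar>D t\<bar> powr p) \<partial>lborel)"
proof -
  define a where "a = \<bar>F 1 - F 0\<bar>"
  have cont: "continuous_on {0..1} D"
    using D by (rule continuous_on_subset) auto
  have hb: "has_bochner_integral lborel (\<lambda>t. indicator {0..1} t *\<^sub>R D t) (F 1 - F 0)"
    using F cont
    by (intro has_bochner_integral_FTC_Icc)
       (auto simp: has_real_derivative_iff_has_vector_derivative intro: has_vector_derivative_at_within)
  have iD: "integrable lborel (\<lambda>t. indicator {0..1} t *\<^sub>R \<bar>D t\<bar>)"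
    using cont by (intro borel_integrable_compact) (auto intro!: continuous_intros)
  have iP: "integrable lborel (\<lambda>t. indicator {0..1} t *\<^sub>R \<bar>D t\<bar> powr p)"
    using cont assms(1) by (intro borel_integrable_compact) (auto intro!: continuous_intros continuous_on_powr')
  have i1: "integrable lborel (\<lambda>t. indicator {0..1::real} t *\<^sub>R c)" for c :: real
    by (intro borel_integrable_compact) auto
  have "a = \<bar>\<integral>t. indicator {0..1} t *\<^sub>R D t \<partial>lborel\<bar>"
    using has_bochner_integral_integral_eq[OF hb] by (simp add: a_def)
  also have "\<dots> \<le> (\<integral>t. \<bar>indicator {0..1} t *\<^sub>R D t\<bar> \<partial>lborel)"
    by (rule integral_abs_bound)
  also have "\<dots> = (\<integral>t. indicator {0..1} t *\<^sub>R \<bar>D t\<bar> \<partial>lborel)"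
    by (rule Bochner_Integration.integral_cong) (auto simp: indicator_def)
  finally have a: "a \<le> (\<integral>t. indicator {0..1} t *\<^sub>R \<bar>D t\<bar> \<partial>lborel)" .
  \<comment> \<open>A trivial identity, written so that the single factor \<open>a\<close> can be
    replaced by the mean of \<open>\<bar>D t\<bar>\<close>; what results is the integrated
    tangent.\<close>
  have "a powr p = p * a powr (p - 1) * a - (p - 1) * a powr p"
  proof (cases "a = 0")
    case False
    then have "a powr p = a powr (p - 1) * a"
      using powr_add[of a "p - 1" 1] by (simp add: a_def)
    then show ?thesis by (simp add: algebra_simps)
  qed simp
  also have "\<dots> \<le> p * a powr (p - 1) * (\<integral>t. indicator {0..1} t *\<^sub>R \<bar>D t\<bar> \<partial>lborel) - (p - 1) * a powr p"
    using a assms(1) by (intro diff_right_mono mult_left_mono) auto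
  also have "\<dots> = (\<integral>t. p * a powr (p - 1) * (indicator {0..1} t *\<^sub>R \<bar>D t\<bar>)
      - indicator {0..1} t *\<^sub>R ((p - 1) * a powr p) \<partial>lborel)"
    using iD i1 by (subst Bochner_Integration.integral_diff) auto
  also have "\<dots> \<le> (\<integral>t. indicator {0..1} t *\<^sub>R \<bar>D t\<bar> powr p \<partial>lborel)"
  proof (rule integral_mono)
    show "integrable lborel (\<lambda>t. p * a powr (p - 1) * (indicator {0..1} t *\<^sub>R \<bar>D t\<bar>)
      - indicator {0..1} t *\<^sub>R ((p - 1) * a powr p))"
      using iD i1 by (intro Bochner_Integration.integrable_diff integrable_mult_right) auto
    show "p * a powr (p - 1) * (indicator {0..1} t *\<^sub>R \<bar>D t\<bar>)
      - indicator {0..1} t *\<^sub>R ((p - 1) * a powr p) \<le> indicator {0..1} t *\<^sub>R \<bar>D t\<bar> powr p" for t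
      using powr_tangent[OF assms(1), of a "\<bar>D t\<bar>"] by (auto simp: a_def indicator_def)
  qed (rule iP)
  finally have "ennreal (a powr p) \<le> ennreal (\<integral>t. indicator {0..1} t *\<^sub>R \<bar>D t\<bar> powr p \<partial>lborel)"
    by (rule ennreal_leI)
  also have "\<dots> = (\<integral>\<^sup>+t. ennreal (indicator {0..1} t * \<bar>D t\<bar> powr p) \<partial>lborel)"
    using iP by (subst nn_integral_eq_integral) auto
  finally show ?thesis by (simp add: a_def)
qed

text \<open>The increment is estimated along the segment from \<open>x\<close> to
  \<open>x + y\<close> by \<open>powr_increment_le\<close>. After Tonelli the integral over
  \<open>x\<close> is the same for every point \<open>t\<close> of the segment, by translation
  invariance.\<close>

lemma translation_estimate:
  fixes \<phi> :: "'a::euclidean_space \<Rightarrow> real"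
  assumes "\<phi> \<in> test_functions \<Omega>" "p \<ge> 1"
  shows "integrable lborel (\<lambda>x. \<bar>\<phi> (x + y) - \<phi> x\<bar> powr p)"
    and "(\<integral>x. \<bar>\<phi> (x + y) - \<phi> x\<bar> powr p \<partial>lborel) \<le> norm y powr p * (\<integral>x. norm (grad \<phi> x) powr p \<partial>lborel)"
proof -
  note s = test_functions_smooth[OF assms(1)]
  have m[measurable]: "\<phi> \<in> borel_measurable borel" "grad \<phi> \<in> borel_measurable borel"
    using borel_measurable_smooth[OF s] .
  let ?I = "\<integral>x. norm (grad \<phi> x) powr p \<partial>lborel"
  have I: "(\<integral>\<^sup>+x. ennreal (norm (grad \<phi> x) powr p) \<partial>lborel) = ennreal ?I"
    using integrable_test_powr[OF assms(1), of p] assms(2) by (intro nn_integral_eq_integral) auto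
  have "(\<integral>\<^sup>+x. ennreal (\<bar>\<phi> (x + y) - \<phi> x\<bar> powr p) \<partial>lborel)
      \<le> (\<integral>\<^sup>+x. (\<integral>\<^sup>+t. ennreal (indicator {0..1} t * \<bar>grad \<phi> (x + t *\<^sub>R y) \<bullet> y\<bar> powr p) \<partial>lborel) \<partial>lborel)"
  proof (rule nn_integral_mono)
    fix x
    note has_real_derivative_along_line[OF s, of x y]
    moreover have "continuous_on UNIV (\<lambda>t. grad \<phi> (x + t *\<^sub>R y) \<bullet> y)"
      by (intro continuous_intros continuous_on_compose2[OF continuous_on_grad[OF s]]) auto
    ultimately show "ennreal (\<bar>\<phi> (x + y) - \<phi> x\<bar> powr p)
      \<le> (\<integral>\<^sup>+t. ennreal (indicator {0..1} t * \<bar>grad \<phi> (x + t *\<^sub>R y) \<bullet> y\<bar> powr p) \<partial>lborel)"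
      using powr_increment_le[OF assms(2), of "\<lambda>t. \<phi> (x + t *\<^sub>R y)"] by simp
  qed
  also have "\<dots> \<le> (\<integral>\<^sup>+x. (\<integral>\<^sup>+t. ennreal (indicator {0..1} t)
      * (ennreal (norm y powr p) * ennreal (norm (grad \<phi> (t *\<^sub>R y + x)) powr p)) \<partial>lborel) \<partial>lborel)"
  proof (intro nn_integral_mono)
    fix x :: 'a and t :: real
    have "\<bar>grad \<phi> (x + t *\<^sub>R y) \<bullet> y\<bar> powr p \<le> (norm y * norm (grad \<phi> (t *\<^sub>R y + x))) powr p"
      using Cauchy_Schwarz_ineq2[of "grad \<phi> (x + t *\<^sub>R y)" y] assms(2)
      by (intro powr_mono2) (auto simp: mult.commute add.commute)
    then show "ennreal (indicator {0..1} t * \<bar>grad \<phi> (x + t *\<^sub>R y) \<bullet> y\<bar> powr p)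
      \<le> ennreal (indicator {0..1} t)
        * (ennreal (norm y powr p) * ennreal (norm (grad \<phi> (t *\<^sub>R y + x)) powr p))"
      by (auto simp: indicator_def powr_mult ennreal_mult[symmetric] intro!: ennreal_leI)
  qed
  also have "\<dots> = (\<integral>\<^sup>+t. (\<integral>\<^sup>+x. ennreal (indicator {0..1} t)
      * (ennreal (norm y powr p) * ennreal (norm (grad \<phi> (t *\<^sub>R y + x)) powr p)) \<partial>lborel) \<partial>lborel)"
    by (rule lborel_pair.Fubini') measurable
  also have "\<dots> = (\<integral>\<^sup>+t. ennreal (indicator {0..1::real} t)
      * (ennreal (norm y powr p) * ennreal ?I) \<partial>lborel)"
  proof (intro nn_integral_cong)
    fix t :: real
    have "(\<integral>\<^sup>+x. ennreal (norm (grad \<phi> (t *\<^sub>R y + x)) powr p) \<partial>lborel) = ennreal ?I"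
      unfolding I[symmetric] by (rule nn_integral_lborel_translation) measurable
    then show "(\<integral>\<^sup>+x. ennreal (indicator {0..1} t)
      * (ennreal (norm y powr p) * ennreal (norm (grad \<phi> (t *\<^sub>R y + x)) powr p)) \<partial>lborel)
      = ennreal (indicator {0..1} t) * (ennreal (norm y powr p) * ennreal ?I)"
      by (simp add: nn_integral_cmult)
  qed
  also have "\<dots> = ennreal (norm y powr p) * ennreal ?I"
    by (simp add: nn_integral_multc ennreal_indicator)
  also have "\<dots> = ennreal (norm y powr p * ?I)"
    by (simp add: ennreal_mult)
  finally have *: "(\<integral>\<^sup>+x. ennreal (\<bar>\<phi> (x + y) - \<phi> x\<bar> powr p) \<partial>lborel) \<le> ennreal (norm y powr p * ?I)" .
  show i: "integrable lborel (\<lambda>x. \<bar>\<phi> (x + y) - \<phi> x\<bar> powr p)"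
  proof (rule integrableI_bounded)
    show "(\<integral>\<^sup>+x. ennreal (norm (\<bar>\<phi> (x + y) - \<phi> x\<bar> powr p)) \<partial>lborel) < \<infinity>"
      using * by (simp add: le_less_trans)
  qed measurable
  have "ennreal (\<integral>x. \<bar>\<phi> (x + y) - \<phi> x\<bar> powr p \<partial>lborel) \<le> ennreal (norm y powr p * ?I)"
    using * nn_integral_eq_integral[OF i] by simp
  then show "(\<integral>x. \<bar>\<phi> (x + y) - \<phi> x\<bar> powr p \<partial>lborel) \<le> norm y powr p * ?I"
    by (simp add: ennreal_le_iff)
qed

section \<open>Poincare and interpolation inequalities\<close>

text \<open>Translation invariance makes the integral of every difference quotient vanish, and
  dominated convergence carries this over to the directional derivative.\<close>

lemma integral_grad_eq_0:
  fixes \<phi> :: "'a::euclidean_space \<Rightarrow> real"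
  assumes "\<phi> \<in> test_functions \<Omega>"
  shows "(\<integral>x. grad \<phi> x \<bullet> b \<partial>lborel) = 0"
proof -
  note s = test_functions_smooth[OF assms]
  have m[measurable]: "\<phi> \<in> borel_measurable borel" "grad \<phi> \<in> borel_measurable borel"
    using borel_measurable_smooth[OF s] .
  obtain K where K: "compact K" "\<And>x. x \<notin> K \<Longrightarrow> \<phi> x = 0"
    using test_functions_support[OF assms] by metis
  obtain R where R: "\<And>x. x \<in> K \<Longrightarrow> norm x \<le> R"
    using compact_imp_bounded[OF K(1)] by (auto simp: bounded_iff)
  obtain B where B: "B \<ge> 0" "\<And>x. norm (grad \<phi> x) \<le> B"
    using test_functions_bounded[OF assms] by metis
  define q where "q n x = (\<phi> (x + (1 / real (Suc n)) *\<^sub>R b) - \<phi> x) / (1 / real (Suc n))" for n x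
  have lip: "\<bar>\<phi> x - \<phi> y\<bar> \<le> B * norm (x - y)" for x y
  proof -
    have "norm (\<phi> x - \<phi> y) \<le> B * norm (x - y)"
    proof (rule differentiable_bound[of UNIV \<phi> "\<lambda>x v. grad \<phi> x \<bullet> v"])
      show "onorm (\<lambda>v. grad \<phi> x \<bullet> v) \<le> B" for x
      proof (rule onorm_le)
        fix v
        have "\<bar>grad \<phi> x \<bullet> v\<bar> \<le> norm (grad \<phi> x) * norm v"
          by (rule Cauchy_Schwarz_ineq2)
        also have "\<dots> \<le> B * norm v"
          using B by (intro mult_right_mono) auto
        finally show "norm (grad \<phi> x \<bullet> v) \<le> B * norm v" by simp
      qed
    qed (auto intro: smooth_on_has_derivative s)
    then show ?thesis by simp
  qed
  \<comment> \<open>The steps are at most 1, so all difference quotients vanish outside one ball;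
    inside it the Lipschitz constant \<open>B\<close> bounds them.\<close>
  let ?w = "\<lambda>x. indicator (cball 0 (R + norm b)) x *\<^sub>R (B * norm b)"
  have "(\<lambda>n. \<integral>x. q n x \<partial>lborel) \<longlonglongrightarrow> (\<integral>x. grad \<phi> x \<bullet> b \<partial>lborel)"
  proof (rule integral_dominated_convergence[where w="?w"])
    show "AE x in lborel. (\<lambda>n. q n x) \<longlonglongrightarrow> grad \<phi> x \<bullet> b"
    proof (rule AE_I2)
      fix x
      have "(\<lambda>h. (\<phi> (x + h *\<^sub>R b) - \<phi> x) / h) \<midarrow>0\<rightarrow> grad \<phi> x \<bullet> b"
        using has_real_derivative_along_line[OF s, of x b 0] by (simp add: DERIV_def)
      moreover have "filterlim (\<lambda>n. 1 / real (Suc n)) (at 0) sequentially"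
        using LIMSEQ_Suc[OF lim_1_over_n] by (auto simp: filterlim_at)
      ultimately show "(\<lambda>n. q n x) \<longlonglongrightarrow> grad \<phi> x \<bullet> b"
        unfolding q_def by (rule filterlim_compose)
    qed
    show "integrable lborel ?w"
      by (intro borel_integrable_compact) auto
    show "AE x in lborel. norm (q n x) \<le> ?w x" for n
    proof (rule AE_I2)
      fix x
      define h where "h = 1 / real (Suc n)"
      have h: "0 < h" "h \<le> 1" by (auto simp: h_def)
      show "norm (q n x) \<le> ?w x"
      proof (cases "x \<in> cball 0 (R + norm b)")
        case True
        have "\<bar>\<phi> (x + h *\<^sub>R b) - \<phi> x\<bar> \<le> B * (h * norm b)"
          using lip[of "x + h *\<^sub>R b" x] h by simp
        then show ?thesis
          using True h unfolding q_def h_def[symmetric] by (simp add: abs_div field_simps)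
      next
        case False
        have "norm x \<le> norm (x + h *\<^sub>R b) + norm b"
        proof -
          have "norm x \<le> norm (x + h *\<^sub>R b) + norm (h *\<^sub>R b)"
            using norm_triangle_ineq4[of "x + h *\<^sub>R b" "h *\<^sub>R b"] by simp
          moreover have "norm (h *\<^sub>R b) \<le> norm b"
            using h mult_right_mono[of h 1 "norm b"] by simp
          ultimately show ?thesis by linarith
        qed
        then have "x \<notin> K" "x + h *\<^sub>R b \<notin> K"
          using False R[of x] R[of "x + h *\<^sub>R b"] norm_ge_zero[of b] by (auto simp del: norm_ge_zero)
        then show ?thesis
          using K(2) False unfolding q_def h_def[symmetric] by simp
      qed
    qed
  qed (auto simp: q_def)
  moreover have "(\<integral>x. q n x \<partial>lborel) = 0" for n
  proof -
    have i: "integrable lborel \<phi>"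
      by (rule integrable_continuous_compact_support[OF continuous_on_smooth[OF s] K])
    have i2: "integrable lborel (\<lambda>x. \<phi> (x + (1 / real (Suc n)) *\<^sub>R b))"
      using lborel_translation(2)[OF m(1), of "(1 / real (Suc n)) *\<^sub>R b"] i
      by (simp add: add.commute)
    have "(\<integral>x. q n x \<partial>lborel)
        = ((\<integral>x. \<phi> (x + (1 / real (Suc n)) *\<^sub>R b) \<partial>lborel) - (\<integral>x. \<phi> x \<partial>lborel)) / (1 / real (Suc n))"
      unfolding q_def integral_divide_zero Bochner_Integration.integral_diff[OF i2 i] ..
    then show ?thesis
      using lborel_translation(1)[OF m(1), of "(1 / real (Suc n)) *\<^sub>R b"]
      by (simp add: add.commute)
  qed
  ultimately show ?thesis
    by (simp add: LIMSEQ_const_iff)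
qed

text \<open>Only one factor has compact support, but that makes the product a test function, to
  which \<open>integral_grad_eq_0\<close> applies.\<close>

lemma integration_by_parts:
  fixes \<phi> :: "'a::euclidean_space \<Rightarrow> real"
  assumes "smooth_on UNIV \<phi>" "\<psi> \<in> test_functions \<Omega>"
  shows "(\<integral>x. \<phi> x * (grad \<psi> x \<bullet> b) \<partial>lborel) = - (\<integral>x. (grad \<phi> x \<bullet> b) * \<psi> x \<partial>lborel)"
proof -
  note s = test_functions_smooth[OF assms(2)]
  obtain K where K: "compact K" "\<And>x. x \<notin> K \<Longrightarrow> \<psi> x = 0" "\<And>x. x \<notin> K \<Longrightarrow> grad \<psi> x = 0"
    using test_functions_support[OF assms(2)] by metis
  note c = continuous_on_smooth[OF assms(1)] continuous_on_smooth[OF s]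
    continuous_on_grad[OF assms(1)] continuous_on_grad[OF s]
  have i: "integrable lborel (\<lambda>x. \<phi> x * (grad \<psi> x \<bullet> b))"
    by (rule integrable_continuous_compact_support[OF _ K(1)]) (use c K in \<open>auto intro!: continuous_intros\<close>)
  have j: "integrable lborel (\<lambda>x. (grad \<phi> x \<bullet> b) * \<psi> x)"
    by (rule integrable_continuous_compact_support[OF _ K(1)]) (use c K in \<open>auto intro!: continuous_intros\<close>)
  have "0 = (\<integral>x. grad (\<lambda>x. \<psi> x * \<phi> x) x \<bullet> b \<partial>lborel)"
    using integral_grad_eq_0[OF test_functions_mult[OF assms(2,1)]] by simp
  also have "\<dots> = (\<integral>x. \<phi> x * (grad \<psi> x \<bullet> b) + (grad \<phi> x \<bullet> b) * \<psi> x \<partial>lborel)"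
    unfolding grad_mult[OF s assms(1)] by (simp add: inner_add_left algebra_simps)
  also have "\<dots> = (\<integral>x. \<phi> x * (grad \<psi> x \<bullet> b) \<partial>lborel) + (\<integral>x. (grad \<phi> x \<bullet> b) * \<psi> x \<partial>lborel)"
    by (rule Bochner_Integration.integral_add[OF i j])
  finally show ?thesis by simp
qed

text \<open>A translation longer than the diameter moves the domain off itself. Then
  \<open>\<phi> x\<close> and \<open>\<phi> (x + y)\<close> are never both nonzero, so the
  difference in \<open>translation_estimate\<close> dominates \<open>\<phi>\<close> itself.\<close>

theorem poincare_inequality:
  fixes \<Omega> :: "'a::euclidean_space set"
  assumes "bounded \<Omega>" "p \<ge> 1"
  obtains C where "C > 0" "\<And>\<phi>. \<phi> \<in> test_functions \<Omega> \<Longrightarrow>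
    (\<integral>x. \<bar>\<phi> x\<bar> powr p \<partial>lborel) \<le> C * (\<integral>x. norm (grad \<phi> x) powr p \<partial>lborel)"
proof -
  obtain R where R: "R > 0" "\<And>x. x \<in> \<Omega> \<Longrightarrow> norm x \<le> R"
    using assms(1) by (auto simp: bounded_pos)
  \<comment> \<open>Two points of the domain are at distance at most \<open>2 * R\<close>, less than
    the length of \<open>y\<close>.\<close>
  obtain y :: 'a where y: "norm y = 3 * R"
    using R(1) vector_choose_size[of "3 * R"] by auto
  show ?thesis
  proof
    show "norm y powr p > 0" using y R by auto
    fix \<phi> assume \<phi>: "\<phi> \<in> test_functions \<Omega>"
    have i: "integrable lborel (\<lambda>x. \<bar>\<phi> x\<bar> powr p)"
      using assms(2) by (intro integrable_test_powr[OF \<phi>]) auto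
    have "(\<integral>x. \<bar>\<phi> x\<bar> powr p \<partial>lborel) \<le> (\<integral>x. \<bar>\<phi> (x + y) - \<phi> x\<bar> powr p \<partial>lborel)"
    proof (rule integral_mono[OF i translation_estimate(1)[OF \<phi> assms(2)]])
      fix x
      have "\<phi> x = 0 \<or> \<phi> (x + y) = 0"
      proof (rule ccontr)
        assume "\<not> ?thesis"
        then have "x \<in> \<Omega>" "x + y \<in> \<Omega>"
          using test_functions_zero_outside(1)[OF \<phi>] by blast+
        then have "norm x \<le> R" "norm (x + y) \<le> R" using R by auto
        then show False
          using y R(1) norm_triangle_ineq4[of "x + y" x] by simp
      qed
      then show "\<bar>\<phi> x\<bar> powr p \<le> \<bar>\<phi> (x + y) - \<phi> x\<bar> powr p" by auto
    qed
    also have "\<dots> \<le> norm y powr p * (\<integral>x. norm (grad \<phi> x) powr p \<partial>lborel)"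
      by (rule translation_estimate(2)[OF \<phi> assms(2)])
    finally show "(\<integral>x. \<bar>\<phi> x\<bar> powr p \<partial>lborel) \<le> norm y powr p * (\<integral>x. norm (grad \<phi> x) powr p \<partial>lborel)" .
  qed
qed

text \<open>This takes the place of the Rellich compactness theorem: a sequence that is bounded in the
  Sobolev norm and tends to \<open>0\<close> in the mean cannot keep its \<open>p\<close>-norm (take \<open>h\<close> small). Integrate
  \<open>\<bar>a\<bar>^p \<le> 2^p * \<bar>b - a\<bar>^p + 2 * \<bar>a\<bar>^(p - 1) * \<bar>b\<bar>\<close> with \<open>a = \<phi> x\<close> and \<open>b = \<phi> (x + y)\<close> over
  \<open>x\<close> and \<open>norm y \<le> h\<close>.\<close>

lemma interpolation_inequality:
  fixes \<phi> :: "'a::euclidean_space \<Rightarrow> real"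
  assumes \<phi>: "\<phi> \<in> test_functions \<Omega>" and p: "p > 1" and h: "h \<ge> 0"
  shows "measure lborel (cball (0::'a) h) * (\<integral>x. \<bar>\<phi> x\<bar> powr p \<partial>lborel)
    \<le> measure lborel (cball (0::'a) h) * (2 powr p * h powr p * (\<integral>x. norm (grad \<phi> x) powr p \<partial>lborel))
      + 2 * (\<integral>x. \<bar>\<phi> x\<bar> powr (p - 1) \<partial>lborel) * (\<integral>x. \<bar>\<phi> x\<bar> \<partial>lborel)"
proof -
  define P where "P = (\<integral>x. \<bar>\<phi> x\<bar> powr p \<partial>lborel)"
  define I where "I = (\<integral>x. norm (grad \<phi> x) powr p \<partial>lborel)"
  define Q where "Q = (\<integral>x. \<bar>\<phi> x\<bar> powr (p - 1) \<partial>lborel)"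
  define N where "N = (\<integral>x. \<bar>\<phi> x\<bar> \<partial>lborel)"
  define \<beta> where "\<beta> = measure lborel (cball (0::'a) h)"
  note s = test_functions_smooth[OF \<phi>]
  have m[measurable]: "\<phi> \<in> borel_measurable borel"
    using borel_measurable_smooth[OF s] by blast
  have iP: "integrable lborel (\<lambda>x. \<bar>\<phi> x\<bar> powr p)" and iQ: "integrable lborel (\<lambda>x. \<bar>\<phi> x\<bar> powr (p - 1))"
    using integrable_test_powr(1)[OF \<phi>] p by auto
  have iN: "integrable lborel (\<lambda>x. \<bar>\<phi> x\<bar>)"
    using integrable_test_powr(1)[OF \<phi>, of 1] by simp
  have nn: "P \<ge> 0" "I \<ge> 0" "Q \<ge> 0" "N \<ge> 0" "\<beta> \<ge> 0"
    by (auto simp: P_def I_def Q_def N_def \<beta>_def)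
  \<comment> \<open>If \<open>b\<close> is small compared with \<open>a\<close>, the difference has
    at least half the size of \<open>a\<close>; otherwise one of the factors
    \<open>\<bar>a\<bar>\<close> is bounded by \<open>2 * \<bar>b\<bar>\<close>.\<close>
  have elem: "\<bar>a\<bar> powr p \<le> 2 powr p * \<bar>b - a\<bar> powr p + 2 * (\<bar>a\<bar> powr (p - 1) * \<bar>b\<bar>)" for a b :: real
  proof (cases "\<bar>b\<bar> \<le> \<bar>a\<bar> / 2")
    case True
    then have "\<bar>a\<bar> \<le> 2 * \<bar>b - a\<bar>"
      using abs_triangle_ineq2[of a b] by (simp add: abs_minus_commute)
    then have "\<bar>a\<bar> powr p \<le> (2 * \<bar>b - a\<bar>) powr p"
      using p by (intro powr_mono2) auto
    then show ?thesis by (simp add: powr_mult add_increasing2)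
  next
    case False
    have "\<bar>a\<bar> powr p = \<bar>a\<bar> powr (p - 1) * \<bar>a\<bar>"
      using powr_add[of "\<bar>a\<bar>" "p - 1" 1] by (cases "a = 0") auto
    also have "\<dots> \<le> \<bar>a\<bar> powr (p - 1) * (2 * \<bar>b\<bar>)"
      using False by (intro mult_left_mono) auto
    finally show ?thesis by (simp add: add_increasing)
  qed
  have tr: "ennreal P \<le> ennreal (2 powr p * h powr p * I)
      + 2 * (\<integral>\<^sup>+x. ennreal (\<bar>\<phi> x\<bar> powr (p - 1)) * ennreal \<bar>\<phi> (x + y)\<bar> \<partial>lborel)" if "norm y \<le> h" for y
  proof -
    have "ennreal P = (\<integral>\<^sup>+x. ennreal (\<bar>\<phi> x\<bar> powr p) \<partial>lborel)"
      unfolding P_def using iP by (subst nn_integral_eq_integral) auto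
    also have "\<dots> \<le> (\<integral>\<^sup>+x. ennreal (2 powr p * \<bar>\<phi> (x + y) - \<phi> x\<bar> powr p)
        + 2 * (ennreal (\<bar>\<phi> x\<bar> powr (p - 1)) * ennreal \<bar>\<phi> (x + y)\<bar>) \<partial>lborel)"
    proof (rule nn_integral_mono)
      fix x
      have "ennreal (\<bar>\<phi> x\<bar> powr p) \<le> ennreal (2 powr p * \<bar>\<phi> (x + y) - \<phi> x\<bar> powr p
          + 2 * (\<bar>\<phi> x\<bar> powr (p - 1) * \<bar>\<phi> (x + y)\<bar>))"
        by (rule ennreal_leI[OF elem])
      then show "ennreal (\<bar>\<phi> x\<bar> powr p) \<le> ennreal (2 powr p * \<bar>\<phi> (x + y) - \<phi> x\<bar> powr p)
        + 2 * (ennreal (\<bar>\<phi> x\<bar> powr (p - 1)) * ennreal \<bar>\<phi> (x + y)\<bar>)"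
        by (simp add: ennreal_plus ennreal_mult)
    qed
    also have "\<dots> = (\<integral>\<^sup>+x. ennreal (2 powr p * \<bar>\<phi> (x + y) - \<phi> x\<bar> powr p) \<partial>lborel)
        + 2 * (\<integral>\<^sup>+x. ennreal (\<bar>\<phi> x\<bar> powr (p - 1)) * ennreal \<bar>\<phi> (x + y)\<bar> \<partial>lborel)"
      by (subst nn_integral_add) (auto simp: nn_integral_cmult)
    also have "(\<integral>\<^sup>+x. ennreal (2 powr p * \<bar>\<phi> (x + y) - \<phi> x\<bar> powr p) \<partial>lborel)
        = ennreal (2 powr p * (\<integral>x. \<bar>\<phi> (x + y) - \<phi> x\<bar> powr p \<partial>lborel))"
      using translation_estimate(1)[OF \<phi>, of p y] p by (subst nn_integral_eq_integral) auto
    also have "\<dots> \<le> ennreal (2 powr p * h powr p * I)"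
    proof (rule ennreal_leI)
      have "(\<integral>x. \<bar>\<phi> (x + y) - \<phi> x\<bar> powr p \<partial>lborel) \<le> norm y powr p * I"
        unfolding I_def using p by (intro translation_estimate(2)[OF \<phi>]) auto
      also have "\<dots> \<le> h powr p * I"
        using that p nn by (intro mult_right_mono powr_mono2) auto
      finally show "2 powr p * (\<integral>x. \<bar>\<phi> (x + y) - \<phi> x\<bar> powr p \<partial>lborel) \<le> 2 powr p * h powr p * I"
        by simp
    qed
    finally show ?thesis by (simp add: add_right_mono)
  qed
  have [measurable]: "cball (0::'a) h \<in> sets borel" by auto
  have em: "emeasure lborel (cball (0::'a) h) = ennreal \<beta>"
    unfolding \<beta>_def
    by (intro emeasure_eq_ennreal_measure) (use emeasure_lborel_cball_finite[of "0::'a" h] in auto)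
  have "ennreal (\<beta> * P) = (\<integral>\<^sup>+y. indicator (cball (0::'a) h) y * ennreal P \<partial>lborel)"
    using nn by (subst nn_integral_multc) (measurable, auto simp: em ennreal_mult)
  \<comment> \<open>The cross term is enlarged from the ball to the whole space: there the integral
    over \<open>y\<close> is independent of \<open>x\<close>, and the double integral splits into
    the product of \<open>Q\<close> and \<open>N\<close>.\<close>
  also have "\<dots> \<le> (\<integral>\<^sup>+y. indicator (cball (0::'a) h) y * ennreal (2 powr p * h powr p * I)
      + 2 * (\<integral>\<^sup>+x. ennreal (\<bar>\<phi> x\<bar> powr (p - 1)) * ennreal \<bar>\<phi> (x + y)\<bar> \<partial>lborel) \<partial>lborel)"
    by (rule nn_integral_mono) (auto simp: indicator_def tr)
  also have "\<dots> = (\<integral>\<^sup>+y. indicator (cball (0::'a) h) y * ennreal (2 powr p * h powr p * I) \<partial>lborel)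
      + 2 * (\<integral>\<^sup>+y. (\<integral>\<^sup>+x. ennreal (\<bar>\<phi> x\<bar> powr (p - 1)) * ennreal \<bar>\<phi> (x + y)\<bar> \<partial>lborel) \<partial>lborel)"
    by (subst nn_integral_add) (auto simp: nn_integral_cmult)
  also have "(\<integral>\<^sup>+y. indicator (cball (0::'a) h) y * ennreal (2 powr p * h powr p * I) \<partial>lborel)
      = ennreal (\<beta> * (2 powr p * h powr p * I))"
    using nn by (subst nn_integral_multc) (measurable, auto simp: em ennreal_mult)
  also have "(\<integral>\<^sup>+y. (\<integral>\<^sup>+x. ennreal (\<bar>\<phi> x\<bar> powr (p - 1)) * ennreal \<bar>\<phi> (x + y)\<bar> \<partial>lborel) \<partial>lborel)
      = (\<integral>\<^sup>+x. (\<integral>\<^sup>+y. ennreal (\<bar>\<phi> x\<bar> powr (p - 1)) * ennreal \<bar>\<phi> (x + y)\<bar> \<partial>lborel) \<partial>lborel)"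
    by (rule lborel_pair.Fubini') measurable
  also have "\<dots> = (\<integral>\<^sup>+x. ennreal (\<bar>\<phi> x\<bar> powr (p - 1)) * ennreal N \<partial>lborel)"
  proof (rule nn_integral_cong)
    fix x
    have "(\<integral>\<^sup>+y. ennreal \<bar>\<phi> (x + y)\<bar> \<partial>lborel) = (\<integral>\<^sup>+y. ennreal \<bar>\<phi> y\<bar> \<partial>lborel)"
      by (rule nn_integral_lborel_translation) measurable
    also have "\<dots> = ennreal N"
      unfolding N_def using iN by (subst nn_integral_eq_integral) auto
    finally show "(\<integral>\<^sup>+y. ennreal (\<bar>\<phi> x\<bar> powr (p - 1)) * ennreal \<bar>\<phi> (x + y)\<bar> \<partial>lborel)
      = ennreal (\<bar>\<phi> x\<bar> powr (p - 1)) * ennreal N"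
      by (simp add: nn_integral_cmult)
  qed
  also have "\<dots> = ennreal Q * ennreal N"
    unfolding Q_def using iQ by (simp add: nn_integral_multc nn_integral_eq_integral)
  also have "ennreal (\<beta> * (2 powr p * h powr p * I)) + 2 * (ennreal Q * ennreal N)
      = ennreal (\<beta> * (2 powr p * h powr p * I) + 2 * Q * N)"
    using nn by (simp add: ennreal_plus ennreal_mult mult.assoc)
  finally show ?thesis
    using nn unfolding P_def[symmetric] I_def[symmetric] Q_def[symmetric] N_def[symmetric] \<beta>_def[symmetric]
    by (subst (asm) ennreal_le_iff) auto
qed

section \<open>Weak gradients\<close>

lemma locally_integrable_mult_integrable:
  fixes f :: "'a::euclidean_space \<Rightarrow> 'b::euclidean_space"
  assumes "open \<Omega>" "locally_integrable_on f \<Omega>"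
    and \<psi>: "continuous_on UNIV \<psi>" "compact K" "K \<subseteq> \<Omega>" "\<And>x. x \<notin> K \<Longrightarrow> \<psi> x = (0::real)"
  shows "integrable (lebesgue_on \<Omega>) (\<lambda>x. \<psi> x *\<^sub>R f x)"
proof -
  have f: "integrable lebesgue (\<lambda>x. indicator K x *\<^sub>R f x)"
    using assms unfolding locally_integrable_on_def set_integrable_def by blast
  obtain B where B: "B \<ge> 0" "\<And>x. norm (\<psi> x) \<le> B"
    using bounded_continuous_compact_support[OF \<psi>(1,2,4)] by blast
  have [measurable]: "\<psi> \<in> borel_measurable lebesgue"
    using \<psi>(1) by (intro measurable_completion) (simp add: borel_measurable_continuous_onI)
  have "integrable lebesgue (\<lambda>x. \<psi> x *\<^sub>R (indicator K x *\<^sub>R f x))"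
  proof (rule Bochner_Integration.integrable_bound)
    show "integrable lebesgue (\<lambda>x. B *\<^sub>R (indicator K x *\<^sub>R f x))"
      using f by (intro integrable_scaleR_right)
    show "(\<lambda>x. \<psi> x *\<^sub>R (indicator K x *\<^sub>R f x)) \<in> borel_measurable lebesgue"
      using f by measurable
    show "AE x in lebesgue. norm (\<psi> x *\<^sub>R (indicator K x *\<^sub>R f x)) \<le> norm (B *\<^sub>R (indicator K x *\<^sub>R f x))"
    proof (rule AE_I2)
      fix x
      have "norm (\<psi> x *\<^sub>R (indicator K x *\<^sub>R f x)) \<le> B * norm (indicator K x *\<^sub>R f x)"
        unfolding norm_scaleR[of "\<psi> x"] using B(2)[of x] by (intro mult_right_mono) auto
      then show "norm (\<psi> x *\<^sub>R (indicator K x *\<^sub>R f x)) \<le> norm (B *\<^sub>R (indicator K x *\<^sub>R f x))"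
        using B(1) by (simp only: norm_scaleR[of B] abs_of_nonneg)
    qed
  qed
  also have "(\<lambda>x. \<psi> x *\<^sub>R (indicator K x *\<^sub>R f x)) = (\<lambda>x. indicator \<Omega> x *\<^sub>R (\<psi> x *\<^sub>R f x))"
  proof
    fix x show "\<psi> x *\<^sub>R (indicator K x *\<^sub>R f x) = indicator \<Omega> x *\<^sub>R (\<psi> x *\<^sub>R f x)"
      using \<psi>(3) \<psi>(4)[of x] by (cases "x \<in> K") auto
  qed
  finally show ?thesis
    using assms(1) by (subst integrable_restrict_space) auto
qed

text \<open>The indicator of the open box is a bounded pointwise limit of test functions supported
  in the closed box, and the faces of the box are a null set.\<close>

lemma integral_cbox_eq_0:
  fixes f :: "'a::euclidean_space \<Rightarrow> real"
  assumes \<Omega>: "open \<Omega>" and f: "locally_integrable_on f \<Omega>"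
    and 0: "\<And>\<phi>. \<phi> \<in> test_functions \<Omega> \<Longrightarrow> (LINT x|lebesgue_on \<Omega>. f x * \<phi> x) = 0"
    and sub: "cbox a b \<subseteq> \<Omega>"
  shows "integral (cbox a b) f = 0"
proof -
  obtain \<rho> where \<rho>: "\<And>j::nat. smooth_on UNIV (\<rho> j)" "\<And>j x. 0 \<le> \<rho> j x" "\<And>j x. \<rho> j x \<le> 1"
    "\<And>j x. x \<notin> box a b \<Longrightarrow> \<rho> j x = 0" "\<And>x. (\<lambda>j. \<rho> j x) \<longlonglongrightarrow> indicator (box a b) x"
    using smooth_approximation_of_box[of a b] by metis
  have test: "\<rho> j \<in> test_functions \<Omega>" for j
  proof -
    have "{x. \<rho> j x \<noteq> 0} \<subseteq> box a b"
      using \<rho>(4) by blast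
    then have "{x. \<rho> j x \<noteq> 0} \<subseteq> cbox a b"
      using box_subset_cbox by blast
    then have s: "closure {x. \<rho> j x \<noteq> 0} \<subseteq> cbox a b"
      by (rule closure_minimal) (rule closed_cbox)
    then have "compact (closure {x. \<rho> j x \<noteq> 0})"
      using compact_cbox bounded_subset compact_imp_bounded by (metis compact_closure closure_subset subset_trans)
    then show ?thesis
      using s sub \<rho>(1) by (auto simp: test_functions_def)
  qed
  have i: "integrable lebesgue (\<lambda>x. indicator (cbox a b) x *\<^sub>R f x)"
    using f sub unfolding locally_integrable_on_def set_integrable_def by auto
  have ib: "f absolutely_integrable_on box a b"
    using f sub unfolding locally_integrable_on_def
    by (meson box_subset_cbox compact_cbox lmeasurable_box set_integrable_subset fmeasurableD)
  have m: "\<rho> j \<in> borel_measurable lebesgue" for j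
    using borel_measurable_smooth(1)[OF \<rho>(1)] by (intro measurable_completion) simp
  have "(\<lambda>j. LINT x|lebesgue. \<rho> j x * (indicator (cbox a b) x *\<^sub>R f x))
      \<longlonglongrightarrow> (LINT x|lebesgue. indicator (box a b) x *\<^sub>R f x)"
  proof (rule integral_dominated_convergence[where w="\<lambda>x. norm (indicator (cbox a b) x *\<^sub>R f x)"])
    show "AE x in lebesgue. (\<lambda>j. \<rho> j x * (indicator (cbox a b) x *\<^sub>R f x)) \<longlonglongrightarrow> indicator (box a b) x *\<^sub>R f x"
    proof (rule AE_I2)
      fix x
      have e: "indicator (box a b) x *\<^sub>R f x = indicator (box a b) x * (indicator (cbox a b) x *\<^sub>R f x)"
        using box_subset_cbox[of a b] by (auto simp: indicator_def)
      show "(\<lambda>j. \<rho> j x * (indicator (cbox a b) x *\<^sub>R f x)) \<longlonglongrightarrow> indicator (box a b) x *\<^sub>R f x"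
        unfolding e by (rule tendsto_mult_right[OF \<rho>(5)])
    qed
    show "(\<lambda>x. indicator (box a b) x *\<^sub>R f x) \<in> borel_measurable lebesgue"
      using ib unfolding set_integrable_def by (rule borel_measurable_integrable)
    show "(\<lambda>x. \<rho> j x * (indicator (cbox a b) x *\<^sub>R f x)) \<in> borel_measurable lebesgue" for j
      using m i by (intro borel_measurable_times) auto
    show "AE x in lebesgue. norm (\<rho> j x * (indicator (cbox a b) x *\<^sub>R f x)) \<le> norm (indicator (cbox a b) x *\<^sub>R f x)" for j
    proof (rule AE_I2)
      fix x
      have "norm (\<rho> j x * (indicator (cbox a b) x *\<^sub>R f x)) \<le> 1 * norm (indicator (cbox a b) x *\<^sub>R f x)"
        unfolding norm_mult using \<rho>(2,3)[of j x] by (intro mult_right_mono) auto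
      then show "norm (\<rho> j x * (indicator (cbox a b) x *\<^sub>R f x)) \<le> norm (indicator (cbox a b) x *\<^sub>R f x)"
        by simp
    qed
  qed (use i in auto)
  moreover have "(LINT x|lebesgue. \<rho> j x * (indicator (cbox a b) x *\<^sub>R f x)) = 0" for j
  proof -
    have "(\<lambda>x. \<rho> j x * (indicator (cbox a b) x *\<^sub>R f x)) = (\<lambda>x. indicator \<Omega> x *\<^sub>R (f x * \<rho> j x))"
    proof
      fix x show "\<rho> j x * (indicator (cbox a b) x *\<^sub>R f x) = indicator \<Omega> x *\<^sub>R (f x * \<rho> j x)"
        using \<rho>(4)[of x j] sub box_subset_cbox[of a b] by (cases "x \<in> box a b") (auto simp: indicator_def)
    qed
    then have "(LINT x|lebesgue. \<rho> j x * (indicator (cbox a b) x *\<^sub>R f x)) = (LINT x|lebesgue_on \<Omega>. f x * \<rho> j x)"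
      using \<Omega> by (simp add: integral_restrict_space)
    with 0[OF test] show ?thesis by simp
  qed
  ultimately have "(LINT x|lebesgue. indicator (box a b) x *\<^sub>R f x) = 0"
    by (simp add: LIMSEQ_const_iff)
  then show ?thesis
    using set_lebesgue_integral_eq_integral(2)[OF ib]
    by (simp add: set_lebesgue_integral_def integral_open_interval)
qed

text \<open>By Lebesgue differentiation \<open>f\<close> is almost everywhere the limit of its
  averages over small cubes, and all these averages vanish by \<open>integral_cbox_eq_0\<close>.
  Countably many closed boxes exhaust the open set.\<close>

theorem fundamental_lemma_calculus_of_variations:
  fixes f :: "'a::euclidean_space \<Rightarrow> real"
  assumes \<Omega>: "open \<Omega>" and f: "locally_integrable_on f \<Omega>"
    and 0: "\<And>\<phi>. \<phi> \<in> test_functions \<Omega> \<Longrightarrow> (LINT x|lebesgue_on \<Omega>. f x * \<phi> x) = 0"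
  shows "AE x in lebesgue_on \<Omega>. f x = 0"
proof -
  have box: "negligible {x \<in> cbox a b. f x \<noteq> 0}" if sub: "cbox a b \<subseteq> \<Omega>" for a b
  proof -
    \<comment> \<open>Extension by 0 makes the local function integrable on every box, as the
      differentiation theorem requires; on small cubes inside the open box nothing changes.\<close>
    define F where "F x = (if x \<in> cbox a b then f x else 0)" for x
    have "f absolutely_integrable_on cbox a b"
      using f sub unfolding locally_integrable_on_def by (simp add: compact_cbox)
    then have "f integrable_on cbox a b"
      by (rule set_lebesgue_integral_eq_integral)
    then have "F integrable_on UNIV"
      unfolding F_def by (subst Henstock_Kurzweil_Integration.integrable_restrict_UNIV)
    then have Fi: "F integrable_on cbox c d" for c d
      by (rule integrable_on_subcbox) simp
    have "\<exists>N. negligible N \<and> (\<forall>x e. x \<notin> N \<longrightarrow> 0 < e \<longrightarrow> (\<exists>d>0. \<forall>h. 0 < h \<and> h < d \<longrightarrow>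
          norm (integral (cbox x (x + h *\<^sub>R One)) F /\<^sub>R h ^ DIM('a) - F x) < e))"
      by (rule integrable_ccontinuous_explicit[of F, OF Fi]) (rule exI, rule conjI, assumption, simp)
    then obtain N where N: "negligible N" "\<And>x e. x \<notin> N \<Longrightarrow> 0 < e \<Longrightarrow>
        \<exists>d>0. \<forall>h. 0 < h \<and> h < d \<longrightarrow>
          norm (integral (cbox x (x + h *\<^sub>R One)) F /\<^sub>R h ^ DIM('a) - F x) < e"
      by (elim exE conjE) simp
    have "f x = 0" if x: "x \<in> box a b" "x \<notin> N" for x
    proof (rule ccontr)
      assume nz: "f x \<noteq> 0"
      have Fx: "F x = f x" using x box_subset_cbox[of a b] by (auto simp: F_def)
      obtain d where d: "d > 0" "\<And>h. 0 < h \<Longrightarrow> h < d \<Longrightarrow>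
          norm (integral (cbox x (x + h *\<^sub>R One)) F /\<^sub>R h ^ DIM('a) - F x) < \<bar>f x\<bar>"
        using N(2)[OF x(2), of "\<bar>f x\<bar>"] nz by auto
      obtain r where r: "r > 0" "cball x r \<subseteq> box a b"
        using open_contains_cball[of "box a b"] x(1) by auto
      \<comment> \<open>A cube of side \<open>h\<close> with corner \<open>x\<close> has diameter at
        most \<open>h * DIM('a)\<close>, so it stays in the ball of radius \<open>r\<close>.\<close>
      define h where "h = min (d / 2) (r / DIM('a))"
      have h: "0 < h" "h < d" "h * DIM('a) \<le> r"
        using d(1) r(1) by (auto simp: h_def min_def field_simps)
      have c: "cbox x (x + h *\<^sub>R One) \<subseteq> box a b"
      proof
        fix y assume y: "y \<in> cbox x (x + h *\<^sub>R One)"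
        have "norm (y - x) \<le> (\<Sum>i\<in>Basis. \<bar>(y - x) \<bullet> i\<bar>)" by (rule norm_le_l1)
        also have "\<dots> \<le> (\<Sum>i\<in>(Basis::'a set). h)"
          using y by (intro sum_mono) (auto simp: mem_box inner_diff_left inner_add_left inner_sum_left_Basis)
        also have "\<dots> = h * DIM('a)" by simp
        finally show "y \<in> box a b"
          using h(3) r(2) by (auto simp: dist_norm norm_minus_commute)
      qed
      then have c': "cbox x (x + h *\<^sub>R One) \<subseteq> cbox a b"
        using box_subset_cbox by blast
      have "integral (cbox x (x + h *\<^sub>R One)) F = integral (cbox x (x + h *\<^sub>R One)) f"
        using c' by (intro integral_cong) (auto simp: F_def)
      also have "\<dots> = 0"
        using c' sub by (intro integral_cbox_eq_0[OF \<Omega> f 0]) auto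
      finally show False using d(2)[OF h(1,2)] Fx by simp
    qed
    then have "{x \<in> cbox a b. f x \<noteq> 0} \<subseteq> N \<union> (cbox a b - box a b)" by blast
    moreover have "negligible (N \<union> (cbox a b - box a b))"
      using N(1) negligible_frontier_interval by (rule negligible_Un)
    ultimately show ?thesis by (rule negligible_subset[rotated])
  qed
  obtain D where D: "countable D" "D \<subseteq> Pow \<Omega>" "\<And>X. X \<in> D \<Longrightarrow> \<exists>a b. X = cbox a b" "\<Union>D = \<Omega>"
    using open_countable_Union_open_cbox[OF \<Omega>] by metis
  have "negligible {x \<in> X. f x \<noteq> 0}" if "X \<in> D" for X
    using D(2) D(3)[of X] that box by auto
  then have "negligible (\<Union>((\<lambda>X. {x \<in> X. f x \<noteq> 0}) ` D))"
    using D(1) by (intro negligible_countable_Union) auto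
  also have "\<Union>((\<lambda>X. {x \<in> X. f x \<noteq> 0}) ` D) = {x. \<not> (x \<in> \<Omega> \<longrightarrow> f x = 0)}"
    using D(4) by auto
  finally have "AE x in lebesgue. x \<in> \<Omega> \<longrightarrow> f x = 0"
    unfolding negligible_iff_null_sets completion.AE_iff_null_sets by simp
  then show ?thesis
    using \<Omega> by (subst AE_restrict_space_iff) auto
qed

section \<open>Uniqueness and calculus of weak gradients\<close>

lemma locally_integrable_on_diff:
  "locally_integrable_on f \<Omega> \<Longrightarrow> locally_integrable_on g \<Omega> \<Longrightarrow> locally_integrable_on (\<lambda>x. f x - g x) \<Omega>"
  unfolding locally_integrable_on_def by (auto intro: set_integral_diff(1))

lemma locally_integrable_on_inner:
  "locally_integrable_on f \<Omega> \<Longrightarrow> locally_integrable_on (\<lambda>x. f x \<bullet> b) \<Omega>"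
  unfolding locally_integrable_on_def set_integrable_def
  by (auto simp flip: inner_scaleR_left intro!: integrable_inner_left)

lemma weak_gradient_integrable:
  assumes "open \<Omega>" "weak_gradient \<Omega> u G" "\<psi> \<in> test_functions \<Omega>"
  shows "integrable (lebesgue_on \<Omega>) (\<lambda>x. u x * frechet_derivative \<psi> (at x) b)"
    and "integrable (lebesgue_on \<Omega>) (\<lambda>x. (G x \<bullet> b) * \<psi> x)"
proof -
  note s = test_functions_smooth[OF assms(3)]
  obtain K where K: "compact K" "K \<subseteq> \<Omega>" "\<And>x. x \<notin> K \<Longrightarrow> \<psi> x = 0" "\<And>x. x \<notin> K \<Longrightarrow> grad \<psi> x = 0"
    using test_functions_support[OF assms(3)] by metis
  have u: "locally_integrable_on u \<Omega>" and G: "locally_integrable_on (\<lambda>x. G x \<bullet> b) \<Omega>"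
    using assms(2) locally_integrable_on_inner by (auto simp: weak_gradient_def)
  have "integrable (lebesgue_on \<Omega>) (\<lambda>x. (grad \<psi> x \<bullet> b) *\<^sub>R u x)"
    by (rule locally_integrable_mult_integrable[OF assms(1) u _ K(1,2)])
       (use K continuous_on_grad[OF s] in \<open>auto intro!: continuous_intros\<close>)
  then show "integrable (lebesgue_on \<Omega>) (\<lambda>x. u x * frechet_derivative \<psi> (at x) b)"
    by (simp add: frechet_derivative_eq_grad[OF s] mult.commute)
  have "integrable (lebesgue_on \<Omega>) (\<lambda>x. \<psi> x *\<^sub>R (G x \<bullet> b))"
    by (rule locally_integrable_mult_integrable[OF assms(1) G continuous_on_smooth[OF s] K(1-3)])
  then show "integrable (lebesgue_on \<Omega>) (\<lambda>x. (G x \<bullet> b) * \<psi> x)"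
    by (simp add: mult.commute)
qed

lemma weak_gradient_diff:
  assumes "open \<Omega>" "weak_gradient \<Omega> u G" "weak_gradient \<Omega> v H"
  shows "weak_gradient \<Omega> (\<lambda>x. u x - v x) (\<lambda>x. G x - H x)"
  unfolding weak_gradient_def
proof (intro conjI ballI)
  show "locally_integrable_on (\<lambda>x. u x - v x) \<Omega>" "locally_integrable_on (\<lambda>x. G x - H x) \<Omega>"
    using assms by (auto simp: weak_gradient_def intro: locally_integrable_on_diff)
  fix \<psi> and b :: 'a assume \<psi>: "\<psi> \<in> test_functions \<Omega>" and b: "b \<in> Basis"
  note i = weak_gradient_integrable[OF assms(1,2) \<psi>, of b] weak_gradient_integrable[OF assms(1,3) \<psi>, of b]
  show "(LINT x|lebesgue_on \<Omega>. (u x - v x) * frechet_derivative \<psi> (at x) b)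
      = - (LINT x|lebesgue_on \<Omega>. ((G x - H x) \<bullet> b) * \<psi> x)"
    using assms(2,3) \<psi> b i
    by (simp add: weak_gradient_def left_diff_distrib inner_diff_left)
qed

lemma weak_gradient_unique:
  fixes \<Omega> :: "'a::euclidean_space set"
  assumes "open \<Omega>" "weak_gradient \<Omega> u G" "weak_gradient \<Omega> u H"
  shows "AE x in lebesgue_on \<Omega>. G x = H x"
proof -
  have w: "weak_gradient \<Omega> (\<lambda>x. u x - u x) (\<lambda>x. G x - H x)"
    by (rule weak_gradient_diff[OF assms])
  have "AE x in lebesgue_on \<Omega>. (G x - H x) \<bullet> b = 0" if b: "b \<in> Basis" for b
  proof (rule fundamental_lemma_calculus_of_variations[OF assms(1)])
    show "locally_integrable_on (\<lambda>x. (G x - H x) \<bullet> b) \<Omega>"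
      using w by (auto simp: weak_gradient_def intro: locally_integrable_on_inner)
    show "(LINT x|lebesgue_on \<Omega>. (G x - H x) \<bullet> b * \<phi> x) = 0" if "\<phi> \<in> test_functions \<Omega>" for \<phi>
      using w that b by (auto simp: weak_gradient_def)
  qed
  then have "AE x in lebesgue_on \<Omega>. \<forall>b\<in>Basis. (G x - H x) \<bullet> b = 0"
    by (intro AE_finite_allI) auto
  then show ?thesis
    by eventually_elim (auto simp: inner_diff_left intro: euclidean_eqI)
qed

lemma continuous_imp_locally_integrable_on:
  fixes f :: "'a::euclidean_space \<Rightarrow> 'b::euclidean_space"
  assumes "continuous_on UNIV f"
  shows "locally_integrable_on f \<Omega>"
  unfolding locally_integrable_on_def set_integrable_def
proof (intro allI impI, elim conjE)
  fix K :: "'a set" assume "compact K"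
  then have "integrable lborel (\<lambda>x. indicator K x *\<^sub>R f x)"
    using assms by (intro borel_integrable_compact) (auto intro: continuous_on_subset)
  then show "integrable lebesgue (\<lambda>x. indicator K x *\<^sub>R f x)"
    using integrable_completion borel_measurable_integrable by blast
qed

lemma weak_gradient_smooth:
  fixes \<phi> :: "'a::euclidean_space \<Rightarrow> real"
  assumes "open \<Omega>" "smooth_on UNIV \<phi>"
  shows "weak_gradient \<Omega> \<phi> (grad \<phi>)"
  unfolding weak_gradient_def
proof (intro conjI ballI)
  note c = continuous_on_smooth[OF assms(2)] continuous_on_grad[OF assms(2)]
  show "locally_integrable_on \<phi> \<Omega>" "locally_integrable_on (grad \<phi>) \<Omega>"
    using c by (blast intro: continuous_imp_locally_integrable_on)+
  fix \<psi> and b :: 'a assume \<psi>: "\<psi> \<in> test_functions \<Omega>" and b: "b \<in> Basis"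
  note s = test_functions_smooth[OF \<psi>]
  note [measurable] = borel_measurable_smooth[OF assms(2)] borel_measurable_smooth[OF s]
  have "(LINT x|lebesgue_on \<Omega>. \<phi> x * (grad \<psi> x \<bullet> b)) = (LINT x|lborel. \<phi> x * (grad \<psi> x \<bullet> b))"
    by (rule lebesgue_on_eq_lborel[OF assms(1)])
       (auto simp: test_functions_zero_outside[OF \<psi>])
  also have "\<dots> = - (LINT x|lborel. (grad \<phi> x \<bullet> b) * \<psi> x)"
    by (rule integration_by_parts[OF assms(2) \<psi>])
  also have "(LINT x|lborel. (grad \<phi> x \<bullet> b) * \<psi> x) = (LINT x|lebesgue_on \<Omega>. (grad \<phi> x \<bullet> b) * \<psi> x)"
    by (rule lebesgue_on_eq_lborel[OF assms(1), symmetric])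
       (auto simp: test_functions_zero_outside[OF \<psi>])
  finally show "(LINT x|lebesgue_on \<Omega>. \<phi> x * frechet_derivative \<psi> (at x) b)
      = - (LINT x|lebesgue_on \<Omega>. (grad \<phi> x \<bullet> b) * \<psi> x)"
    by (simp add: frechet_derivative_eq_grad[OF s])
qed

text \<open>Uniqueness makes the choice of a representative in \<open>wgrad\<close> harmless. Every
  concrete weak gradient below, that of a test function or of a difference, is identified in this
  way.\<close>

lemma wgrad_AE_eq:
  assumes "open \<Omega>" "weak_gradient \<Omega> u G"
  shows "AE x in lebesgue_on \<Omega>. wgrad \<Omega> u x = G x"
proof -
  have "weak_gradient \<Omega> u (wgrad \<Omega> u)"
    unfolding wgrad_def using someI[of "weak_gradient \<Omega> u"] assms(2) by blast
  then show ?thesis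
    using weak_gradient_unique[OF assms(1)] assms(2) by blast
qed

text \<open>This rests on completeness of Lebesgue measure. It passes measurability from a known
  weak gradient to the representative chosen by \<open>wgrad\<close>, which agrees with it only
  almost everywhere.\<close>

lemma borel_measurable_lebesgue_on_AE:
  fixes f g :: "'a::euclidean_space \<Rightarrow> 'b::euclidean_space"
  assumes "open \<Omega>" "f \<in> borel_measurable (lebesgue_on \<Omega>)" "AE x in lebesgue_on \<Omega>. f x = g x"
  shows "g \<in> borel_measurable (lebesgue_on \<Omega>)"
proof -
  have S: "\<Omega> \<inter> space lebesgue \<in> sets lebesgue" using assms(1) by auto
  have "AE x in lebesgue. indicator \<Omega> x *\<^sub>R f x = indicator \<Omega> x *\<^sub>R g x"
    using assms(3) unfolding AE_restrict_space_iff[OF S]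
    by eventually_elim (auto simp: indicator_def)
  with assms(2) show ?thesis
    unfolding borel_measurable_restrict_space_iff[OF S] by (rule borel_measurable_AE)
qed

lemma W1p_wgrad:
  fixes u :: "'a::euclidean_space \<Rightarrow> real"
  assumes "open \<Omega>" "u \<in> W1p p \<Omega>"
  shows "weak_gradient \<Omega> u (wgrad \<Omega> u)" "wgrad \<Omega> u \<in> Lp_space p \<Omega>"
proof -
  obtain G where G: "weak_gradient \<Omega> u G" "G \<in> Lp_space p \<Omega>"
    using assms(2) by (auto simp: W1p_def)
  show "weak_gradient \<Omega> u (wgrad \<Omega> u)"
    unfolding wgrad_def using someI[of "weak_gradient \<Omega> u"] G(1) by blast
  have ae: "AE x in lebesgue_on \<Omega>. G x = wgrad \<Omega> u x"
    using wgrad_AE_eq[OF assms(1) G(1)] by eventually_elim simp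
  have Gm: "G \<in> borel_measurable (lebesgue_on \<Omega>)"
    and Gi: "integrable (lebesgue_on \<Omega>) (\<lambda>x. norm (G x) powr p)"
    using G(2) by (auto simp: Lp_space_def)
  have m[measurable]: "wgrad \<Omega> u \<in> borel_measurable (lebesgue_on \<Omega>)"
    by (rule borel_measurable_lebesgue_on_AE[OF assms(1) Gm ae])
  have "integrable (lebesgue_on \<Omega>) (\<lambda>x. norm (wgrad \<Omega> u x) powr p)"
    by (rule integrable_cong_AE_imp[OF Gi]) (use ae in auto)
  with m show "wgrad \<Omega> u \<in> Lp_space p \<Omega>"
    by (simp add: Lp_space_def)
qed

section \<open>Approximation by test functions in the Sobolev space\<close>

lemma Lp_norm_powr:
  assumes "p > 0"
  shows "Lp_norm p \<Omega> f powr p = (LINT x|lebesgue_on \<Omega>. norm (f x) powr p)"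
  using assms by (simp add: Lp_norm_def powr_powr)

lemma test_functions_lebesgue_on:
  assumes "open \<Omega>" "\<phi> \<in> test_functions \<Omega>" "p > 0"
  shows "integrable (lebesgue_on \<Omega>) (\<lambda>x. \<bar>\<phi> x\<bar> powr p)"
    and "integrable (lebesgue_on \<Omega>) (\<lambda>x. norm (grad \<phi> x) powr p)"
    and "(LINT x|lebesgue_on \<Omega>. \<bar>\<phi> x\<bar> powr p) = (LINT x|lborel. \<bar>\<phi> x\<bar> powr p)"
    and "(LINT x|lebesgue_on \<Omega>. norm (grad \<phi> x) powr p) = (LINT x|lborel. norm (grad \<phi> x) powr p)"
proof -
  note [measurable] = borel_measurable_smooth[OF test_functions_smooth[OF assms(2)]]
  have a: "(\<lambda>x. \<bar>\<phi> x\<bar> powr p) \<in> borel_measurable borel" "(\<lambda>x. norm (grad \<phi> x) powr p) \<in> borel_measurable borel"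
    by measurable
  have z: "\<And>x. x \<notin> \<Omega> \<Longrightarrow> \<bar>\<phi> x\<bar> powr p = 0" "\<And>x. x \<notin> \<Omega> \<Longrightarrow> norm (grad \<phi> x) powr p = 0"
    by (auto simp: test_functions_zero_outside[OF assms(2)])
  show "integrable (lebesgue_on \<Omega>) (\<lambda>x. \<bar>\<phi> x\<bar> powr p)"
    "integrable (lebesgue_on \<Omega>) (\<lambda>x. norm (grad \<phi> x) powr p)"
    "(LINT x|lebesgue_on \<Omega>. \<bar>\<phi> x\<bar> powr p) = (LINT x|lborel. \<bar>\<phi> x\<bar> powr p)"
    "(LINT x|lebesgue_on \<Omega>. norm (grad \<phi> x) powr p) = (LINT x|lborel. norm (grad \<phi> x) powr p)"
    using lebesgue_on_eq_lborel[OF assms(1) a(1) z(1)] lebesgue_on_eq_lborel[OF assms(1) a(2) z(2)]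
      integrable_test_powr[OF assms(2,3)] by auto
qed

lemma borel_measurable_smooth_lebesgue_on:
  assumes "smooth_on UNIV \<phi>"
  shows "\<phi> \<in> borel_measurable (lebesgue_on \<Omega>)" "grad \<phi> \<in> borel_measurable (lebesgue_on \<Omega>)"
  using borel_measurable_smooth[OF assms]
  by (auto intro!: measurable_restrict_space1 measurable_completion)

lemma test_functions_subset_W1p0:
  fixes \<Omega> :: "'a::euclidean_space set"
  assumes "open \<Omega>" "p > 0" "\<phi> \<in> test_functions \<Omega>"
  shows "\<phi> \<in> W1p0 p \<Omega>"
proof -
  note s = test_functions_smooth[OF assms(3)]
  have "grad \<phi> \<in> Lp_space p \<Omega>" "\<phi> \<in> Lp_space p \<Omega>"
    using test_functions_lebesgue_on[OF assms(1,3,2)] borel_measurable_smooth_lebesgue_on[OF s]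
    by (auto simp: Lp_space_def)
  then have W: "\<phi> \<in> W1p p \<Omega>"
    using weak_gradient_smooth[OF assms(1) s] by (auto simp: W1p_def)
  \<comment> \<open>The approximating sequence is constantly \<open>\<phi>\<close>, so its distance
    to \<open>\<phi>\<close> is the norm of the zero function. The gradient chosen for the zero
    function is known to vanish only almost everywhere, which suffices for the integral.\<close>
  have "smooth_on UNIV (\<lambda>x::'a. 0)" by (rule smooth_on_const)
  from wgrad_AE_eq[OF assms(1) weak_gradient_smooth[OF assms(1) this]]
  have ae: "AE x in lebesgue_on \<Omega>. wgrad \<Omega> (\<lambda>x. 0) x = 0"
    by (auto simp: grad_def frechet_derivative_const)
  have "(LINT x|lebesgue_on \<Omega>. norm (wgrad \<Omega> (\<lambda>x. 0) x) powr p) = 0"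
  proof (rule integral_eq_zero_AE)
    show "AE x in lebesgue_on \<Omega>. norm (wgrad \<Omega> (\<lambda>x. 0) x) powr p = 0"
      using ae by eventually_elim simp
  qed
  then have "W1p_norm p \<Omega> (\<lambda>x. \<phi> x - \<phi> x) = 0"
    using assms(2) by (simp add: W1p_norm_def Lp_norm_def)
  then show ?thesis
    using W assms(3) unfolding W1p0_def by (auto intro!: exI[of _ "\<lambda>n. \<phi>"])
qed

lemma W1p0_approximation:
  fixes u :: "'a::euclidean_space \<Rightarrow> real"
  assumes "open \<Omega>" "p > 0" "u \<in> W1p0 p \<Omega>"
  obtains \<phi> where "\<And>k::nat. \<phi> k \<in> test_functions \<Omega>"
    "(\<lambda>k. LINT x|lebesgue_on \<Omega>. norm (u x - \<phi> k x) powr p) \<longlonglongrightarrow> 0"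
    "(\<lambda>k. LINT x|lebesgue_on \<Omega>. norm (wgrad \<Omega> u x - grad (\<phi> k) x) powr p) \<longlonglongrightarrow> 0"
proof -
  obtain \<phi> where \<phi>: "\<And>k::nat. \<phi> k \<in> test_functions \<Omega>"
      "(\<lambda>n. W1p_norm p \<Omega> (\<lambda>x. u x - \<phi> n x)) \<longlonglongrightarrow> 0"
    and u: "u \<in> W1p p \<Omega>"
    using assms(3) by (auto simp: W1p0_def)
  define A where "A k = (LINT x|lebesgue_on \<Omega>. norm (u x - \<phi> k x) powr p)" for k
  define B where "B k = (LINT x|lebesgue_on \<Omega>. norm (wgrad \<Omega> u x - grad (\<phi> k) x) powr p)" for k
  have nn: "A k \<ge> 0" "B k \<ge> 0" for k by (auto simp: A_def B_def)
  have "W1p_norm p \<Omega> (\<lambda>x. u x - \<phi> k x) = (A k + B k) powr (1 / p)" for k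
  proof -
    note s = test_functions_smooth[OF \<phi>(1)[of k]]
    have ae: "AE x in lebesgue_on \<Omega>. wgrad \<Omega> (\<lambda>x. u x - \<phi> k x) x = wgrad \<Omega> u x - grad (\<phi> k) x"
      by (intro wgrad_AE_eq[OF assms(1)] weak_gradient_diff[OF assms(1)] W1p_wgrad[OF assms(1) u]
          weak_gradient_smooth[OF assms(1) s])
    have [measurable]: "wgrad \<Omega> u \<in> borel_measurable (lebesgue_on \<Omega>)"
      "grad (\<phi> k) \<in> borel_measurable (lebesgue_on \<Omega>)"
      using W1p_wgrad(2)[OF assms(1) u] borel_measurable_smooth_lebesgue_on[OF s] by (auto simp: Lp_space_def)
    have [measurable]: "wgrad \<Omega> (\<lambda>x. u x - \<phi> k x) \<in> borel_measurable (lebesgue_on \<Omega>)"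
      by (rule borel_measurable_lebesgue_on_AE[OF assms(1), of "\<lambda>x. wgrad \<Omega> u x - grad (\<phi> k) x"])
         (use ae in auto)
    have "(LINT x|lebesgue_on \<Omega>. norm (wgrad \<Omega> (\<lambda>x. u x - \<phi> k x) x) powr p) = B k"
      unfolding B_def by (rule integral_cong_AE) (use ae in auto)
    then show ?thesis
      unfolding W1p_norm_def Lp_norm_powr[OF assms(2)] A_def by simp
  qed
  then have "(\<lambda>k. (A k + B k) powr (1 / p)) \<longlonglongrightarrow> 0"
    using \<phi>(2) by simp
  then have "(\<lambda>k. ((A k + B k) powr (1 / p)) powr p) \<longlonglongrightarrow> 0 powr p"
    using assms(2) by (intro tendsto_powr') auto
  then have AB: "(\<lambda>k. A k + B k) \<longlonglongrightarrow> 0"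
    using assms(2) nn by (simp add: powr_powr)
  have "A \<longlonglongrightarrow> 0" "B \<longlonglongrightarrow> 0"
    by (rule tendsto_sandwich[OF _ _ tendsto_const AB]; use nn in auto)+
  then show ?thesis
    using that[of \<phi>] \<phi>(1) unfolding A_def B_def by blast
qed

section \<open>Convergence of powers of the norm\<close>

text \<open>A mean value bound at the larger of \<open>a\<close> and \<open>b\<close>, which is at
  most \<open>2 * max a d\<close>. No power of \<open>b\<close> is left on the right:
  \<open>a\<close> is the fixed function and \<open>d\<close> the small error in the convergence
  proofs.\<close>

lemma powr_diff_bound:
  fixes a b d :: real
  assumes "p \<ge> 1" "a \<ge> 0" "b \<ge> 0" "\<bar>a - b\<bar> \<le> d"
  shows "\<bar>b powr p - a powr p\<bar> \<le> p * 2 powr p * (a powr (p - 1) * d + d powr p)"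
proof -
  have ord: "y powr p - x powr p \<le> p * y powr (p - 1) * d" if "0 \<le> x" "x \<le> y" "y - x \<le> d" for x y
  proof -
    have "y powr p = y powr (p - 1) * y"
      using that powr_add[of y "p - 1" 1] by (cases "y = 0") auto
    then have "y powr p - x powr p \<le> p * y powr (p - 1) * (y - x)"
      using powr_tangent[of p y x] assms(1) that by (simp add: algebra_simps)
    also have "\<dots> \<le> p * y powr (p - 1) * d"
      using assms(1) that by (intro mult_left_mono) auto
    finally show ?thesis .
  qed
  have d: "d \<ge> 0" using assms(4) by linarith
  have "d powr p = d powr (p - 1) * d"
    using d powr_add[of d "p - 1" 1] by (cases "d = 0") auto
  moreover have "max a b powr (p - 1) \<le> (2 * max a d) powr (p - 1)"
    using assms by (intro powr_mono2) auto
  moreover have "(2 * max a d) powr (p - 1) \<le> 2 powr p * (a powr (p - 1) + d powr (p - 1))"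
    using assms(1,2) d by (auto simp: powr_mult max_def intro!: mult_mono powr_mono)
  ultimately have "p * max a b powr (p - 1) * d \<le> p * (2 powr p * (a powr (p - 1) + d powr (p - 1))) * d"
    using assms(1) d by (intro mult_right_mono mult_left_mono) auto
  moreover have "\<bar>b powr p - a powr p\<bar> \<le> p * max a b powr (p - 1) * d"
    using ord[of a b] ord[of b a] assms powr_mono2[of p a b] powr_mono2[of p b a]
    by (cases "a \<le> b") (auto simp: max_def abs_le_iff)
  ultimately show ?thesis
    using \<open>d powr p = d powr (p - 1) * d\<close> by (simp add: algebra_simps)
qed

lemma integrable_powr_diff:
  fixes f g :: "'a \<Rightarrow> 'b::{real_normed_vector,second_countable_topology}"
  assumes p: "p > 0" and [measurable]: "f \<in> borel_measurable M" "g \<in> borel_measurable M"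
    and i: "integrable M (\<lambda>x. norm (f x) powr p)" "integrable M (\<lambda>x. norm (g x) powr p)"
  shows "integrable M (\<lambda>x. norm (f x - g x) powr p)"
proof (rule Bochner_Integration.integrable_bound)
  show "integrable M (\<lambda>x. 2 powr p * (norm (f x) powr p + norm (g x) powr p))"
    using i by simp
  have "norm (a - b) powr p \<le> 2 powr p * (norm a powr p + norm b powr p)" for a b :: 'b
  proof -
    have "norm (a - b) powr p \<le> (2 * max (norm a) (norm b)) powr p"
      using norm_triangle_ineq4[of a b] p by (intro powr_mono2) auto
    also have "\<dots> \<le> 2 powr p * (norm a powr p + norm b powr p)"
      by (auto simp: powr_mult max_def)
    finally show ?thesis .
  qed
  then show "AE x in M. norm (norm (f x - g x) powr p) \<le> norm (2 powr p * (norm (f x) powr p + norm (g x) powr p))"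
    by simp
qed measurable

text \<open>Young's inequality with a free weight, up to constants: compare \<open>b\<close> with
  \<open>\<tau> * a\<close>. Small \<open>\<tau>\<close> makes the first term small, large
  \<open>\<tau>\<close> the second.\<close>

lemma powr_mult_le_weighted:
  fixes a b :: real
  assumes "p > 1" "\<tau> > 0" "a \<ge> 0" "b \<ge> 0"
  shows "a powr (p - 1) * b \<le> \<tau> * a powr p + \<tau> powr (1 - p) * b powr p"
proof (cases "b \<le> \<tau> * a")
  case True
  have "a powr (p - 1) * b \<le> a powr (p - 1) * (\<tau> * a)"
    using True by (intro mult_left_mono) auto
  also have "\<dots> = \<tau> * a powr p"
    using assms powr_add[of a "p - 1" 1] by (cases "a = 0") auto
  finally show ?thesis by (simp add: add_increasing2)
next
  case False
  then have b: "b > 0" "a \<le> b / \<tau>" using assms by (auto simp: field_simps intro: le_less_trans[of 0 "\<tau> * a"])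
  then have "a powr (p - 1) * b \<le> (b / \<tau>) powr (p - 1) * b"
    using assms by (intro mult_right_mono powr_mono2) auto
  also have "\<dots> = \<tau> powr (1 - p) * b powr p"
    using b assms powr_add[of b "p - 1" 1] powr_minus_divide[of \<tau> "p - 1"]
    by (simp add: powr_divide field_simps)
  finally show ?thesis using assms by (simp add: add_increasing)
qed

text \<open>This stands in for Hoelder's inequality; optimizing over \<open>\<tau>\<close> would
  give the product of norms, but for limits a free weight is just as good.\<close>

lemma Lp_duality:
  fixes X :: "'a \<Rightarrow> 'b::{real_normed_vector,second_countable_topology}"
    and Y :: "'a \<Rightarrow> 'c::{real_normed_vector,second_countable_topology}"
  assumes p: "p > 1" and [measurable]: "X \<in> borel_measurable M" "Y \<in> borel_measurable M"
    and i: "integrable M (\<lambda>x. norm (X x) powr p)" "integrable M (\<lambda>x. norm (Y x) powr p)"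
  shows "integrable M (\<lambda>x. norm (X x) powr (p - 1) * norm (Y x))"
    and "\<tau> > 0 \<Longrightarrow> (LINT x|M. norm (X x) powr (p - 1) * norm (Y x))
      \<le> \<tau> * (LINT x|M. norm (X x) powr p) + \<tau> powr (1 - p) * (LINT x|M. norm (Y x) powr p)"
proof -
  show I: "integrable M (\<lambda>x. norm (X x) powr (p - 1) * norm (Y x))"
  proof (rule Bochner_Integration.integrable_bound)
    show "integrable M (\<lambda>x. 1 * norm (X x) powr p + 1 powr (1 - p) * norm (Y x) powr p)"
      using i by simp
    show "AE x in M. norm (norm (X x) powr (p - 1) * norm (Y x))
        \<le> norm (1 * norm (X x) powr p + 1 powr (1 - p) * norm (Y x) powr p)"
    proof (rule AE_I2)
      fix x show "norm (norm (X x) powr (p - 1) * norm (Y x))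
        \<le> norm (1 * norm (X x) powr p + 1 powr (1 - p) * norm (Y x) powr p)"
        using powr_mult_le_weighted[OF p, of 1 "norm (X x)" "norm (Y x)"] by simp
    qed
  qed measurable
  assume \<tau>: "\<tau> > 0"
  have "(LINT x|M. norm (X x) powr (p - 1) * norm (Y x))
      \<le> (LINT x|M. \<tau> * norm (X x) powr p + \<tau> powr (1 - p) * norm (Y x) powr p)"
    using i by (intro integral_mono I powr_mult_le_weighted[OF p \<tau>]) auto
  also have "\<dots> = \<tau> * (LINT x|M. norm (X x) powr p) + \<tau> powr (1 - p) * (LINT x|M. norm (Y x) powr p)"
    using i by (subst Bochner_Integration.integral_add) auto
  finally show "(LINT x|M. norm (X x) powr (p - 1) * norm (Y x))
      \<le> \<tau> * (LINT x|M. norm (X x) powr p) + \<tau> powr (1 - p) * (LINT x|M. norm (Y x) powr p)" .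
qed

lemma Lp_duality_tendsto_0:
  fixes X :: "'a \<Rightarrow> 'b::{real_normed_vector,second_countable_topology}"
    and Y :: "nat \<Rightarrow> 'a \<Rightarrow> 'c::{real_normed_vector,second_countable_topology}"
  assumes p: "p > 1" and m: "X \<in> borel_measurable M" "\<And>k. Y k \<in> borel_measurable M"
    and i: "integrable M (\<lambda>x. norm (X x) powr p)" "\<And>k. integrable M (\<lambda>x. norm (Y k x) powr p)"
    and lim: "(\<lambda>k. LINT x|M. norm (Y k x) powr p) \<longlonglongrightarrow> 0"
  shows "(\<lambda>k. LINT x|M. norm (X x) powr (p - 1) * norm (Y k x)) \<longlonglongrightarrow> 0"
proof (rule order_tendstoI)
  fix a :: real assume "a < 0"
  then show "\<forall>\<^sub>F k in sequentially. a < (LINT x|M. norm (X x) powr (p - 1) * norm (Y k x))"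
    by (intro always_eventually allI) (auto intro: less_le_trans)
next
  fix a :: real assume a: "0 < a"
  define A where "A = (LINT x|M. norm (X x) powr p)"
  have A: "A \<ge> 0" by (auto simp: A_def)
  \<comment> \<open>The weight is fixed before \<open>k\<close>: the term with the fixed function
    \<open>X\<close> stays below \<open>a\<close>, and the other one tends to 0 whatever its factor.
    The summand 1 covers \<open>A = 0\<close>.\<close>
  define \<tau> where "\<tau> = a / (2 * (A + 1))"
  have \<tau>: "\<tau> > 0" "\<tau> * A < a"
    using a A by (auto simp: \<tau>_def field_simps intro: add_nonneg_pos)
  have "(\<lambda>k. \<tau> * A + \<tau> powr (1 - p) * (LINT x|M. norm (Y k x) powr p)) \<longlonglongrightarrow> \<tau> * A + \<tau> powr (1 - p) * 0"
    by (intro tendsto_intros lim)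
  then have "\<forall>\<^sub>F k in sequentially. \<tau> * A + \<tau> powr (1 - p) * (LINT x|M. norm (Y k x) powr p) < a"
    using \<tau> by (intro order_tendstoD(2)[of _ "\<tau> * A"]) auto
  then show "\<forall>\<^sub>F k in sequentially. (LINT x|M. norm (X x) powr (p - 1) * norm (Y k x)) < a"
  proof eventually_elim
    case (elim k)
    then show ?case
      using Lp_duality(2)[OF p m(1) m(2)[of k] i(1) i(2)[of k] \<tau>(1)] by (simp add: A_def)
  qed
qed

text \<open>Integrating \<open>powr_diff_bound\<close> with the norm of \<open>f x - F k x\<close>
  as the error gives continuity of the norm without Minkowski's inequality; the mixed term is
  handled by duality.\<close>

lemma tendsto_Lp_norm:
  fixes f :: "'a \<Rightarrow> 'b::{real_normed_vector,second_countable_topology}"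
  assumes p: "p > 1" and m[measurable]: "f \<in> borel_measurable M" "\<And>k. F k \<in> borel_measurable M"
    and i: "integrable M (\<lambda>x. norm (f x) powr p)" "\<And>k. integrable M (\<lambda>x. norm (F k x) powr p)"
    and D: "(\<lambda>k::nat. LINT x|M. norm (f x - F k x) powr p) \<longlonglongrightarrow> 0"
  shows "(\<lambda>k. LINT x|M. norm (F k x) powr p) \<longlonglongrightarrow> (LINT x|M. norm (f x) powr p)"
proof (rule LIM_zero_cancel, rule Lim_null_comparison)
  have id: "integrable M (\<lambda>x. norm (f x - F k x) powr p)" for k
    using p i by (intro integrable_powr_diff) auto
  have iD: "integrable M (\<lambda>x. norm (f x) powr (p - 1) * norm (f x - F k x))" for k
    by (rule Lp_duality(1)[OF p m(1) _ i(1) id]) measurable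
  let ?b = "\<lambda>k. p * 2 powr p * ((LINT x|M. norm (f x) powr (p - 1) * norm (f x - F k x))
    + (LINT x|M. norm (f x - F k x) powr p))"
  have "(\<lambda>k. LINT x|M. norm (f x) powr (p - 1) * norm (f x - F k x)) \<longlonglongrightarrow> 0"
    by (rule Lp_duality_tendsto_0[OF p m(1) _ i(1) id D]) measurable
  from tendsto_mult_right_zero[OF tendsto_add_zero[OF this D]] show "?b \<longlonglongrightarrow> 0" .
  have "norm ((LINT x|M. norm (F k x) powr p) - (LINT x|M. norm (f x) powr p)) \<le> ?b k" for k
  proof -
    have "norm ((LINT x|M. norm (F k x) powr p) - (LINT x|M. norm (f x) powr p))
        = norm (LINT x|M. norm (F k x) powr p - norm (f x) powr p)"
      using i by simp
    also have "\<dots> \<le> (LINT x|M. norm (norm (F k x) powr p - norm (f x) powr p))"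
      by (rule integral_norm_bound)
    also have "\<dots> \<le> (LINT x|M. p * 2 powr p * (norm (f x) powr (p - 1) * norm (f x - F k x) + norm (f x - F k x) powr p))"
    proof (rule integral_mono)
      fix x
      show "norm (norm (F k x) powr p - norm (f x) powr p)
          \<le> p * 2 powr p * (norm (f x) powr (p - 1) * norm (f x - F k x) + norm (f x - F k x) powr p)"
        using powr_diff_bound[of p "norm (f x)" "norm (F k x)"] norm_triangle_ineq3[of "f x" "F k x"] p by simp
    qed (use i id iD in auto)
    also have "\<dots> = ?b k"
      using id iD by simp
    finally show ?thesis .
  qed
  then show "\<forall>\<^sub>F k in sequentially. norm ((LINT x|M. norm (F k x) powr p) - (LINT x|M. norm (f x) powr p)) \<le> ?b k"
    by simp
qed

lemma tendsto_powr_0_cancel: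
  fixes f :: "nat \<Rightarrow> real"
  assumes "p > 0" "\<And>k. f k \<ge> 0" "(\<lambda>k. f k powr p) \<longlonglongrightarrow> 0"
  shows "f \<longlonglongrightarrow> 0"
proof -
  have "(\<lambda>k. (f k powr p) powr (1 / p)) \<longlonglongrightarrow> 0 powr (1 / p)"
    using assms by (intro tendsto_powr'[OF assms(3) tendsto_const]) auto
  then show ?thesis using assms by (simp add: powr_powr)
qed

lemma W1p0_measurable:
  assumes "open \<Omega>" "u \<in> W1p0 p \<Omega>"
  shows "u \<in> borel_measurable (lebesgue_on \<Omega>)" "wgrad \<Omega> u \<in> borel_measurable (lebesgue_on \<Omega>)"
    and "integrable (lebesgue_on \<Omega>) (\<lambda>x. norm (u x) powr p)"
    and "integrable (lebesgue_on \<Omega>) (\<lambda>x. norm (wgrad \<Omega> u x) powr p)"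
    and "weak_gradient \<Omega> u (wgrad \<Omega> u)"
proof -
  have "u \<in> W1p p \<Omega>" using assms(2) by (simp add: W1p0_def)
  from W1p_wgrad[OF assms(1) this] this
  show "u \<in> borel_measurable (lebesgue_on \<Omega>)" "wgrad \<Omega> u \<in> borel_measurable (lebesgue_on \<Omega>)"
    "integrable (lebesgue_on \<Omega>) (\<lambda>x. norm (u x) powr p)"
    "integrable (lebesgue_on \<Omega>) (\<lambda>x. norm (wgrad \<Omega> u x) powr p)"
    "weak_gradient \<Omega> u (wgrad \<Omega> u)"
    by (auto simp: W1p_def Lp_space_def)
qed

text \<open>A subsequence turns convergence in the norm into convergence almost everywhere, so that
  nonlinear functions of the approximants converge as well.\<close>

lemma W1p0_approximation_AE:
  fixes u :: "'a::euclidean_space \<Rightarrow> real"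
  assumes \<Omega>: "open \<Omega>" and p: "p > 0" and u: "u \<in> W1p0 p \<Omega>"
  obtains \<phi> where "\<And>k::nat. \<phi> k \<in> test_functions \<Omega>"
    "AE x in lebesgue_on \<Omega>. (\<lambda>k. \<phi> k x) \<longlonglongrightarrow> u x"
    "(\<lambda>k. LINT x|lebesgue_on \<Omega>. norm (wgrad \<Omega> u x - grad (\<phi> k) x) powr p) \<longlonglongrightarrow> 0"
proof -
  obtain \<phi> where \<phi>: "\<And>k::nat. \<phi> k \<in> test_functions \<Omega>"
    "(\<lambda>k. LINT x|lebesgue_on \<Omega>. norm (u x - \<phi> k x) powr p) \<longlonglongrightarrow> 0"
    "(\<lambda>k. LINT x|lebesgue_on \<Omega>. norm (wgrad \<Omega> u x - grad (\<phi> k) x) powr p) \<longlonglongrightarrow> 0"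
    using W1p0_approximation[OF assms] by blast
  have "integrable (lebesgue_on \<Omega>) (\<lambda>x. norm (u x - \<phi> k x) powr p)" for k
    using W1p0_measurable[OF \<Omega> u] test_functions_lebesgue_on(1)[OF \<Omega> \<phi>(1) p, of k]
      borel_measurable_smooth_lebesgue_on(1)[OF test_functions_smooth[OF \<phi>(1)]]
    by (intro integrable_powr_diff[OF p]) auto
  from tendsto_L1_AE_subseq[where u="\<lambda>k x. norm (u x - \<phi> k x) powr p", OF this] \<phi>(2)
  obtain r where r: "strict_mono r" "AE x in lebesgue_on \<Omega>. (\<lambda>k. norm (u x - \<phi> (r k) x) powr p) \<longlonglongrightarrow> 0"
    by auto
  have "AE x in lebesgue_on \<Omega>. (\<lambda>k. \<phi> (r k) x) \<longlonglongrightarrow> u x"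
    using r(2)
  proof eventually_elim
    case (elim x)
    have "(\<lambda>k. norm (u x - \<phi> (r k) x)) \<longlonglongrightarrow> 0"
      by (rule tendsto_powr_0_cancel[OF p _ elim]) simp
    then have "(\<lambda>k. u x - \<phi> (r k) x) \<longlonglongrightarrow> 0"
      by (rule tendsto_norm_zero_cancel)
    from tendsto_diff[OF tendsto_const[of "u x"] this] show ?case by simp
  qed
  with \<phi>(1) LIMSEQ_subseq_LIMSEQ[OF \<phi>(3) r(1)] show ?thesis
    by (intro that[of "\<phi> \<circ> r"]) (auto simp: o_def)
qed

section \<open>Weak gradients on level sets\<close>

text \<open>\<open>Y k\<close> converges in the \<open>p\<close>-norm, while \<open>V k\<close>
  converges only almost everywhere, dominated by a fixed function of the dual exponent. Replacing
  \<open>Y k\<close> by its limit costs an error that vanishes by duality; for the limit itself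
  dominated convergence applies. In the applications \<open>V k\<close> is a nonlinear function of
  the approximants and \<open>Y k\<close> a gradient.\<close>

lemma tendsto_integral_inner:
  fixes X W :: "'a \<Rightarrow> 'b::euclidean_space"
    and Z :: "'a \<Rightarrow> 'c::{real_normed_vector,second_countable_topology}" and Y :: "nat \<Rightarrow> 'a \<Rightarrow> 'b"
  assumes p: "p > 1"
    and m[measurable]: "X \<in> borel_measurable M" "\<And>k. Y k \<in> borel_measurable M"
      "Z \<in> borel_measurable M" "\<And>k. V k \<in> borel_measurable M" "W \<in> borel_measurable M"
    and i: "integrable M (\<lambda>x. norm (X x) powr p)" "\<And>k. integrable M (\<lambda>x. norm (Y k x) powr p)"
      "integrable M (\<lambda>x. norm (Z x) powr p)"
    and lim: "(\<lambda>k. LINT x|M. norm (X x - Y k x) powr p) \<longlonglongrightarrow> 0"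
    and C: "C \<ge> 0" "\<And>k. AE x in M. norm (V k x) \<le> C * norm (Z x) powr (p - 1)"
    and V: "AE x in M. (\<lambda>k. V k x) \<longlonglongrightarrow> W x"
  shows "(\<lambda>k. LINT x|M. V k x \<bullet> Y k x) \<longlonglongrightarrow> (LINT x|M. W x \<bullet> X x)"
    and "integrable M (\<lambda>x. W x \<bullet> X x)" "\<And>k. integrable M (\<lambda>x. V k x \<bullet> Y k x)"
proof -
  have bound: "norm (V k x \<bullet> A) \<le> C * (norm (Z x) powr (p - 1) * norm A)"
    if "norm (V k x) \<le> C * norm (Z x) powr (p - 1)" for k x A
  proof -
    have "norm (V k x \<bullet> A) \<le> norm (V k x) * norm A"
      using Cauchy_Schwarz_ineq2 by simp
    also have "\<dots> \<le> (C * norm (Z x) powr (p - 1)) * norm A"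
      using that by (intro mult_right_mono) auto
    finally show ?thesis by (simp add: mult.assoc)
  qed
  have iD: "integrable M (\<lambda>x. norm (X x - Y k x) powr p)" for k
    using p i by (intro integrable_powr_diff) auto
  have iX: "integrable M (\<lambda>x. C * (norm (Z x) powr (p - 1) * norm (X x)))"
    using Lp_duality(1)[OF p m(3,1) i(3,1)] by simp
  have dX: "AE x in M. norm (V k x \<bullet> X x) \<le> C * (norm (Z x) powr (p - 1) * norm (X x))" for k
    using C(2) by eventually_elim (rule bound)
  have lX: "AE x in M. (\<lambda>k. V k x \<bullet> X x) \<longlonglongrightarrow> W x \<bullet> X x"
    using V by eventually_elim (intro tendsto_intros)
  have one: "(\<lambda>k. LINT x|M. V k x \<bullet> X x) \<longlonglongrightarrow> (LINT x|M. W x \<bullet> X x)"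
    by (rule integral_dominated_convergence[OF _ _ iX lX dX]) measurable
  have iVX: "integrable M (\<lambda>x. V k x \<bullet> X x)" for k
    by (rule integrable_dominated_convergence2[OF _ _ iX lX dX]) measurable
  show "integrable M (\<lambda>x. W x \<bullet> X x)"
    by (rule integrable_dominated_convergence[OF _ _ iX lX dX]) measurable
  have iZD: "integrable M (\<lambda>x. C * (norm (Z x) powr (p - 1) * norm (X x - Y k x)))" for k
    using Lp_duality(1)[OF p m(3) _ i(3) iD, of k] by simp
  have dD: "AE x in M. norm (V k x \<bullet> (X x - Y k x)) \<le> C * (norm (Z x) powr (p - 1) * norm (X x - Y k x))" for k
    using C(2) by eventually_elim (rule bound)
  have iVD: "integrable M (\<lambda>x. V k x \<bullet> (X x - Y k x))" for k
    by (rule Bochner_Integration.integrable_bound[OF iZD[of k]])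
       (measurable, use dD[of k] in eventually_elim, auto intro: order_trans)
  have two: "(\<lambda>k. LINT x|M. V k x \<bullet> (X x - Y k x)) \<longlonglongrightarrow> 0"
  proof (rule Lim_null_comparison)
    show "\<forall>\<^sub>F k in sequentially. norm (LINT x|M. V k x \<bullet> (X x - Y k x))
        \<le> C * (LINT x|M. norm (Z x) powr (p - 1) * norm (X x - Y k x))"
    proof (intro always_eventually allI)
      fix k
      have "norm (LINT x|M. V k x \<bullet> (X x - Y k x)) \<le> (LINT x|M. norm (V k x \<bullet> (X x - Y k x)))"
        by (rule integral_norm_bound)
      also have "\<dots> \<le> (LINT x|M. C * (norm (Z x) powr (p - 1) * norm (X x - Y k x)))"
        using iVD[of k] iZD[of k] dD[of k] by (intro integral_mono_AE integrable_norm) auto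
      finally show "norm (LINT x|M. V k x \<bullet> (X x - Y k x))
        \<le> C * (LINT x|M. norm (Z x) powr (p - 1) * norm (X x - Y k x))" by simp
    qed
    have "(\<lambda>k. LINT x|M. norm (Z x) powr (p - 1) * norm (X x - Y k x)) \<longlonglongrightarrow> 0"
      by (rule Lp_duality_tendsto_0[OF p m(3) _ i(3) iD lim]) measurable
    from tendsto_mult_right_zero[OF this]
    show "(\<lambda>k. C * (LINT x|M. norm (Z x) powr (p - 1) * norm (X x - Y k x))) \<longlonglongrightarrow> 0" .
  qed
  have e: "(\<lambda>x. V k x \<bullet> Y k x) = (\<lambda>x. V k x \<bullet> X x - V k x \<bullet> (X x - Y k x))" for k
    by (simp add: inner_diff_right)
  show "integrable M (\<lambda>x. V k x \<bullet> Y k x)" for k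
    unfolding e using iVX iVD by (rule Bochner_Integration.integrable_diff)
  show "(\<lambda>k. LINT x|M. V k x \<bullet> Y k x) \<longlonglongrightarrow> (LINT x|M. W x \<bullet> X x)"
    unfolding e Bochner_Integration.integral_diff[OF iVX iVD] using tendsto_diff[OF one two] by simp
qed

text \<open>The truncation \<open>\<lambda>t. d\<^sup>2 (t - c) / (d\<^sup>2 + (t - c)\<^sup>2)\<close> has size \<open>O(d)\<close>, while its derivative is
  bounded and tends to the indicator function of \<open>c\<close> as \<open>d\<close> tends to \<open>0\<close>.\<close>

definition bell :: "real \<Rightarrow> real \<Rightarrow> real \<Rightarrow> real" where
  "bell c d t = d\<^sup>2 * ((t - c) * (d\<^sup>2 + (t - c) * (t - c)) powr (-1))"

definition bell' :: "real \<Rightarrow> real \<Rightarrow> real \<Rightarrow> real" where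
  "bell' c d t = d\<^sup>2 * (d\<^sup>2 - (t - c)\<^sup>2) / (d\<^sup>2 + (t - c)\<^sup>2)\<^sup>2"

text \<open>The definition uses a power with exponent -1, the form covered by
  \<open>smooth_on_powr\<close>; the quotient is the form for derivatives and estimates.\<close>

lemma bell_alt: "d > 0 \<Longrightarrow> bell c d t = d\<^sup>2 * (t - c) / (d\<^sup>2 + (t - c)\<^sup>2)"
  by (simp add: bell_def powr_minus_divide power2_eq_square add_pos_nonneg)

lemma has_derivative_bell:
  assumes "d > 0"
  shows "(bell c d has_real_derivative bell' c d t) (at t)"
proof -
  have pos: "d\<^sup>2 + (t - c)\<^sup>2 > 0" for t
    using assms by (intro add_pos_nonneg) auto
  have "((\<lambda>t. d\<^sup>2 * (t - c) / (d\<^sup>2 + (t - c)\<^sup>2)) has_real_derivative bell' c d t) (at t)"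
    using pos[of t] unfolding bell'_def
    by (auto intro!: derivative_eq_intros simp: field_simps power2_eq_square)
  moreover have "bell c d = (\<lambda>t. d\<^sup>2 * (t - c) / (d\<^sup>2 + (t - c)\<^sup>2))"
    using bell_alt[OF assms] by auto
  ultimately show ?thesis by simp
qed

lemma bell_bound:
  assumes "d > 0"
  shows "\<bar>bell c d t\<bar> \<le> d"
proof -
  have pos: "d\<^sup>2 + (t - c)\<^sup>2 > 0"
    using assms by (intro add_pos_nonneg) auto
  have "2 * (d * \<bar>t - c\<bar>) \<le> d\<^sup>2 + (t - c)\<^sup>2"
    using sum_squares_bound[of d "\<bar>t - c\<bar>"] by (simp add: mult.assoc)
  moreover have "0 \<le> d * \<bar>t - c\<bar>" using assms by simp
  ultimately have "d * \<bar>t - c\<bar> \<le> d\<^sup>2 + (t - c)\<^sup>2" by linarith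
  then have "d * (d * \<bar>t - c\<bar>) \<le> d * (d\<^sup>2 + (t - c)\<^sup>2)"
    using assms by (intro mult_left_mono) auto
  then show ?thesis
    using pos by (simp add: bell_alt[OF assms] abs_mult abs_divide abs_of_pos[OF pos] divide_le_eq power2_eq_square mult.assoc)
qed

lemma bell'_bound:
  assumes "d > 0"
  shows "\<bar>bell' c d t\<bar> \<le> 1"
proof -
  have "\<bar>d\<^sup>2 * (d\<^sup>2 - (t - c)\<^sup>2)\<bar> = d\<^sup>2 * \<bar>d\<^sup>2 - (t - c)\<^sup>2\<bar>"
    by (simp add: abs_mult)
  also have "\<dots> \<le> (d\<^sup>2 + (t - c)\<^sup>2) * (d\<^sup>2 + (t - c)\<^sup>2)"
    by (intro mult_mono) (auto simp: abs_le_iff)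
  finally have "\<bar>d\<^sup>2 * (d\<^sup>2 - (t - c)\<^sup>2)\<bar> \<le> (d\<^sup>2 + (t - c)\<^sup>2)\<^sup>2"
    by (simp add: power2_eq_square)
  moreover have "(d\<^sup>2 + (t - c)\<^sup>2)\<^sup>2 > 0"
    using assms by (intro zero_less_power add_pos_nonneg) auto
  ultimately show ?thesis by (simp add: bell'_def abs_divide)
qed

lemma bell'_limit:
  "(\<lambda>n. bell' c (1 / real (Suc n)) t) \<longlonglongrightarrow> (if t = c then 1 else 0)"
proof (cases "t = c")
  case True
  have "bell' c d c = 1" if "d > 0" for d
    using that by (simp add: bell'_def power2_eq_square)
  then show ?thesis using True by simp
next
  case False
  have d: "(\<lambda>n. 1 / real (Suc n)) \<longlonglongrightarrow> 0"
    by (rule LIMSEQ_Suc[OF lim_1_over_n])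
  have "(\<lambda>n. bell' c (1 / real (Suc n)) t) \<longlonglongrightarrow> 0\<^sup>2 * (0\<^sup>2 - (t - c)\<^sup>2) / (0\<^sup>2 + (t - c)\<^sup>2)\<^sup>2"
    unfolding bell'_def using False by (intro tendsto_intros d) auto
  then show ?thesis using False by simp
qed

lemma smooth_on_bell:
  assumes "smooth_on UNIV \<phi>" "d > 0"
  shows "smooth_on UNIV (\<lambda>x. bell c d (\<phi> x))"
  unfolding bell_def using assms
  by (intro smooth_on_mult smooth_on_const smooth_on_powr smooth_on_add smooth_on_diff)
     (auto intro: add_pos_nonneg)

lemma continuous_bell: "d > 0 \<Longrightarrow> isCont (bell c d) t"
  using has_derivative_bell DERIV_isCont by blast

lemma continuous_bell': "d > 0 \<Longrightarrow> isCont (bell' c d) t"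
proof -
  assume d: "d > 0"
  have "(d\<^sup>2 + (t - c)\<^sup>2)\<^sup>2 \<noteq> 0" for t
    using d add_pos_nonneg[of "d\<^sup>2" "(t - c)\<^sup>2"] by auto
  then show ?thesis
    unfolding bell'_def by (intro continuous_intros) auto
qed

text \<open>The chain rule for the weak gradient of \<open>bell c d\<close> composed with
  \<open>u\<close>, in tested form. For test functions in place of \<open>u\<close> it is classical
  integration by parts, and both sides pass to the limit.\<close>

lemma integral_bell:
  fixes \<Omega> :: "'a::euclidean_space set"
  assumes \<Omega>: "open \<Omega>" "bounded \<Omega>" and p: "p > 1" and u: "u \<in> W1p0 p \<Omega>"
    and d: "d > 0" and \<psi>: "\<psi> \<in> test_functions \<Omega>"
  shows "(LINT x|lebesgue_on \<Omega>. bell c d (u x) * (grad \<psi> x \<bullet> b))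
    = - (LINT x|lebesgue_on \<Omega>. bell' c d (u x) * (wgrad \<Omega> u x \<bullet> b) * \<psi> x)"
proof -
  let ?M = "lebesgue_on \<Omega>"
  interpret finite_measure ?M
    using \<Omega> by (intro finite_measure_lebesgue_on lmeasurable_open)
  have p0: "p > 0" using p by simp
  obtain \<phi> where \<phi>: "\<And>k::nat. \<phi> k \<in> test_functions \<Omega>"
    "AE x in ?M. (\<lambda>k. \<phi> k x) \<longlonglongrightarrow> u x"
    "(\<lambda>k. LINT x|?M. norm (wgrad \<Omega> u x - grad (\<phi> k) x) powr p) \<longlonglongrightarrow> 0"
    using W1p0_approximation_AE[OF \<Omega>(1) p0 u] by blast
  note s = test_functions_smooth[OF \<phi>(1)] and s\<psi> = test_functions_smooth[OF \<psi>]
  obtain B where B: "B \<ge> 0" "\<And>x. \<bar>\<psi> x\<bar> \<le> B" "\<And>x. norm (grad \<psi> x) \<le> B"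
    using test_functions_bounded[OF \<psi>] by metis
  have cb: "continuous_on UNIV (bell c d)" "continuous_on UNIV (bell' c d)"
    using continuous_bell[OF d] continuous_bell'[OF d] by (auto intro: continuous_at_imp_continuous_on)
  have [measurable]: "bell c d \<in> borel_measurable borel" "bell' c d \<in> borel_measurable borel"
    using cb by (auto intro: borel_measurable_continuous_onI)
  note [measurable] = borel_measurable_smooth_lebesgue_on[OF s] borel_measurable_smooth_lebesgue_on[OF s\<psi>]
    W1p0_measurable(1,2)[OF \<Omega>(1) u]
  have bb: "\<bar>grad \<psi> x \<bullet> b\<bar> \<le> B * norm b" for x
    using Cauchy_Schwarz_ineq2[of "grad \<psi> x" b] B(3)[of x] by (meson mult_right_mono norm_ge_zero order_trans)
  have L: "(\<lambda>k. LINT x|?M. bell c d (\<phi> k x) * (grad \<psi> x \<bullet> b)) \<longlonglongrightarrow> (LINT x|?M. bell c d (u x) * (grad \<psi> x \<bullet> b))"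
  proof (rule integral_dominated_convergence[where w="\<lambda>x. d * (B * norm b)"])
    show "AE x in ?M. (\<lambda>k. bell c d (\<phi> k x) * (grad \<psi> x \<bullet> b)) \<longlonglongrightarrow> bell c d (u x) * (grad \<psi> x \<bullet> b)"
      using \<phi>(2) by eventually_elim (intro tendsto_mult tendsto_const isCont_tendsto_compose[OF continuous_bell[OF d]])
    show "AE x in ?M. norm (bell c d (\<phi> k x) * (grad \<psi> x \<bullet> b)) \<le> d * (B * norm b)" for k
      using bell_bound[OF d] bb d by (intro AE_I2) (auto simp: abs_mult intro!: mult_mono)
  qed auto
  \<comment> \<open>The factors in front of the gradients are uniformly bounded. On a set of finite
    measure the constant 1 can serve as the dominating function \<open>Z\<close>.\<close>
  have R: "(\<lambda>k. LINT x|?M. ((bell' c d (\<phi> k x) * \<psi> x) *\<^sub>R b) \<bullet> grad (\<phi> k) x)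
      \<longlonglongrightarrow> (LINT x|?M. ((bell' c d (u x) * \<psi> x) *\<^sub>R b) \<bullet> wgrad \<Omega> u x)"
  proof (rule tendsto_integral_inner(1)[OF p _ _ _ _ _ _ _ _ \<phi>(3), where Z="\<lambda>x. 1::real" and C="B * norm b"])
    show "AE x in ?M. norm ((bell' c d (\<phi> k x) * \<psi> x) *\<^sub>R b) \<le> B * norm b * norm (1::real) powr (p - 1)" for k
    proof (rule AE_I2)
      fix x
      have "\<bar>bell' c d (\<phi> k x)\<bar> * \<bar>\<psi> x\<bar> \<le> 1 * B"
        using bell'_bound[OF d] B by (intro mult_mono) auto
      then have "\<bar>bell' c d (\<phi> k x)\<bar> * \<bar>\<psi> x\<bar> * norm b \<le> B * norm b"
        by (intro mult_right_mono) auto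
      then show "norm ((bell' c d (\<phi> k x) * \<psi> x) *\<^sub>R b) \<le> B * norm b * norm (1::real) powr (p - 1)"
        by (simp add: abs_mult)
    qed
    show "AE x in ?M. (\<lambda>k. (bell' c d (\<phi> k x) * \<psi> x) *\<^sub>R b) \<longlonglongrightarrow> (bell' c d (u x) * \<psi> x) *\<^sub>R b"
      using \<phi>(2) by eventually_elim
        (intro tendsto_mult tendsto_scaleR tendsto_const isCont_tendsto_compose[OF continuous_bell'[OF d]])
  qed (use W1p0_measurable[OF \<Omega>(1) u] test_functions_lebesgue_on(2)[OF \<Omega>(1) \<phi>(1) p0] B in \<open>auto\<close>)
  have "(LINT x|?M. bell c d (\<phi> k x) * (grad \<psi> x \<bullet> b))
      = - (LINT x|?M. ((bell' c d (\<phi> k x) * \<psi> x) *\<^sub>R b) \<bullet> grad (\<phi> k) x)" for k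
  proof -
    note [measurable] = borel_measurable_smooth[OF s[of k]] borel_measurable_smooth[OF s\<psi>]
    have "(LINT x|?M. bell c d (\<phi> k x) * (grad \<psi> x \<bullet> b)) = (LINT x|lborel. bell c d (\<phi> k x) * (grad \<psi> x \<bullet> b))"
      by (rule lebesgue_on_eq_lborel[OF \<Omega>(1)]) (auto simp: test_functions_zero_outside[OF \<psi>])
    also have "\<dots> = - (LINT x|lborel. (grad (\<lambda>x. bell c d (\<phi> k x)) x \<bullet> b) * \<psi> x)"
      by (rule integration_by_parts[OF smooth_on_bell[OF s d] \<psi>])
    also have "\<dots> = - (LINT x|lborel. ((bell' c d (\<phi> k x) * \<psi> x) *\<^sub>R b) \<bullet> grad (\<phi> k) x)"
      unfolding grad_compose[OF s has_derivative_bell[OF d]] by (simp add: inner_commute mult_ac)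
    also have "(LINT x|lborel. ((bell' c d (\<phi> k x) * \<psi> x) *\<^sub>R b) \<bullet> grad (\<phi> k) x)
        = (LINT x|?M. ((bell' c d (\<phi> k x) * \<psi> x) *\<^sub>R b) \<bullet> grad (\<phi> k) x)"
      by (rule lebesgue_on_eq_lborel[OF \<Omega>(1), symmetric]) (auto simp: test_functions_zero_outside[OF \<psi>])
    finally show ?thesis .
  qed
  then have "(LINT x|?M. bell c d (u x) * (grad \<psi> x \<bullet> b))
      = - (LINT x|?M. ((bell' c d (u x) * \<psi> x) *\<^sub>R b) \<bullet> wgrad \<Omega> u x)"
    using LIMSEQ_unique[OF L] tendsto_minus[OF R] by simp
  then show ?thesis by (simp add: inner_commute mult_ac)
qed

text \<open>Stampacchia's lemma. As \<open>d\<close> tends to 0 in \<open>integral_bell\<close>, the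
  left side is of order \<open>d\<close>, while the right side tends to the integral of the gradient
  against \<open>\<psi>\<close> over the level set. The gradient restricted to the level set thus
  annihilates all test functions, and the fundamental lemma applies.\<close>

lemma wgrad_eq_0_on_level_set:
  fixes \<Omega> :: "'a::euclidean_space set"
  assumes \<Omega>: "open \<Omega>" "bounded \<Omega>" and p: "p > 1" and u: "u \<in> W1p0 p \<Omega>"
  shows "AE x in lebesgue_on \<Omega>. u x = c \<longrightarrow> wgrad \<Omega> u x = 0"
proof -
  let ?M = "lebesgue_on \<Omega>"
  let ?X = "wgrad \<Omega> u"
  interpret finite_measure ?M
    using \<Omega> by (intro finite_measure_lebesgue_on lmeasurable_open)
  have [measurable]: "u \<in> borel_measurable ?M" "?X \<in> borel_measurable ?M"
    using W1p0_measurable(1,2)[OF \<Omega>(1) u] by auto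
  have w: "weak_gradient \<Omega> u ?X"
    by (rule W1p0_measurable(5)[OF \<Omega>(1) u])
  have "AE x in ?M. (if u x = c then 1 else 0) * (?X x \<bullet> b) = 0" if b: "b \<in> Basis" for b
  proof (rule fundamental_lemma_calculus_of_variations[OF \<Omega>(1)])
    have li: "locally_integrable_on (\<lambda>x. ?X x \<bullet> b) \<Omega>"
      using w by (auto simp: weak_gradient_def intro: locally_integrable_on_inner)
    show "locally_integrable_on (\<lambda>x. (if u x = c then 1 else 0) * (?X x \<bullet> b)) \<Omega>"
      unfolding locally_integrable_on_def
    proof (intro allI impI, elim conjE)
      fix K :: "'a set" assume K: "compact K" "K \<subseteq> \<Omega>"
      have "(\<lambda>x. if u x = c then 1 else 0 :: real) \<in> borel_measurable ?M" by measurable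
      then have "(\<lambda>x. if u x = c then 1 else 0 :: real) \<in> borel_measurable (lebesgue_on K)"
        using K(2) by (rule measurable_restrict_mono)
      moreover have "bounded ((\<lambda>x. if u x = c then 1 else 0 :: real) ` K)"
        by (rule bounded_subset[of "{0, 1}"]) auto
      moreover have "K \<in> sets lebesgue"
        using K(1) by (simp add: lmeasurable_compact fmeasurableD)
      ultimately show "(\<lambda>x. (if u x = c then 1 else 0) * (?X x \<bullet> b)) absolutely_integrable_on K"
        using li K unfolding locally_integrable_on_def
        by (intro absolutely_integrable_bounded_measurable_product[OF bilinear_times]) auto
    qed
    fix \<psi> assume \<psi>: "\<psi> \<in> test_functions \<Omega>"
    note s\<psi> = test_functions_smooth[OF \<psi>]
    note [measurable] = borel_measurable_smooth_lebesgue_on[OF s\<psi>]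
    obtain B where B: "B \<ge> 0" "\<And>x. \<bar>\<psi> x\<bar> \<le> B" "\<And>x. norm (grad \<psi> x) \<le> B"
      using test_functions_bounded[OF \<psi>] by metis
    define \<delta> where "\<delta> n = 1 / real (Suc n)" for n
    have \<delta>: "\<delta> n > 0" for n by (simp add: \<delta>_def)
    have [measurable]: "bell c (\<delta> n) \<in> borel_measurable borel" "bell' c (\<delta> n) \<in> borel_measurable borel" for n
      using continuous_bell[OF \<delta>] continuous_bell'[OF \<delta>]
      by (auto intro!: borel_measurable_continuous_onI continuous_at_imp_continuous_on)
    have i: "integrable ?M (\<lambda>x. (?X x \<bullet> b) * \<psi> x)"
      by (rule weak_gradient_integrable(2)[OF \<Omega>(1) w \<psi>])
    have "(\<lambda>n. LINT x|?M. bell' c (\<delta> n) (u x) * (?X x \<bullet> b) * \<psi> x)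
        \<longlonglongrightarrow> (LINT x|?M. (if u x = c then 1 else 0) * (?X x \<bullet> b) * \<psi> x)"
    proof (rule integral_dominated_convergence[where w="\<lambda>x. norm ((?X x \<bullet> b) * \<psi> x)"])
      show "integrable ?M (\<lambda>x. norm ((?X x \<bullet> b) * \<psi> x))"
        using i by (rule integrable_norm)
      show "AE x in ?M. (\<lambda>n. bell' c (\<delta> n) (u x) * (?X x \<bullet> b) * \<psi> x)
          \<longlonglongrightarrow> (if u x = c then 1 else 0) * (?X x \<bullet> b) * \<psi> x"
        unfolding \<delta>_def by (intro AE_I2 tendsto_mult tendsto_const bell'_limit)
      show "AE x in ?M. norm (bell' c (\<delta> n) (u x) * (?X x \<bullet> b) * \<psi> x) \<le> norm ((?X x \<bullet> b) * \<psi> x)" for n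
      proof (rule AE_I2)
        fix x
        have "norm (bell' c (\<delta> n) (u x)) * norm ((?X x \<bullet> b) * \<psi> x) \<le> 1 * norm ((?X x \<bullet> b) * \<psi> x)"
          using bell'_bound[OF \<delta>] by (intro mult_right_mono) auto
        then show "norm (bell' c (\<delta> n) (u x) * (?X x \<bullet> b) * \<psi> x) \<le> norm ((?X x \<bullet> b) * \<psi> x)"
          by (simp add: abs_mult)
      qed
    qed measurable
    moreover have "(\<lambda>n. LINT x|?M. bell' c (\<delta> n) (u x) * (?X x \<bullet> b) * \<psi> x) \<longlonglongrightarrow> 0"
    proof (rule Lim_null_comparison)
      have "(\<lambda>n. \<delta> n * (B * norm b * measure ?M (space ?M))) \<longlonglongrightarrow> 0"
        unfolding \<delta>_def by (intro tendsto_mult_left_zero LIMSEQ_Suc[OF lim_1_over_n])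
      then show "(\<lambda>n. \<delta> n * (B * norm b * measure ?M (space ?M))) \<longlonglongrightarrow> 0" .
      show "\<forall>\<^sub>F n in sequentially. norm (LINT x|?M. bell' c (\<delta> n) (u x) * (?X x \<bullet> b) * \<psi> x)
          \<le> \<delta> n * (B * norm b * measure ?M (space ?M))"
      proof (intro always_eventually allI)
        fix n
        have bnd: "norm (bell c (\<delta> n) (u x) * (grad \<psi> x \<bullet> b)) \<le> \<delta> n * (B * norm b)" for x
        proof -
          have "\<bar>grad \<psi> x \<bullet> b\<bar> \<le> B * norm b"
            using Cauchy_Schwarz_ineq2[of "grad \<psi> x" b] B(3)[of x] by (meson mult_right_mono norm_ge_zero order_trans)
          then show ?thesis
            unfolding real_norm_def abs_mult using bell_bound[OF \<delta>] less_imp_le[OF \<delta>] by (intro mult_mono) auto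
        qed
        have ib: "integrable ?M (\<lambda>x. bell c (\<delta> n) (u x) * (grad \<psi> x \<bullet> b))"
          by (rule integrable_const_bound[OF AE_I2[OF bnd]]) measurable
        have "norm (LINT x|?M. bell' c (\<delta> n) (u x) * (?X x \<bullet> b) * \<psi> x)
            = norm (LINT x|?M. bell c (\<delta> n) (u x) * (grad \<psi> x \<bullet> b))"
          unfolding integral_bell[OF \<Omega> p u \<delta> \<psi>] by simp
        also have "\<dots> \<le> (LINT x|?M. norm (bell c (\<delta> n) (u x) * (grad \<psi> x \<bullet> b)))"
          by (rule integral_norm_bound)
        also have "\<dots> \<le> (LINT x|?M. \<delta> n * (B * norm b))"
          using ib bnd by (intro integral_mono integrable_norm) auto
        also have "\<dots> = \<delta> n * (B * norm b * measure ?M (space ?M))"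
          by simp
        finally show "norm (LINT x|?M. bell' c (\<delta> n) (u x) * (?X x \<bullet> b) * \<psi> x)
          \<le> \<delta> n * (B * norm b * measure ?M (space ?M))" .
      qed
    qed
    ultimately show "(LINT x|?M. (if u x = c then 1 else 0) * (?X x \<bullet> b) * \<psi> x) = 0"
      by (rule LIMSEQ_unique)
  qed
  then have "AE x in ?M. \<forall>b\<in>Basis. (if u x = c then 1 else 0) * (?X x \<bullet> b) = 0"
    by (intro AE_finite_allI) auto
  then show ?thesis
    by eventually_elim (auto intro: euclidean_eqI)
qed

section \<open>Picone's inequality\<close>

text \<open>A smooth version of \<open>(t + \<delta>) powr (1 - p)\<close> for \<open>t > 0\<close>: the test functions approximating a
  positive Sobolev function may change sign.\<close>

definition reg_inv_powr :: "real \<Rightarrow> real \<Rightarrow> real \<Rightarrow> real \<Rightarrow> real" where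
  "reg_inv_powr p \<delta> e t = ((t * t + e * e) powr (1/2) + \<delta>) powr (1 - p)"

definition reg_inv_powr' :: "real \<Rightarrow> real \<Rightarrow> real \<Rightarrow> real \<Rightarrow> real" where
  "reg_inv_powr' p \<delta> e t =
     (1 - p) * ((t * t + e * e) powr (1/2) + \<delta>) powr (- p) * (t * (t * t + e * e) powr (- (1/2)))"

lemma has_derivative_reg_inv_powr:
  assumes "\<delta> > 0" "e > 0"
  shows "(reg_inv_powr p \<delta> e has_real_derivative reg_inv_powr' p \<delta> e t) (at t)"
proof -
  have pos: "t * t + e * e > 0"
    using assms by (intro add_nonneg_pos) auto
  have pos2: "(t * t + e * e) powr (1/2) + \<delta> > 0"
    using assms by (intro add_nonneg_pos) auto
  have N: "((t * t + e * e) powr (1/2) + \<delta>) powr (1 - p) / ((t * t + e * e) powr (1/2) + \<delta>)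
      = ((t * t + e * e) powr (1/2) + \<delta>) powr (- p)"
    using pos2 powr_diff[of "(t * t + e * e) powr (1/2) + \<delta>" "1 - p" 1] by simp
  have "((\<lambda>t. t * t + e * e) has_real_derivative 2 * t) (at t)"
    by (auto intro!: derivative_eq_intros)
  from DERIV_powr[OF this pos DERIV_const[of "1/2"]]
  have "((\<lambda>t. (t * t + e * e) powr (1/2)) has_real_derivative (t * t + e * e) powr (1/2) * (t / (t * t + e * e))) (at t)"
    by simp
  then have "((\<lambda>t. (t * t + e * e) powr (1/2) + \<delta>) has_real_derivative (t * t + e * e) powr (1/2) * (t / (t * t + e * e))) (at t)"
    using DERIV_add[OF _ DERIV_const[of \<delta>]] by fastforce
  from DERIV_powr[OF this pos2 DERIV_const[of "1 - p"]]
  have "(reg_inv_powr p \<delta> e has_real_derivative ((t * t + e * e) powr (1/2) + \<delta>) powr (1 - p) *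
      ((t * t + e * e) powr (1/2) * (t / (t * t + e * e)) * (1 - p) / ((t * t + e * e) powr (1/2) + \<delta>))) (at t)"
    unfolding reg_inv_powr_def[abs_def] by simp
  moreover have "(t * t + e * e) powr (1/2) * (t / (t * t + e * e)) = t * (t * t + e * e) powr (- (1/2))"
    using pos powr_diff[of "t * t + e * e" "1/2" 1] by simp
  ultimately have "(reg_inv_powr p \<delta> e has_real_derivative ((t * t + e * e) powr (1/2) + \<delta>) powr (1 - p) *
      (t * (t * t + e * e) powr (- (1/2)) * (1 - p) / ((t * t + e * e) powr (1/2) + \<delta>))) (at t)"
    by (simp only:)
  also have "((t * t + e * e) powr (1/2) + \<delta>) powr (1 - p) *
      (t * (t * t + e * e) powr (- (1/2)) * (1 - p) / ((t * t + e * e) powr (1/2) + \<delta>))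
    = (((t * t + e * e) powr (1/2) + \<delta>) powr (1 - p) / ((t * t + e * e) powr (1/2) + \<delta>))
      * (t * (t * t + e * e) powr (- (1/2)) * (1 - p))"
    by simp
  also have "\<dots> = reg_inv_powr' p \<delta> e t"
    unfolding N reg_inv_powr'_def by simp
  finally show ?thesis .
qed

text \<open>Here and for the derivative the bound does not depend on \<open>e\<close>. This gives
  dominated convergence while \<open>e\<close> tends to 0 together with the approximation of
  \<open>u\<close>.\<close>

lemma reg_inv_powr_bound:
  assumes "p > 1" "\<delta> > 0"
  shows "0 \<le> reg_inv_powr p \<delta> e t" "reg_inv_powr p \<delta> e t \<le> \<delta> powr (1 - p)"
  using assms unfolding reg_inv_powr_def by (auto intro!: powr_mono2')

lemma reg_inv_powr'_bound:
  assumes "p > 1" "\<delta> > 0" "e > 0"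
  shows "\<bar>reg_inv_powr' p \<delta> e t\<bar> \<le> (p - 1) * \<delta> powr (- p)"
proof -
  have "\<bar>t\<bar> = (t * t) powr (1/2)"
    by (simp add: powr_half_sqrt)
  also have "\<dots> \<le> (t * t + e * e) powr (1/2)"
    by (intro powr_mono2) auto
  finally have "\<bar>t\<bar> * (t * t + e * e) powr (- (1/2)) \<le> (t * t + e * e) powr (1/2) * (t * t + e * e) powr (- (1/2))"
    by (intro mult_right_mono) auto
  also have "\<dots> = 1" using assms(3) by (simp flip: powr_add)
  finally have 1: "\<bar>t * (t * t + e * e) powr (- (1/2))\<bar> \<le> 1" by (simp add: abs_mult)
  have 2: "((t * t + e * e) powr (1/2) + \<delta>) powr (- p) \<le> \<delta> powr (- p)"
    using assms by (intro powr_mono2') auto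
  have "\<bar>reg_inv_powr' p \<delta> e t\<bar>
      = ((p - 1) * ((t * t + e * e) powr (1/2) + \<delta>) powr (- p)) * \<bar>t * (t * t + e * e) powr (- (1/2))\<bar>"
    using assms by (simp add: reg_inv_powr'_def abs_mult)
  also have "\<dots> \<le> ((p - 1) * \<delta> powr (- p)) * 1"
    using 1 2 assms by (intro mult_mono mult_left_mono) auto
  finally show ?thesis by simp
qed

text \<open>At a positive limit the smoothed absolute value tends to \<open>u\<close> and its
  derivative to 1, so both smoothings disappear at once; the signs of the individual
  \<open>f k\<close> do not matter.\<close>

lemma reg_inv_powr_tendsto:
  assumes u: "f \<longlonglongrightarrow> u" "u > 0" and e: "e \<longlonglongrightarrow> 0" and \<delta>: "\<delta> > 0"
  shows "(\<lambda>k. reg_inv_powr p \<delta> (e k) (f k)) \<longlonglongrightarrow> (u + \<delta>) powr (1 - p)"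
    and "(\<lambda>k. reg_inv_powr' p \<delta> (e k) (f k)) \<longlonglongrightarrow> (1 - p) * (u + \<delta>) powr (- p)"
proof -
  have l: "(\<lambda>k. f k * f k + e k * e k) \<longlonglongrightarrow> u * u + 0 * 0"
    by (intro tendsto_intros u e)
  have h: "(u * u + 0 * 0) powr (1/2) = u"
    using u(2) by (simp add: powr_half_sqrt)
  have g: "(u * u + 0 * 0) powr (- (1/2)) = 1 / u"
    using u(2) h by (simp add: powr_minus_divide)
  have 1: "(\<lambda>k. (f k * f k + e k * e k) powr (1/2)) \<longlonglongrightarrow> u"
    using tendsto_powr[OF l tendsto_const[of "1/2"]] u(2) unfolding h by simp
  have 2: "(\<lambda>k. (f k * f k + e k * e k) powr (- (1/2))) \<longlonglongrightarrow> 1 / u"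
    using tendsto_powr[OF l tendsto_const[of "- (1/2)"]] u(2) unfolding g by simp
  show "(\<lambda>k. reg_inv_powr p \<delta> (e k) (f k)) \<longlonglongrightarrow> (u + \<delta>) powr (1 - p)"
    unfolding reg_inv_powr_def using u \<delta> by (intro tendsto_intros 1) auto
  have "(\<lambda>k. reg_inv_powr' p \<delta> (e k) (f k)) \<longlonglongrightarrow> (1 - p) * (u + \<delta>) powr (- p) * (u * (1 / u))"
    unfolding reg_inv_powr'_def using u \<delta> by (intro tendsto_mult tendsto_powr tendsto_add tendsto_const 1 2) auto
  then show "(\<lambda>k. reg_inv_powr' p \<delta> (e k) (f k)) \<longlonglongrightarrow> (1 - p) * (u + \<delta>) powr (- p)"
    using u(2) by simp
qed

lemma smooth_on_reg_inv_powr: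
  assumes "smooth_on UNIV \<phi>" "\<delta> > 0" "e > 0"
  shows "smooth_on UNIV (\<lambda>x. reg_inv_powr p \<delta> e (\<phi> x))"
  unfolding reg_inv_powr_def using assms
  by (intro smooth_on_powr smooth_on_add smooth_on_mult smooth_on_const) (auto intro: add_nonneg_pos)

section \<open>The field of the p-Laplacian and testing with quotients\<close>

definition flux :: "real \<Rightarrow> 'b::real_normed_vector \<Rightarrow> 'b" where
  "flux p \<xi> = norm \<xi> powr (p - 2) *\<^sub>R \<xi>"

lemma norm_flux: "norm (flux p \<xi>) = norm \<xi> powr (p - 1)"
  using powr_add[of "norm \<xi>" "p - 2" 1] by (cases "\<xi> = 0") (auto simp: flux_def)

lemma inner_flux_self: "flux p \<xi> \<bullet> \<xi> = norm \<xi> powr p"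
  using powr_add[of "norm \<xi>" "p - 2" 2] 
  by (cases "\<xi> = 0") (auto simp: flux_def dot_square_norm powr_numeral)

lemma flux_scaleR: "a > 0 \<Longrightarrow> flux p (a *\<^sub>R \<xi>) = a powr (p - 1) *\<^sub>R flux p \<xi>"
  using powr_add[of a "p - 2" 1] by (simp add: flux_def powr_mult mult_ac)

lemma flux_measurable[measurable]:
  fixes X :: "'a \<Rightarrow> 'b::{real_normed_vector,second_countable_topology}"
  assumes [measurable]: "X \<in> borel_measurable M"
  shows "(\<lambda>x. flux p (X x)) \<in> borel_measurable M"
  unfolding flux_def by measurable

text \<open>The shift by \<open>\<epsilon>\<close> makes the power smooth at the zeros of \<open>\<psi>\<close>, also for non-integer \<open>p\<close>.\<close>

lemma test_functions_shifted_powr: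
  assumes \<psi>: "\<psi> \<in> test_functions \<Omega>" "\<And>x. \<psi> x \<ge> 0" and \<epsilon>: "\<epsilon> > 0"
  shows "(\<lambda>x. (\<psi> x + \<epsilon>) powr p - \<epsilon> powr p) \<in> test_functions \<Omega>"
    and "grad (\<lambda>x. (\<psi> x + \<epsilon>) powr p - \<epsilon> powr p) x = (p * (\<psi> x + \<epsilon>) powr (p - 1)) *\<^sub>R grad \<psi> x"
proof -
  note s = test_functions_smooth[OF \<psi>(1)]
  have "smooth_on UNIV (\<lambda>x. (\<psi> x + \<epsilon>) powr p - \<epsilon> powr p)"
    using \<psi> \<epsilon> by (intro smooth_on_diff smooth_on_powr smooth_on_add smooth_on_const s) (auto intro: add_nonneg_pos)
  \<comment> \<open>Subtracting \<open>\<epsilon> powr p\<close> restores the zeros of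
    \<open>\<psi>\<close>, hence the compact support that the shift destroyed.\<close>
  then show "(\<lambda>x. (\<psi> x + \<epsilon>) powr p - \<epsilon> powr p) \<in> test_functions \<Omega>"
    by (rule test_functionsI[OF \<psi>(1)]) auto
  have pos: "\<psi> x + \<epsilon> > 0" using \<psi>(2)[of x] \<epsilon> by simp
  have "((\<lambda>t. t + \<epsilon>) has_real_derivative 1) (at (\<psi> x))"
    by (auto intro!: derivative_eq_intros)
  from DERIV_powr[OF this pos DERIV_const[of p]]
  have "((\<lambda>t. (t + \<epsilon>) powr p) has_real_derivative (\<psi> x + \<epsilon>) powr p * (p / (\<psi> x + \<epsilon>))) (at (\<psi> x))"
    by simp
  also have "(\<psi> x + \<epsilon>) powr p * (p / (\<psi> x + \<epsilon>)) = p * (\<psi> x + \<epsilon>) powr (p - 1)"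
    using pos by (simp add: powr_diff)
  finally have "((\<lambda>t. (t + \<epsilon>) powr p - \<epsilon> powr p) has_real_derivative p * (\<psi> x + \<epsilon>) powr (p - 1)) (at (\<psi> x))"
    using DERIV_diff[OF _ DERIV_const[of "\<epsilon> powr p"]] by fastforce
  from grad_compose[OF s this]
  show "grad (\<lambda>x. (\<psi> x + \<epsilon>) powr p - \<epsilon> powr p) x = (p * (\<psi> x + \<epsilon>) powr (p - 1)) *\<^sub>R grad \<psi> x" .
qed

definition tested_solution ::
  "real \<Rightarrow> 'a::euclidean_space set \<Rightarrow> ('a \<Rightarrow> real) \<Rightarrow> ('a \<Rightarrow> real) \<Rightarrow> bool" where
  "tested_solution p \<Omega> F u \<longleftrightarrow> (\<forall>\<phi>\<in>test_functions \<Omega>.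
     integrable (lebesgue_on \<Omega>) (\<lambda>x. F x * \<phi> x) \<and>
     (LINT x|lebesgue_on \<Omega>. flux p (wgrad \<Omega> u x) \<bullet> grad \<phi> x) = (LINT x|lebesgue_on \<Omega>. F x * \<phi> x))"

text \<open>This is the equation tested with
  \<open>\<Phi> x * (u x + \<delta>) powr (1 - p)\<close>. That product is not smooth, so the
  equation is tested with \<open>\<Phi> x * g k x\<close>, where \<open>g k\<close> is a smooth
  function of an approximant of \<open>u\<close>; the product rule gives the two integrals on the
  left. The shift \<open>\<delta>\<close> keeps the negative powers bounded.\<close>

lemma picone_identity:
  fixes \<Omega> :: "'a::euclidean_space set" and u F :: "'a \<Rightarrow> real"
  assumes \<Omega>: "open \<Omega>" "bounded \<Omega>" and p: "p > 1" and u: "u \<in> W1p0 p \<Omega>"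
    and pos: "AE x in lebesgue_on \<Omega>. u x > 0"
    and F: "tested_solution p \<Omega> F u"
    and \<Phi>: "\<Phi> \<in> test_functions \<Omega>" and \<delta>: "\<delta> > 0"
  shows "integrable (lebesgue_on \<Omega>) (\<lambda>x. (u x + \<delta>) powr (1 - p) *\<^sub>R flux p (wgrad \<Omega> u x) \<bullet> grad \<Phi> x)"
    and "integrable (lebesgue_on \<Omega>) (\<lambda>x. (1 - p) * (u x + \<delta>) powr (- p) * \<Phi> x * norm (wgrad \<Omega> u x) powr p)"
    and "integrable (lebesgue_on \<Omega>) (\<lambda>x. F x * \<Phi> x * (u x + \<delta>) powr (1 - p))"
    and "(LINT x|lebesgue_on \<Omega>. (u x + \<delta>) powr (1 - p) *\<^sub>R flux p (wgrad \<Omega> u x) \<bullet> grad \<Phi> x)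
       + (LINT x|lebesgue_on \<Omega>. (1 - p) * (u x + \<delta>) powr (- p) * \<Phi> x * norm (wgrad \<Omega> u x) powr p)
       = (LINT x|lebesgue_on \<Omega>. F x * \<Phi> x * (u x + \<delta>) powr (1 - p))"
proof -
  let ?M = "lebesgue_on \<Omega>" and ?X = "wgrad \<Omega> u"
  have p0: "p > 0" using p by simp
  obtain \<phi> where \<phi>: "\<And>k::nat. \<phi> k \<in> test_functions \<Omega>"
    "AE x in ?M. (\<lambda>k. \<phi> k x) \<longlonglongrightarrow> u x"
    "(\<lambda>k. LINT x|?M. norm (?X x - grad (\<phi> k) x) powr p) \<longlonglongrightarrow> 0"
    using W1p0_approximation_AE[OF \<Omega>(1) p0 u] by blast
  note s = test_functions_smooth[OF \<phi>(1)] and s\<Phi> = test_functions_smooth[OF \<Phi>]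
  obtain B where B: "B \<ge> 0" "\<And>x. \<bar>\<Phi> x\<bar> \<le> B" "\<And>x. norm (grad \<Phi> x) \<le> B"
    using test_functions_bounded[OF \<Phi>] by metis
  note mu[measurable] = borel_measurable_smooth_lebesgue_on[OF s] borel_measurable_smooth_lebesgue_on[OF s\<Phi>]
    W1p0_measurable(1,2)[OF \<Omega>(1) u]
  note iX = W1p0_measurable(4)[OF \<Omega>(1) u]
  have Fi: "integrable ?M (\<lambda>x. F x * \<phi> x)"
    and Feq: "(LINT x|?M. flux p (?X x) \<bullet> grad \<phi> x) = (LINT x|?M. F x * \<phi> x)"
    if "\<phi> \<in> test_functions \<Omega>" for \<phi>
    using F that by (auto simp: tested_solution_def)
  define e where "e k = 1 / real (Suc k)" for k
  have e: "e k > 0" "e \<longlonglongrightarrow> 0" for k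
    unfolding e_def by (simp, rule LIMSEQ_Suc[OF lim_1_over_n])
  define g where "g k x = reg_inv_powr p \<delta> (e k) (\<phi> k x)" for k x
  define g' where "g' k x = reg_inv_powr' p \<delta> (e k) (\<phi> k x)" for k x
  have [measurable]: "g k \<in> borel_measurable ?M" "g' k \<in> borel_measurable ?M" for k
    unfolding g_def[abs_def] g'_def[abs_def] reg_inv_powr_def reg_inv_powr'_def by measurable
  have gl: "AE x in ?M. (\<lambda>k. g k x) \<longlonglongrightarrow> (u x + \<delta>) powr (1 - p)"
    using \<phi>(2) pos unfolding g_def by eventually_elim (rule reg_inv_powr_tendsto(1)[OF _ _ e(2) \<delta>])
  have gl': "AE x in ?M. (\<lambda>k. g' k x) \<longlonglongrightarrow> (1 - p) * (u x + \<delta>) powr (- p)"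
    using \<phi>(2) pos unfolding g'_def by eventually_elim (rule reg_inv_powr_tendsto(2)[OF _ _ e(2) \<delta>])
  \<comment> \<open>The derivative falls on \<open>\<Phi>\<close>: here the gradients are constant
    in \<open>k\<close> and only the bounded factors \<open>g k\<close> vary.\<close>
  have T1: "(\<lambda>k. LINT x|?M. (g k x *\<^sub>R flux p (?X x)) \<bullet> grad \<Phi> x)
        \<longlonglongrightarrow> (LINT x|?M. ((u x + \<delta>) powr (1 - p) *\<^sub>R flux p (?X x)) \<bullet> grad \<Phi> x)
      \<and> integrable ?M (\<lambda>x. ((u x + \<delta>) powr (1 - p) *\<^sub>R flux p (?X x)) \<bullet> grad \<Phi> x)
      \<and> (\<forall>k. integrable ?M (\<lambda>x. (g k x *\<^sub>R flux p (?X x)) \<bullet> grad \<Phi> x))"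
  proof -
    have i: "integrable ?M (\<lambda>x. norm (grad \<Phi> x) powr p)"
      by (rule test_functions_lebesgue_on(2)[OF \<Omega>(1) \<Phi> p0])
    have l: "(\<lambda>k. LINT x|?M. norm (grad \<Phi> x - grad \<Phi> x) powr p) \<longlonglongrightarrow> 0" by simp
    have b: "AE x in ?M. norm (g k x *\<^sub>R flux p (?X x)) \<le> \<delta> powr (1 - p) * norm (?X x) powr (p - 1)" for k
      using reg_inv_powr_bound[OF p \<delta>]
      by (intro AE_I2) (auto simp: g_def norm_flux intro!: mult_right_mono)
    have c: "AE x in ?M. (\<lambda>k. g k x *\<^sub>R flux p (?X x)) \<longlonglongrightarrow> (u x + \<delta>) powr (1 - p) *\<^sub>R flux p (?X x)"
      using gl by eventually_elim (intro tendsto_intros)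
    note t = tendsto_integral_inner[OF p _ _ _ _ _ i i iX l _ b c]
    show ?thesis
      by (intro conjI allI; rule t; (measurable | simp))
  qed
  \<comment> \<open>The derivative falls on \<open>g k\<close>: the gradients of the approximants
    converge in the \<open>p\<close>-norm, and the factor in front is dominated by a multiple of the
    \<open>(p - 1)\<close>-th power of the norm of \<open>wgrad \<Omega> u x\<close>.\<close>
  have T2: "(\<lambda>k. LINT x|?M. ((g' k x * \<Phi> x) *\<^sub>R flux p (?X x)) \<bullet> grad (\<phi> k) x)
        \<longlonglongrightarrow> (LINT x|?M. (((1 - p) * (u x + \<delta>) powr (- p) * \<Phi> x) *\<^sub>R flux p (?X x)) \<bullet> ?X x)
      \<and> integrable ?M (\<lambda>x. (((1 - p) * (u x + \<delta>) powr (- p) * \<Phi> x) *\<^sub>R flux p (?X x)) \<bullet> ?X x)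
      \<and> (\<forall>k. integrable ?M (\<lambda>x. ((g' k x * \<Phi> x) *\<^sub>R flux p (?X x)) \<bullet> grad (\<phi> k) x))"
  proof -
    have i: "integrable ?M (\<lambda>x. norm (grad (\<phi> k) x) powr p)" for k
      by (rule test_functions_lebesgue_on(2)[OF \<Omega>(1) \<phi>(1) p0])
    have b: "AE x in ?M. norm ((g' k x * \<Phi> x) *\<^sub>R flux p (?X x))
        \<le> ((p - 1) * \<delta> powr (- p) * B) * norm (?X x) powr (p - 1)" for k
    proof (rule AE_I2)
      fix x
      have "\<bar>g' k x\<bar> * \<bar>\<Phi> x\<bar> \<le> ((p - 1) * \<delta> powr (- p)) * B"
        using reg_inv_powr'_bound[OF p \<delta> e(1)] B p unfolding g'_def by (intro mult_mono) auto
      then show "norm ((g' k x * \<Phi> x) *\<^sub>R flux p (?X x))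
        \<le> ((p - 1) * \<delta> powr (- p) * B) * norm (?X x) powr (p - 1)"
        unfolding norm_scaleR norm_flux abs_mult by (intro mult_right_mono) auto
    qed
    have c: "AE x in ?M. (\<lambda>k. (g' k x * \<Phi> x) *\<^sub>R flux p (?X x))
        \<longlonglongrightarrow> ((1 - p) * (u x + \<delta>) powr (- p) * \<Phi> x) *\<^sub>R flux p (?X x)"
      using gl' by eventually_elim (intro tendsto_scaleR tendsto_mult_right tendsto_const)
    note t = tendsto_integral_inner[OF p _ _ _ _ _ iX i iX \<phi>(3) _ b c]
    show ?thesis
      using p B(1) by (intro conjI allI; intro t; (measurable | simp))
  qed
  show I1: "integrable ?M (\<lambda>x. (u x + \<delta>) powr (1 - p) *\<^sub>R flux p (?X x) \<bullet> grad \<Phi> x)"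
    using T1 by simp
  have e2: "(((1 - p) * (u x + \<delta>) powr (- p) * \<Phi> x) *\<^sub>R flux p (?X x)) \<bullet> ?X x
      = (1 - p) * (u x + \<delta>) powr (- p) * \<Phi> x * norm (?X x) powr p" for x
    by (simp add: inner_flux_self)
  show I2: "integrable ?M (\<lambda>x. (1 - p) * (u x + \<delta>) powr (- p) * \<Phi> x * norm (?X x) powr p)"
    using T2 unfolding e2 by simp
  have FM[measurable]: "(\<lambda>x. F x * \<Phi> x) \<in> borel_measurable ?M"
    using Fi[OF \<Phi>] by (rule borel_measurable_integrable)
  have iw: "integrable ?M (\<lambda>x. norm (F x * \<Phi> x) * \<delta> powr (1 - p))"
    using Fi[OF \<Phi>] by simp
  have b: "AE x in ?M. norm (F x * \<Phi> x * g k x) \<le> norm (F x * \<Phi> x) * \<delta> powr (1 - p)" for k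
  proof (rule AE_I2)
    fix x
    show "norm (F x * \<Phi> x * g k x) \<le> norm (F x * \<Phi> x) * \<delta> powr (1 - p)"
      unfolding norm_mult[of "F x * \<Phi> x" "g k x"] using reg_inv_powr_bound[OF p \<delta>]
      by (intro mult_left_mono) (auto simp: g_def)
  qed
  have c: "AE x in ?M. (\<lambda>k. F x * \<Phi> x * g k x) \<longlonglongrightarrow> F x * \<Phi> x * (u x + \<delta>) powr (1 - p)"
    using gl by eventually_elim (intro tendsto_intros)
  have T3: "(\<lambda>k. LINT x|?M. F x * \<Phi> x * g k x) \<longlonglongrightarrow> (LINT x|?M. F x * \<Phi> x * (u x + \<delta>) powr (1 - p))"
    by (rule integral_dominated_convergence[OF _ _ iw c b]) measurable
  show "integrable ?M (\<lambda>x. F x * \<Phi> x * (u x + \<delta>) powr (1 - p))"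
    by (rule integrable_dominated_convergence[OF _ _ iw c b]) measurable
  have "(LINT x|?M. (g k x *\<^sub>R flux p (?X x)) \<bullet> grad \<Phi> x)
      + (LINT x|?M. ((g' k x * \<Phi> x) *\<^sub>R flux p (?X x)) \<bullet> grad (\<phi> k) x)
      = (LINT x|?M. F x * \<Phi> x * g k x)" for k
  proof -
    have sg: "smooth_on UNIV (g k)"
      unfolding g_def using smooth_on_reg_inv_powr[OF s \<delta> e(1)] .
    have gg: "grad (g k) x = g' k x *\<^sub>R grad (\<phi> k) x" for x
      unfolding g_def[abs_def] g'_def by (rule grad_compose[OF s has_derivative_reg_inv_powr[OF \<delta> e(1)]])
    have "(LINT x|?M. (g k x *\<^sub>R flux p (?X x)) \<bullet> grad \<Phi> x)
      + (LINT x|?M. ((g' k x * \<Phi> x) *\<^sub>R flux p (?X x)) \<bullet> grad (\<phi> k) x)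
      = (LINT x|?M. (g k x *\<^sub>R flux p (?X x)) \<bullet> grad \<Phi> x + ((g' k x * \<Phi> x) *\<^sub>R flux p (?X x)) \<bullet> grad (\<phi> k) x)"
      using T1 T2 by (intro Bochner_Integration.integral_add[symmetric]) auto
    also have "\<dots> = (LINT x|?M. flux p (?X x) \<bullet> grad (\<lambda>x. \<Phi> x * g k x) x)"
      unfolding grad_mult[OF s\<Phi> sg] gg by (simp add: inner_add_right algebra_simps)
    also have "\<dots> = (LINT x|?M. F x * (\<Phi> x * g k x))"
      by (rule Feq[OF test_functions_mult[OF \<Phi> sg]])
    finally show ?thesis by (simp add: mult.assoc)
  qed
  then have "(\<lambda>k. LINT x|?M. F x * \<Phi> x * g k x)
      \<longlonglongrightarrow> (LINT x|?M. ((u x + \<delta>) powr (1 - p) *\<^sub>R flux p (?X x)) \<bullet> grad \<Phi> x)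
        + (LINT x|?M. (((1 - p) * (u x + \<delta>) powr (- p) * \<Phi> x) *\<^sub>R flux p (?X x)) \<bullet> ?X x)"
    using tendsto_add[OF conjunct1[OF T1] conjunct1[OF T2]] by simp
  from LIMSEQ_unique[OF this T3]
  show "(LINT x|?M. (u x + \<delta>) powr (1 - p) *\<^sub>R flux p (?X x) \<bullet> grad \<Phi> x)
       + (LINT x|?M. (1 - p) * (u x + \<delta>) powr (- p) * \<Phi> x * norm (?X x) powr p)
       = (LINT x|?M. F x * \<Phi> x * (u x + \<delta>) powr (1 - p))"
    unfolding e2 by simp
qed

text \<open>The excess at \<open>\<xi>\<close> of the convex function
  \<open>norm \<xi> powr p\<close> over its tangent at \<open>\<eta>\<close>, also known as its
  Bregman distance: the tangent has slope \<open>p\<close> times the flux of \<open>\<eta>\<close>,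
  and the two terms in \<open>\<eta>\<close> alone have been collected.\<close>

definition picone_remainder :: "real \<Rightarrow> 'b::real_inner \<Rightarrow> 'b \<Rightarrow> real" where
  "picone_remainder p \<xi> \<eta> = norm \<xi> powr p - p * (flux p \<eta> \<bullet> \<xi>) + (p - 1) * norm \<eta> powr p"

lemma flux_inner_le: "\<bar>flux p \<eta> \<bullet> \<xi>\<bar> \<le> norm \<eta> powr (p - 1) * norm \<xi>"
  using Cauchy_Schwarz_ineq2[of "flux p \<eta>" \<xi>] by (simp add: norm_flux)

lemma picone_remainder_nonneg:
  assumes "p > 1"
  shows "picone_remainder p \<xi> \<eta> \<ge> 0"
proof -
  have "p * (flux p \<eta> \<bullet> \<xi>) \<le> p * (norm \<eta> powr (p - 1) * norm \<xi>)"
    using flux_inner_le[of p \<eta> \<xi>] assms by (intro mult_left_mono) auto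
  also have "\<dots> \<le> (p - 1) * norm \<eta> powr p + norm \<xi> powr p"
    using powr_tangent[of p "norm \<eta>" "norm \<xi>"] assms by (simp add: mult.assoc)
  finally show ?thesis by (simp add: picone_remainder_def)
qed

text \<open>\<open>picone_identity\<close> with the shifted power of \<open>\<psi>\<close> as
  \<open>\<Phi>\<close>. The remainder at \<open>a\<close> times the gradient of \<open>u\<close>,
  where \<open>a = (\<psi> x + \<epsilon>) / (u x + \<delta>)\<close>, calls for the full power of
  \<open>\<psi> x + \<epsilon>\<close>, but \<open>\<Phi>\<close> lacks
  \<open>\<epsilon> powr p\<close>. The missing part is the last term of the bound.\<close>

lemma picone_inequality:
  fixes \<Omega> :: "'a::euclidean_space set" and u F :: "'a \<Rightarrow> real"
  assumes \<Omega>: "open \<Omega>" "bounded \<Omega>" and p: "p > 1" and u: "u \<in> W1p0 p \<Omega>"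
    and pos: "AE x in lebesgue_on \<Omega>. u x > 0"
    and F: "tested_solution p \<Omega> F u"
    and \<psi>: "\<psi> \<in> test_functions \<Omega>" "\<And>x. \<psi> x \<ge> 0" and \<epsilon>: "\<epsilon> > 0" and \<delta>: "\<delta> > 0"
  shows "integrable (lebesgue_on \<Omega>)
      (\<lambda>x. picone_remainder p (grad \<psi> x) (((\<psi> x + \<epsilon>) / (u x + \<delta>)) *\<^sub>R wgrad \<Omega> u x))" (is ?A)
    and "integrable (lebesgue_on \<Omega>) (\<lambda>x. F x * ((\<psi> x + \<epsilon>) powr p - \<epsilon> powr p) * (u x + \<delta>) powr (1 - p))" (is ?B)
    and "(LINT x|lebesgue_on \<Omega>. picone_remainder p (grad \<psi> x) (((\<psi> x + \<epsilon>) / (u x + \<delta>)) *\<^sub>R wgrad \<Omega> u x))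
       + (LINT x|lebesgue_on \<Omega>. F x * ((\<psi> x + \<epsilon>) powr p - \<epsilon> powr p) * (u x + \<delta>) powr (1 - p))
       \<le> (LINT x|lebesgue_on \<Omega>. norm (grad \<psi> x) powr p)
         + (p - 1) * (\<epsilon> / \<delta>) powr p * (LINT x|lebesgue_on \<Omega>. norm (wgrad \<Omega> u x) powr p)" (is ?C)
proof -
  let ?M = "lebesgue_on \<Omega>" and ?X = "wgrad \<Omega> u"
  have p0: "p > 0" using p by simp
  define \<Phi> where "\<Phi> x = (\<psi> x + \<epsilon>) powr p - \<epsilon> powr p" for x
  have \<Phi>: "\<Phi> \<in> test_functions \<Omega>"
    "\<And>x. grad \<Phi> x = (p * (\<psi> x + \<epsilon>) powr (p - 1)) *\<^sub>R grad \<psi> x"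
    using test_functions_shifted_powr[OF \<psi> \<epsilon>, of p] unfolding \<Phi>_def[abs_def] by auto
  note id = picone_identity[OF \<Omega> p u pos F \<Phi>(1) \<delta>]
  note [measurable] = borel_measurable_smooth_lebesgue_on[OF test_functions_smooth[OF \<psi>(1)]]
    W1p0_measurable(1,2)[OF \<Omega>(1) u]
  \<comment> \<open>What the subtracted \<open>\<epsilon> powr p\<close> removes from
    \<open>(p - 1) * a powr p * norm (?X x) powr p\<close>; as \<open>u x\<close> is positive,
    replacing \<open>u x + \<delta>\<close> by \<open>\<delta>\<close> bounds it.\<close>
  define \<rho> where "\<rho> x = (p - 1) * \<epsilon> powr p * (u x + \<delta>) powr (- p) * norm (?X x) powr p" for x
  have iX: "integrable ?M (\<lambda>x. (p - 1) * (\<epsilon> / \<delta>) powr p * norm (?X x) powr p)"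
    using W1p0_measurable(4)[OF \<Omega>(1) u] by simp
  have \<rho>b: "AE x in ?M. \<bar>\<rho> x\<bar> \<le> (p - 1) * (\<epsilon> / \<delta>) powr p * norm (?X x) powr p"
    using pos
  proof eventually_elim
    case (elim x)
    have "(u x + \<delta>) powr (- p) \<le> \<delta> powr (- p)"
      using elim \<delta> p by (intro powr_mono2') auto
    then have "(p - 1) * \<epsilon> powr p * (u x + \<delta>) powr (- p) * norm (?X x) powr p
        \<le> (p - 1) * \<epsilon> powr p * \<delta> powr (- p) * norm (?X x) powr p"
      using p by (intro mult_right_mono mult_left_mono) auto
    moreover have "\<epsilon> powr p * \<delta> powr (- p) = (\<epsilon> / \<delta>) powr p"
      using \<epsilon> \<delta> by (simp add: powr_divide powr_minus_divide)
    moreover have "\<bar>\<rho> x\<bar> = \<rho> x" using p by (simp add: \<rho>_def)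
    ultimately show ?case by (simp add: \<rho>_def mult.assoc)
  qed
  have i\<rho>: "integrable ?M \<rho>"
    by (rule Bochner_Integration.integrable_bound[OF iX])
       (unfold \<rho>_def[abs_def], measurable, use \<rho>b in eventually_elim, use p in \<open>auto simp: \<rho>_def\<close>)
  have L\<rho>: "(LINT x|?M. \<rho> x) \<le> (p - 1) * (\<epsilon> / \<delta>) powr p * (LINT x|?M. norm (?X x) powr p)"
  proof -
    have "(LINT x|?M. \<rho> x) \<le> (LINT x|?M. (p - 1) * (\<epsilon> / \<delta>) powr p * norm (?X x) powr p)"
      by (rule integral_mono_AE[OF i\<rho> iX]) (use \<rho>b in eventually_elim, auto)
    then show ?thesis by simp
  qed
  define r where "r x = picone_remainder p (grad \<psi> x) (((\<psi> x + \<epsilon>) / (u x + \<delta>)) *\<^sub>R ?X x)" for x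
  \<comment> \<open>The remainder again, almost everywhere, but split into terms that are already
    known to be integrable.\<close>
  define T where "T x = norm (grad \<psi> x) powr p + \<rho> x
      - ((u x + \<delta>) powr (1 - p) *\<^sub>R flux p (?X x) \<bullet> grad \<Phi> x
         + (1 - p) * (u x + \<delta>) powr (- p) * \<Phi> x * norm (?X x) powr p)" for x
  have ig: "integrable ?M (\<lambda>x. norm (grad \<psi> x) powr p)"
    by (rule test_functions_lebesgue_on(2)[OF \<Omega>(1) \<psi>(1) p0])
  have iT: "integrable ?M T"
    unfolding T_def[abs_def] using ig i\<rho> id(1,2) by (intro Bochner_Integration.integrable_diff Bochner_Integration.integrable_add)
  have LT: "(LINT x|?M. T x) = (LINT x|?M. norm (grad \<psi> x) powr p) + (LINT x|?M. \<rho> x)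
      - (LINT x|?M. F x * \<Phi> x * (u x + \<delta>) powr (1 - p))"
    unfolding T_def id(4)[symmetric]
      Bochner_Integration.integral_diff[OF Bochner_Integration.integrable_add[OF ig i\<rho>]
        Bochner_Integration.integrable_add[OF id(1,2)]]
      Bochner_Integration.integral_add[OF ig i\<rho>] Bochner_Integration.integral_add[OF id(1,2)] ..
  have rT: "AE x in ?M. T x = r x"
    using pos
  proof eventually_elim
    case (elim x)
    define a where "a = (\<psi> x + \<epsilon>) / (u x + \<delta>)"
    have 1: "\<psi> x + \<epsilon> > 0" "u x + \<delta> > 0" using \<psi>(2)[of x] \<epsilon> \<delta> elim by auto
    then have a: "a > 0" by (simp add: a_def)
    have a1: "a powr (p - 1) = (\<psi> x + \<epsilon>) powr (p - 1) * (u x + \<delta>) powr (1 - p)"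
      using 1 powr_minus_divide[of "u x + \<delta>" "p - 1"] by (simp add: a_def powr_divide)
    have a2: "a powr p = (\<psi> x + \<epsilon>) powr p * (u x + \<delta>) powr (- p)"
      using 1 by (simp add: a_def powr_divide powr_minus_divide)
    have n: "norm (a *\<^sub>R ?X x) powr p = a powr p * norm (?X x) powr p"
      using a by (simp add: powr_mult)
    show ?case
      unfolding T_def r_def picone_remainder_def a_def[symmetric] flux_scaleR[OF a] n \<Phi>(2) \<rho>_def \<Phi>_def a1 a2
      by (simp add: algebra_simps)
  qed
  have mr: "r \<in> borel_measurable ?M"
    unfolding r_def[abs_def] picone_remainder_def by measurable
  show ?A
    using integrable_cong_AE_imp[OF iT mr] rT unfolding r_def[abs_def] by auto
  show ?B using id(3) unfolding \<Phi>_def .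
  have "(LINT x|?M. r x) = (LINT x|?M. T x)"
    using rT mr borel_measurable_integrable[OF iT] by (intro integral_cong_AE) auto
  then show ?C
    using LT L\<rho> unfolding r_def \<Phi>_def by simp
qed

section \<open>Minimizing sequences\<close>

text \<open>With \<open>y = \<alpha> * s * t powr s / q\<close> both sides are exponentials, and
  comparing the exponents is \<open>ln y \<le> y - 1\<close>, with equality only for
  \<open>y = 1\<close>. The constant is the minimum of the quotient of the exponential by
  \<open>t powr q\<close>.\<close>

lemma exp_powr_lower_bound:
  fixes t \<alpha> s q :: real
  assumes "t > 0" "\<alpha> > 0" "s > 0" "q > 0"
  shows "(\<alpha> * s * exp 1 / q) powr (q / s) * t powr q \<le> exp (\<alpha> * t powr s)"
    and "(\<alpha> * s * exp 1 / q) powr (q / s) * t powr q = exp (\<alpha> * t powr s) \<Longrightarrow> t = (q / (\<alpha> * s)) powr (1 / s)"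
proof -
  define y where "y = \<alpha> * s * t powr s / q"
  have y: "y > 0" using assms by (simp add: y_def)
  have ln_y: "ln y = ln (\<alpha> * s / q) + s * ln t"
  proof -
    have "ln ((\<alpha> * s / q) * t powr s) = ln (\<alpha> * s / q) + ln (t powr s)"
      using assms by (intro ln_mult_pos) auto
    then show ?thesis using assms by (simp add: y_def ln_powr)
  qed
  have "(\<alpha> * s * exp 1 / q) powr (q / s) * t powr q = exp ((q / s) * (1 + ln (\<alpha> * s / q)) + q * ln t)"
  proof -
    have "ln (\<alpha> * s * exp 1 / q) = 1 + ln (\<alpha> * s / q)"
      using assms ln_mult_pos[of "\<alpha> * s / q" "exp 1"] by simp
    then show ?thesis using assms by (simp add: powr_def exp_add)
  qed
  also have "(q / s) * (1 + ln (\<alpha> * s / q)) + q * ln t = (q / s) * (1 + ln y)"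
    using assms by (simp add: ln_y field_simps)
  finally have e: "(\<alpha> * s * exp 1 / q) powr (q / s) * t powr q = exp ((q / s) * (1 + ln y))" .
  have r: "\<alpha> * t powr s = (q / s) * y"
    using assms by (simp add: y_def)
  show "(\<alpha> * s * exp 1 / q) powr (q / s) * t powr q \<le> exp (\<alpha> * t powr s)"
    unfolding e r using ln_le_minus_one[OF y] assms by (simp add: mult_left_mono divide_right_mono)
  assume "(\<alpha> * s * exp 1 / q) powr (q / s) * t powr q = exp (\<alpha> * t powr s)"
  then have "ln y = y - 1"
    unfolding e r using assms by simp
  then have "y = 1" by (rule ln_eq_minus_one[OF y])
  then have "t powr s = q / (\<alpha> * s)"
    using assms by (simp add: y_def field_simps)
  then have "(t powr s) powr (1 / s) = (q / (\<alpha> * s)) powr (1 / s)" by simp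
  then show "t = (q / (\<alpha> * s)) powr (1 / s)"
    using assms by (simp add: powr_powr)
qed

text \<open>A case of Vitali's theorem: the bound with \<open>p > 1\<close> makes the sequence
  uniformly integrable. Above the level \<open>K\<close> the function is at most
  \<open>K powr (1 - p)\<close> times its \<open>p\<close>-th power; below it dominated convergence
  applies.\<close>

lemma L1_tendsto_0_if_AE_tendsto_0:
  fixes f :: "nat \<Rightarrow> 'a \<Rightarrow> real"
  assumes "finite_measure M" and p: "p > 1" and m[measurable]: "\<And>k. f k \<in> borel_measurable M"
    and nn: "\<And>k x. f k x \<ge> 0" and ae: "AE x in M. (\<lambda>k. f k x) \<longlonglongrightarrow> 0"
    and i: "\<And>k. integrable M (\<lambda>x. f k x powr p)" and B: "\<And>k. (LINT x|M. f k x powr p) \<le> B"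
  shows "(\<lambda>k. LINT x|M. f k x) \<longlonglongrightarrow> 0"
proof (rule order_tendstoI)
  interpret finite_measure M by fact
  fix a :: real assume "a < 0"
  then show "\<forall>\<^sub>F k in sequentially. a < (LINT x|M. f k x)"
    using nn by (intro always_eventually allI) (auto intro: less_le_trans Bochner_Integration.integral_nonneg)
next
  interpret finite_measure M by fact
  fix a :: real assume a: "0 < a"
  have "0 \<le> (LINT x|M. f 0 x powr p)" by simp
  with B[of 0] have B0: "B \<ge> 0" by linarith
  \<comment> \<open>Chosen so that \<open>K powr (1 - p) = a / (2 * (B + 1))\<close>, which keeps
    the part above \<open>K\<close> below \<open>a / 2\<close>; the summand 1 covers
    \<open>B = 0\<close>.\<close>
  define K where "K = (2 * (B + 1) / a) powr (1 / (p - 1))"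
  have K: "K > 0" using a B0 by (simp add: K_def)
  have "K powr (p - 1) = 2 * (B + 1) / a"
    using p a B0 by (simp add: K_def powr_powr)
  then have "K powr (1 - p) = a / (2 * (B + 1))"
    using powr_minus_divide[of K "p - 1"] by simp
  then have "2 * K powr (1 - p) + 2 * (K powr (1 - p) * B) = a"
    using B0 by (simp add: field_simps)
  moreover have "K powr (1 - p) > 0" using K by simp
  ultimately have KB: "K powr (1 - p) * B < a / 2" by linarith
  have le: "f k x \<le> min (f k x) K + K powr (1 - p) * f k x powr p" for k x
  proof (cases "f k x \<le> K")
    case False
    have "f k x = f k x powr (1 - p) * f k x powr p"
      using False K by (simp flip: powr_add)
    also have "\<dots> \<le> K powr (1 - p) * f k x powr p"
      using False K p by (intro mult_right_mono powr_mono2') auto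
    finally show ?thesis using nn[of k x] K by (simp add: min_def)
  qed simp
  have im: "integrable M (\<lambda>x. min (f k x) K)" for k
    by (rule integrable_const_bound[of _ K]) (use nn K in \<open>auto intro: AE_I2 simp: min_def\<close>)
  have "(\<lambda>k. LINT x|M. min (f k x) K) \<longlonglongrightarrow> (LINT x|M. 0)"
  proof (rule integral_dominated_convergence[where w="\<lambda>x. K"])
    show "AE x in M. (\<lambda>k. min (f k x) K) \<longlonglongrightarrow> 0"
      using ae
    proof eventually_elim
      case (elim x)
      have "(\<lambda>k. min (f k x) K) \<longlonglongrightarrow> min 0 K"
        by (intro tendsto_min elim tendsto_const)
      then show ?case using K by simp
    qed
    show "AE x in M. norm (min (f k x) K) \<le> K" for k
      using nn K by (intro AE_I2) (auto simp: min_def)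
  qed auto
  then have "\<forall>\<^sub>F k in sequentially. (LINT x|M. min (f k x) K) < a / 2"
    using a by (intro order_tendstoD(2)[of _ 0]) auto
  then show "\<forall>\<^sub>F k in sequentially. (LINT x|M. f k x) < a"
  proof eventually_elim
    case (elim k)
    have if': "integrable M (f k)"
    proof (rule Bochner_Integration.integrable_bound)
      show "integrable M (\<lambda>x. min (f k x) K + K powr (1 - p) * f k x powr p)"
        using im i by simp
      show "AE x in M. norm (f k x) \<le> norm (min (f k x) K + K powr (1 - p) * f k x powr p)"
        using le[of k] nn[of k] by (intro AE_I2) (auto intro: order_trans[OF _ abs_ge_self])
    qed measurable
    have "(LINT x|M. f k x) \<le> (LINT x|M. min (f k x) K + K powr (1 - p) * f k x powr p)"
      using im i if' by (intro integral_mono le) auto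
    also have "\<dots> = (LINT x|M. min (f k x) K) + K powr (1 - p) * (LINT x|M. f k x powr p)"
      using im i by (subst Bochner_Integration.integral_add) auto
    also have "\<dots> \<le> (LINT x|M. min (f k x) K) + K powr (1 - p) * B"
      using B by (intro add_left_mono mult_left_mono) auto
    finally show ?case using elim KB by simp
  qed
qed

text \<open>The mixed term is absorbed by weighted Young, so the \<open>p\<close>-th power of the
  norm of \<open>\<xi> k\<close> is controlled by the remainder and the norm of
  \<open>\<eta> k\<close>.\<close>

lemma picone_remainder_tendsto_0:
  fixes \<xi> \<eta> :: "nat \<Rightarrow> 'b::real_inner"
  assumes p: "p > 1" and r: "(\<lambda>k. picone_remainder p (\<xi> k) (\<eta> k)) \<longlonglongrightarrow> 0"
    and \<eta>: "(\<lambda>k. norm (\<eta> k)) \<longlonglongrightarrow> 0"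
  shows "(\<lambda>k. norm (\<xi> k)) \<longlonglongrightarrow> 0"
proof (rule tendsto_powr_0_cancel[of p])
  \<comment> \<open>With \<open>\<tau> powr (1 - p) = 1 / (2 * p)\<close> the mixed term uses up
    exactly half of the power of \<open>\<xi> k\<close>.\<close>
  define \<tau> where "\<tau> = (2 * p) powr (1 / (p - 1))"
  have \<tau>: "\<tau> > 0" using p by (simp add: \<tau>_def)
  have "\<tau> powr (p - 1) = 2 * p" using p by (simp add: \<tau>_def powr_powr)
  then have \<tau>': "\<tau> powr (1 - p) = 1 / (2 * p)"
    using powr_minus_divide[of \<tau> "p - 1"] by simp
  have le: "norm (\<xi> k) powr p \<le> 2 * picone_remainder p (\<xi> k) (\<eta> k) + 2 * p * \<tau> * norm (\<eta> k) powr p" for k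
  proof -
    have "p * (flux p (\<eta> k) \<bullet> \<xi> k) \<le> p * (norm (\<eta> k) powr (p - 1) * norm (\<xi> k))"
      using flux_inner_le[of p "\<eta> k" "\<xi> k"] p by (intro mult_left_mono) auto
    also have "\<dots> \<le> p * (\<tau> * norm (\<eta> k) powr p + \<tau> powr (1 - p) * norm (\<xi> k) powr p)"
      using powr_mult_le_weighted[OF p \<tau>, of "norm (\<eta> k)" "norm (\<xi> k)"] p by (intro mult_left_mono) auto
    also have "\<dots> = p * \<tau> * norm (\<eta> k) powr p + norm (\<xi> k) powr p / 2"
      using p by (simp add: \<tau>' field_simps)
    finally have "picone_remainder p (\<xi> k) (\<eta> k) + p * \<tau> * norm (\<eta> k) powr p
        \<ge> norm (\<xi> k) powr p / 2 + (p - 1) * norm (\<eta> k) powr p"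
      by (simp add: picone_remainder_def)
    moreover have "(p - 1) * norm (\<eta> k) powr p \<ge> 0" using p by simp
    ultimately show ?thesis by linarith
  qed
  have "(\<lambda>k. norm (\<eta> k) powr p) \<longlonglongrightarrow> 0 powr p"
    using p by (intro tendsto_powr'[OF \<eta> tendsto_const]) auto
  then have "(\<lambda>k. 2 * picone_remainder p (\<xi> k) (\<eta> k) + 2 * p * \<tau> * norm (\<eta> k) powr p) \<longlonglongrightarrow> 2 * 0 + 2 * p * \<tau> * 0"
    using p by (intro tendsto_intros r) auto
  then have l: "(\<lambda>k. 2 * picone_remainder p (\<xi> k) (\<eta> k) + 2 * p * \<tau> * norm (\<eta> k) powr p) \<longlonglongrightarrow> 0"
    by simp
  show "(\<lambda>k. norm (\<xi> k) powr p) \<longlonglongrightarrow> 0"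
    by (rule tendsto_sandwich[OF _ _ tendsto_const l]) (use le in auto)
qed (use p in auto)

section \<open>The first eigenvalue and its approximation by test functions\<close>

lemma W1p0_Lp_norm_tendsto:
  fixes v :: "'a::euclidean_space \<Rightarrow> real"
  assumes "open \<Omega>" "p > 1" "v \<in> W1p0 p \<Omega>"
  obtains \<phi> where "\<And>k::nat. \<phi> k \<in> test_functions \<Omega>"
    "(\<lambda>k. LINT x|lborel. \<bar>\<phi> k x\<bar> powr p) \<longlonglongrightarrow> (LINT x|lebesgue_on \<Omega>. \<bar>v x\<bar> powr p)"
    "(\<lambda>k. LINT x|lborel. norm (grad (\<phi> k) x) powr p) \<longlonglongrightarrow> (LINT x|lebesgue_on \<Omega>. norm (wgrad \<Omega> v x) powr p)"
proof -
  have p: "p > 0" using assms(2) by simp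
  obtain \<phi> where \<phi>: "\<And>k::nat. \<phi> k \<in> test_functions \<Omega>"
    "(\<lambda>k. LINT x|lebesgue_on \<Omega>. norm (v x - \<phi> k x) powr p) \<longlonglongrightarrow> 0"
    "(\<lambda>k. LINT x|lebesgue_on \<Omega>. norm (wgrad \<Omega> v x - grad (\<phi> k) x) powr p) \<longlonglongrightarrow> 0"
    using W1p0_approximation[OF assms(1) p assms(3)] by blast
  note v = W1p0_measurable[OF assms(1,3)]
  note m = borel_measurable_smooth_lebesgue_on[OF test_functions_smooth[OF \<phi>(1)]]
  note t = test_functions_lebesgue_on[OF assms(1) \<phi>(1) p]
  have "(\<lambda>k. LINT x|lebesgue_on \<Omega>. norm (\<phi> k x) powr p) \<longlonglongrightarrow> (LINT x|lebesgue_on \<Omega>. norm (v x) powr p)"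
    using t(1) by (intro tendsto_Lp_norm[OF assms(2) v(1) m(1) v(3) _ \<phi>(2)]) auto
  moreover have "(\<lambda>k. LINT x|lebesgue_on \<Omega>. norm (grad (\<phi> k) x) powr p) \<longlonglongrightarrow> (LINT x|lebesgue_on \<Omega>. norm (wgrad \<Omega> v x) powr p)"
    by (intro tendsto_Lp_norm[OF assms(2) v(2) m(2) v(4) t(2) \<phi>(3)])
  ultimately show ?thesis
    using \<phi>(1) by (intro that[of \<phi>]) (auto simp: t(3,4))
qed

lemma W1p0_Lp_norm_pos:
  assumes "open \<Omega>" "v \<in> W1p0 p \<Omega>" "\<not> (AE x in lebesgue_on \<Omega>. v x = 0)"
  shows "(LINT x|lebesgue_on \<Omega>. \<bar>v x\<bar> powr p) > 0"
proof -
  have "(LINT x|lebesgue_on \<Omega>. \<bar>v x\<bar> powr p) \<noteq> 0"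
    using assms(3) W1p0_measurable(3)[OF assms(1,2)] by (subst integral_nonneg_eq_0_iff_AE) auto
  moreover have "(LINT x|lebesgue_on \<Omega>. \<bar>v x\<bar> powr p) \<ge> 0" by simp
  ultimately show ?thesis by linarith
qed

text \<open>Poincare's inequality extends from test functions to the Sobolev space by density and
  bounds every quotient by \<open>1 / C\<close> from below. The function \<open>u\<close> shows that
  there are quotients at all, without which the infimum would be unspecified.\<close>

lemma first_eigenvalue_pos:
  fixes \<Omega> :: "'a::euclidean_space set"
  assumes \<Omega>: "open \<Omega>" "bounded \<Omega>" and p: "p > 1"
    and u: "u \<in> W1p0 p \<Omega>" "\<not> (AE x in lebesgue_on \<Omega>. u x = 0)"
  shows "first_eigenvalue p \<Omega> > 0"
proof -
  obtain C where C: "C > 0" "\<And>\<phi>. \<phi> \<in> test_functions \<Omega> \<Longrightarrow>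
      (\<integral>x. \<bar>\<phi> x\<bar> powr p \<partial>lborel) \<le> C * (\<integral>x. norm (grad \<phi> x) powr p \<partial>lborel)"
    using poincare_inequality[OF \<Omega>(2), of p] p by (metis less_imp_le)
  have p0: "p > 0" using p by simp
  have "1 / C \<le> first_eigenvalue p \<Omega>"
    unfolding first_eigenvalue_def
  proof (rule cInf_greatest)
    show "{Lp_norm p \<Omega> (wgrad \<Omega> v) powr p / Lp_norm p \<Omega> v powr p |v.
        v \<in> W1p0 p \<Omega> \<and> \<not> (AE x in lebesgue_on \<Omega>. v x = 0)} \<noteq> {}"
      using u by blast
    fix q assume "q \<in> {Lp_norm p \<Omega> (wgrad \<Omega> v) powr p / Lp_norm p \<Omega> v powr p |v.
        v \<in> W1p0 p \<Omega> \<and> \<not> (AE x in lebesgue_on \<Omega>. v x = 0)}"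
    then obtain v where v: "v \<in> W1p0 p \<Omega>" "\<not> (AE x in lebesgue_on \<Omega>. v x = 0)"
      and q: "q = (LINT x|lebesgue_on \<Omega>. norm (wgrad \<Omega> v x) powr p) / (LINT x|lebesgue_on \<Omega>. \<bar>v x\<bar> powr p)"
      by (auto simp: Lp_norm_powr[OF p0])
    note pos = W1p0_Lp_norm_pos[OF \<Omega>(1) v]
    obtain \<phi> where \<phi>: "\<And>k::nat. \<phi> k \<in> test_functions \<Omega>"
      "(\<lambda>k. LINT x|lborel. \<bar>\<phi> k x\<bar> powr p) \<longlonglongrightarrow> (LINT x|lebesgue_on \<Omega>. \<bar>v x\<bar> powr p)"
      "(\<lambda>k. LINT x|lborel. norm (grad (\<phi> k) x) powr p) \<longlonglongrightarrow> (LINT x|lebesgue_on \<Omega>. norm (wgrad \<Omega> v x) powr p)"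
      using W1p0_Lp_norm_tendsto[OF \<Omega>(1) p v(1)] by blast
    have "(LINT x|lebesgue_on \<Omega>. \<bar>v x\<bar> powr p) \<le> C * (LINT x|lebesgue_on \<Omega>. norm (wgrad \<Omega> v x) powr p)"
      by (rule LIMSEQ_le[OF \<phi>(2) tendsto_mult_left[OF \<phi>(3)]]) (use C(2)[OF \<phi>(1)] in auto)
    then show "1 / C \<le> q"
      unfolding q using pos C(1) by (simp add: field_simps)
  qed
  then show ?thesis using C(1) by (auto intro: less_le_trans[rotated])
qed

text \<open>A smooth replacement for the absolute value that increases neither the function nor its
  gradient; subtracting \<open>e\<close> keeps the zeros and hence the compact support.\<close>

lemma smooth_abs_approximation:
  fixes \<phi> :: "'a::euclidean_space \<Rightarrow> real"
  assumes \<phi>: "\<phi> \<in> test_functions \<Omega>" and e: "e > 0"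
  defines "\<psi> \<equiv> \<lambda>x. (\<phi> x * \<phi> x + e * e) powr (1/2) - e"
  shows "\<psi> \<in> test_functions \<Omega>" "\<psi> x \<ge> 0" "\<psi> x \<le> \<bar>\<phi> x\<bar>" "norm (grad \<psi> x) \<le> norm (grad \<phi> x)"
proof -
  note s = test_functions_smooth[OF \<phi>]
  have pos: "t * t + e * e > 0" for t :: real
    using e by (intro add_nonneg_pos) auto
  have ee: "(e * e) powr (1/2) = e" using e by (simp add: powr_half_sqrt)
  have "smooth_on UNIV \<psi>"
    unfolding \<psi>_def by (intro smooth_on_diff smooth_on_powr smooth_on_add smooth_on_mult smooth_on_const s pos)
  then show "\<psi> \<in> test_functions \<Omega>"
    by (rule test_functionsI[OF \<phi>]) (simp add: \<psi>_def ee)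
  have "(e * e) powr (1/2) \<le> (\<phi> x * \<phi> x + e * e) powr (1/2)"
    by (intro powr_mono2) auto
  then show "\<psi> x \<ge> 0" unfolding ee \<psi>_def by simp
  have "(\<phi> x * \<phi> x + e * e) powr (1/2) \<le> ((\<bar>\<phi> x\<bar> + e) * (\<bar>\<phi> x\<bar> + e)) powr (1/2)"
  proof (intro powr_mono2)
    have "0 \<le> \<bar>\<phi> x\<bar> * e" using e by simp
    then show "\<phi> x * \<phi> x + e * e \<le> (\<bar>\<phi> x\<bar> + e) * (\<bar>\<phi> x\<bar> + e)"
      by (simp add: distrib_left distrib_right abs_mult_self_eq mult.commute)
  qed (use e in auto)
  also have "\<dots> = \<bar>\<phi> x\<bar> + e" using e by (simp add: powr_half_sqrt)
  finally show "\<psi> x \<le> \<bar>\<phi> x\<bar>" by (simp add: \<psi>_def)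
  have "((\<lambda>t. t * t + e * e) has_real_derivative 2 * \<phi> x) (at (\<phi> x))"
    by (auto intro!: derivative_eq_intros)
  from DERIV_diff[OF DERIV_powr[OF this pos DERIV_const[of "1/2"]] DERIV_const[of e]]
  have "((\<lambda>t. (t * t + e * e) powr (1/2) - e) has_real_derivative
      (\<phi> x * \<phi> x + e * e) powr (1/2) * (\<phi> x / (\<phi> x * \<phi> x + e * e))) (at (\<phi> x))"
    by simp
  from grad_compose[OF s this]
  have g: "grad \<psi> x = ((\<phi> x * \<phi> x + e * e) powr (1/2) * (\<phi> x / (\<phi> x * \<phi> x + e * e))) *\<^sub>R grad \<phi> x"
    unfolding \<psi>_def .
  define Q where "Q = \<phi> x * \<phi> x + e * e"
  have Q: "Q > 0" using pos by (simp add: Q_def)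
  have "\<bar>\<phi> x\<bar> = (\<phi> x * \<phi> x) powr (1/2)" by (simp add: powr_half_sqrt)
  also have "\<dots> \<le> Q powr (1/2)" unfolding Q_def by (intro powr_mono2) auto
  finally have "Q powr (1/2) * \<bar>\<phi> x\<bar> \<le> Q powr (1/2) * Q powr (1/2)"
    by (intro mult_left_mono) auto
  also have "\<dots> = Q" using Q by (simp flip: powr_add)
  finally have "\<bar>Q powr (1/2) * (\<phi> x / Q)\<bar> \<le> 1"
    using Q by (simp add: abs_mult)
  then have "\<bar>Q powr (1/2) * (\<phi> x / Q)\<bar> * norm (grad \<phi> x) \<le> 1 * norm (grad \<phi> x)"
    by (intro mult_right_mono) auto
  then show "norm (grad \<psi> x) \<le> norm (grad \<phi> x)"
    unfolding g Q_def[symmetric] by simp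
qed

text \<open>The strict inequality leaves room for three successive changes: from the infimum to a
  function \<open>v\<close>, from \<open>v\<close> to a test function, and from that to a
  nonnegative one. The last does not increase the gradient and changes the \<open>p\<close>-norm as
  little as desired; scaling then normalizes it.\<close>

lemma first_eigenvalue_test_function:
  fixes \<Omega> :: "'a::euclidean_space set"
  assumes \<Omega>: "open \<Omega>" "bounded \<Omega>" and p: "p > 1"
    and u: "u \<in> W1p0 p \<Omega>" "\<not> (AE x in lebesgue_on \<Omega>. u x = 0)"
    and lt: "first_eigenvalue p \<Omega> < L"
  obtains \<psi> where "\<psi> \<in> test_functions \<Omega>" "\<And>x. \<psi> x \<ge> 0"
    "(LINT x|lborel. \<psi> x powr p) = 1" "(LINT x|lborel. norm (grad \<psi> x) powr p) \<le> L"
proof -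
  have p0: "p > 0" using p by simp
  have "\<exists>q\<in>{Lp_norm p \<Omega> (wgrad \<Omega> v) powr p / Lp_norm p \<Omega> v powr p |v.
        v \<in> W1p0 p \<Omega> \<and> \<not> (AE x in lebesgue_on \<Omega>. v x = 0)}. q < L"
    using u lt unfolding first_eigenvalue_def by (intro cInf_lessD) auto
  then obtain v where v: "v \<in> W1p0 p \<Omega>" "\<not> (AE x in lebesgue_on \<Omega>. v x = 0)"
    and q: "(LINT x|lebesgue_on \<Omega>. norm (wgrad \<Omega> v x) powr p) / (LINT x|lebesgue_on \<Omega>. \<bar>v x\<bar> powr p) < L"
    by (auto simp: Lp_norm_powr[OF p0])
  note pos = W1p0_Lp_norm_pos[OF \<Omega>(1) v]
  have lt0: "(LINT x|lebesgue_on \<Omega>. norm (wgrad \<Omega> v x) powr p) < L * (LINT x|lebesgue_on \<Omega>. \<bar>v x\<bar> powr p)"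
    using q pos by (simp add: field_simps)
  have L: "L > 0"
    using first_eigenvalue_pos[OF \<Omega> p u] lt by linarith
  obtain \<phi> where \<phi>: "\<And>k::nat. \<phi> k \<in> test_functions \<Omega>"
    "(\<lambda>k. LINT x|lborel. \<bar>\<phi> k x\<bar> powr p) \<longlonglongrightarrow> (LINT x|lebesgue_on \<Omega>. \<bar>v x\<bar> powr p)"
    "(\<lambda>k. LINT x|lborel. norm (grad (\<phi> k) x) powr p) \<longlonglongrightarrow> (LINT x|lebesgue_on \<Omega>. norm (wgrad \<Omega> v x) powr p)"
    using W1p0_Lp_norm_tendsto[OF \<Omega>(1) p v(1)] by blast
  have "\<forall>\<^sub>F k in sequentially. 0 < L * (LINT x|lborel. \<bar>\<phi> k x\<bar> powr p) - (LINT x|lborel. norm (grad (\<phi> k) x) powr p)"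
    using lt0 by (intro order_tendstoD(1)[OF tendsto_diff[OF tendsto_mult_left[OF \<phi>(2)] \<phi>(3)]]) simp
  from eventually_happens'[OF sequentially_bot this]
  obtain k where k: "(LINT x|lborel. norm (grad (\<phi> k) x) powr p) < L * (LINT x|lborel. \<bar>\<phi> k x\<bar> powr p)"
    by auto
  define f where "f = \<phi> k"
  have f: "f \<in> test_functions \<Omega>" using \<phi>(1) by (simp add: f_def)
  note s = test_functions_smooth[OF f]
  note [measurable] = borel_measurable_smooth[OF s]
  define \<psi> where "\<psi> n x = (f x * f x + (1 / real (Suc n)) * (1 / real (Suc n))) powr (1/2) - 1 / real (Suc n)" for n x
  have \<psi>: "\<psi> n \<in> test_functions \<Omega>" "\<psi> n x \<ge> 0" "\<psi> n x \<le> \<bar>f x\<bar>" "norm (grad (\<psi> n) x) \<le> norm (grad f x)" for n x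
    using smooth_abs_approximation[OF f, of "1 / real (Suc n)"] unfolding \<psi>_def[abs_def] by auto
  have [measurable]: "\<psi> n \<in> borel_measurable borel" for n
    using borel_measurable_smooth(1)[OF test_functions_smooth[OF \<psi>(1)]] .
  note ip = integrable_test_powr[OF f p0]
  have "(\<lambda>n. LINT x|lborel. \<psi> n x powr p) \<longlonglongrightarrow> (LINT x|lborel. \<bar>f x\<bar> powr p)"
  proof (rule integral_dominated_convergence[OF _ _ ip(1)])
    show "AE x in lborel. (\<lambda>n. \<psi> n x powr p) \<longlonglongrightarrow> \<bar>f x\<bar> powr p"
    proof (rule AE_I2)
      fix x
      have d: "(\<lambda>n. 1 / real (Suc n)) \<longlonglongrightarrow> 0"
        by (rule LIMSEQ_Suc[OF lim_1_over_n])
      have "(\<lambda>n. \<psi> n x) \<longlonglongrightarrow> (f x * f x + 0 * 0) powr (1/2) - 0"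
        unfolding \<psi>_def by (intro tendsto_diff tendsto_powr' tendsto_add tendsto_mult tendsto_const d) auto
      then have "(\<lambda>n. \<psi> n x) \<longlonglongrightarrow> \<bar>f x\<bar>" by (simp add: powr_half_sqrt)
      then show "(\<lambda>n. \<psi> n x powr p) \<longlonglongrightarrow> \<bar>f x\<bar> powr p"
        using p0 \<psi>(2) by (intro tendsto_powr') (auto intro: always_eventually)
    qed
    show "AE x in lborel. norm (\<psi> n x powr p) \<le> \<bar>f x\<bar> powr p" for n
      using \<psi>(2,3) p0 by (intro AE_I2) (auto intro: powr_mono2)
  qed measurable
  from tendsto_mult_left[OF this, of L]
  have "\<forall>\<^sub>F n in sequentially. (LINT x|lborel. norm (grad f x) powr p) < L * (LINT x|lborel. \<psi> n x powr p)"
    by (rule order_tendstoD(1)) (use k in \<open>simp add: f_def\<close>)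
  from eventually_happens'[OF sequentially_bot this]
  obtain n where n: "(LINT x|lborel. norm (grad f x) powr p) < L * (LINT x|lborel. \<psi> n x powr p)"
    by (elim exE)
  define S where "S = (LINT x|lborel. \<psi> n x powr p)"
  have "0 \<le> (LINT x|lborel. norm (grad f x) powr p)" by simp
  then have S: "S > 0"
    using n L unfolding S_def[symmetric] by (metis le_less_trans zero_less_mult_pos)
  have "(LINT x|lborel. norm (grad (\<psi> n) x) powr p) \<le> (LINT x|lborel. norm (grad f x) powr p)"
    using \<psi>(4) p0 by (intro integral_mono integrable_test_powr[OF \<psi>(1) p0] ip powr_mono2) auto
  with n have g: "(LINT x|lborel. norm (grad (\<psi> n) x) powr p) \<le> L * S"
    by (simp add: S_def)
  define a where "a = (1 / S) powr (1 / p)"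
  have a: "a > 0" "a powr p = 1 / S"
    using S p0 by (auto simp: a_def powr_powr)
  define h where "h x = a * \<psi> n x" for x
  have gh: "grad h x = a *\<^sub>R grad (\<psi> n) x" for x
    unfolding h_def[abs_def]
    by (rule grad_compose[OF test_functions_smooth[OF \<psi>(1)]]) (auto intro!: derivative_eq_intros)
  have sh: "smooth_on UNIV h"
    unfolding h_def[abs_def] by (intro smooth_on_mult smooth_on_const test_functions_smooth[OF \<psi>(1)])
  have "h \<in> test_functions \<Omega>"
    by (rule test_functionsI[OF \<psi>(1)[of n] sh]) (simp add: h_def)
  moreover have "h x \<ge> 0" for x using a \<psi>(2) by (simp add: h_def)
  moreover have "(LINT x|lborel. h x powr p) = 1"
    using a \<psi>(2) S by (simp add: h_def powr_mult S_def[symmetric])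
  moreover have "(LINT x|lborel. norm (grad h x) powr p) \<le> L"
  proof -
    have "(LINT x|lborel. norm (grad h x) powr p) = (LINT x|lborel. norm (grad (\<psi> n) x) powr p) / S"
      using a by (simp add: gh powr_mult)
    also have "\<dots> \<le> L" using g S by (simp add: divide_le_eq)
    finally show ?thesis .
  qed
  ultimately show ?thesis by (rule that)
qed

section \<open>Strict supersolutions\<close>

text \<open>For small shifts the integral with \<open>F\<close> in Picone's inequality is almost
  \<open>L\<close> plus \<open>L\<close> times the integral of \<open>V x * \<psi> x powr p\<close>,
  whereas the gradient integral is at most \<open>L + \<tau>\<close>. The main terms
  \<open>L\<close> cancel. Each of three errors costs one \<open>\<tau>\<close>: the energy of
  \<open>\<psi>\<close>, the limit in the shifts, and the error term of Picone's inequality.\<close>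

lemma near_minimizer_defect:
  fixes \<Omega> :: "'a::euclidean_space set" and u F V :: "'a \<Rightarrow> real"
  assumes \<Omega>: "open \<Omega>" "bounded \<Omega>" and p: "p > 1" and u: "u \<in> W1p0 p \<Omega>"
    and pos: "AE x in lebesgue_on \<Omega>. u x > 0"
    and F: "tested_solution p \<Omega> F u"
    and L: "L \<ge> 0" and mV[measurable]: "V \<in> borel_measurable (lebesgue_on \<Omega>)"
    and V: "AE x in lebesgue_on \<Omega>. 0 \<le> V x \<and> V x \<le> 1"
    and FV: "AE x in lebesgue_on \<Omega>. L * (1 + V x) * u x powr (p - 1) \<le> F x"
    and \<psi>: "\<psi> \<in> test_functions \<Omega>" "\<And>x. \<psi> x \<ge> 0"
      "(LINT x|lborel. \<psi> x powr p) = 1" "(LINT x|lborel. norm (grad \<psi> x) powr p) \<le> L + \<tau>"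
    and \<tau>: "\<tau> > 0"
  shows "\<exists>\<epsilon> \<delta>. 0 < \<epsilon> \<and> \<epsilon> < \<tau> \<and> 0 < \<delta> \<and>
    integrable (lebesgue_on \<Omega>)
      (\<lambda>x. picone_remainder p (grad \<psi> x) (((\<psi> x + \<epsilon>) / (u x + \<delta>)) *\<^sub>R wgrad \<Omega> u x)) \<and>
    integrable (lebesgue_on \<Omega>) (\<lambda>x. V x * \<psi> x powr p) \<and>
    (LINT x|lebesgue_on \<Omega>. picone_remainder p (grad \<psi> x) (((\<psi> x + \<epsilon>) / (u x + \<delta>)) *\<^sub>R wgrad \<Omega> u x))
      + L * (LINT x|lebesgue_on \<Omega>. V x * \<psi> x powr p) \<le> 3 * \<tau>"
proof -
  let ?M = "lebesgue_on \<Omega>" and ?X = "wgrad \<Omega> u"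
  interpret finite_measure ?M
    using \<Omega> by (intro finite_measure_lebesgue_on lmeasurable_open)
  have p0: "p > 0" using p by simp
  note t = test_functions_lebesgue_on[OF \<Omega>(1) \<psi>(1) p0]
  note [measurable] = borel_measurable_smooth_lebesgue_on[OF test_functions_smooth[OF \<psi>(1)]]
    W1p0_measurable(1,2)[OF \<Omega>(1) u]
  have \<psi>p: "integrable ?M (\<lambda>x. \<psi> x powr p)" "(LINT x|?M. \<psi> x powr p) = 1"
    using t(1,3) \<psi>(2,3) by (auto simp: abs_of_nonneg)
  have iV: "integrable ?M (\<lambda>x. V x * \<psi> x powr p)"
  proof (rule Bochner_Integration.integrable_bound[OF \<psi>p(1)])
    show "AE x in ?M. norm (V x * \<psi> x powr p) \<le> norm (\<psi> x powr p)"
      using V by eventually_elim (auto simp: abs_mult intro!: mult_left_le_one_le)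
  qed measurable
  define v where "v = (LINT x|?M. V x * \<psi> x powr p)"
  define A where "A = (LINT x|?M. norm (?X x) powr p)"
  obtain B where B: "B \<ge> 0" "\<And>x. \<bar>\<psi> x\<bar> \<le> B"
    using test_functions_bounded[OF \<psi>(1)] by metis
  define \<delta> where "\<delta> n = 1 / real (Suc n)" for n
  \<comment> \<open>The error term contains the quotient of the shifts, so \<open>\<epsilon>\<close>
    must tend to 0 faster than \<open>\<delta>\<close>.\<close>
  define \<epsilon> where "\<epsilon> n = \<delta> n * \<delta> n" for n
  have \<delta>: "\<delta> n > 0" "\<delta> n \<le> 1" "\<delta> \<longlonglongrightarrow> 0" for n
    unfolding \<delta>_def by (simp, simp, rule LIMSEQ_Suc[OF lim_1_over_n])
  have \<epsilon>: "\<epsilon> n > 0" "\<epsilon> n \<le> 1" "\<epsilon> n / \<delta> n = \<delta> n" for n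
    using \<delta>(1,2)[of n] by (auto simp: \<epsilon>_def mult_le_one)
  have \<epsilon>0: "\<epsilon> \<longlonglongrightarrow> 0"
    using tendsto_mult[OF \<delta>(3) \<delta>(3)] by (simp add: \<epsilon>_def[abs_def])
  \<comment> \<open>The lower bound that the supersolution property gives for the integrand with
    \<open>F\<close>. Unlike that integrand it is bounded uniformly in \<open>n\<close>, because the
    product of the two powers of \<open>u x\<close> and \<open>u x + \<delta> n\<close> is at most 1
    and tends to 1.\<close>
  define G where "G n x = L * (1 + V x) * (u x powr (p - 1) * (u x + \<delta> n) powr (1 - p))
      * ((\<psi> x + \<epsilon> n) powr p - \<epsilon> n powr p)" for n x
  have \<Phi>: "0 \<le> (\<psi> x + \<epsilon> n) powr p - \<epsilon> n powr p" "(\<psi> x + \<epsilon> n) powr p - \<epsilon> n powr p \<le> (B + 1) powr p" for n x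
  proof -
    show "0 \<le> (\<psi> x + \<epsilon> n) powr p - \<epsilon> n powr p"
      using \<psi>(2)[of x] \<epsilon>(1)[of n] p0 powr_mono2[of p "\<epsilon> n" "\<psi> x + \<epsilon> n"] by simp
    have "(\<psi> x + \<epsilon> n) powr p \<le> (B + 1) powr p"
      using \<psi>(2)[of x] \<epsilon>(1,2)[of n] p0 B(2)[of x] by (intro powr_mono2) auto
    then show "(\<psi> x + \<epsilon> n) powr p - \<epsilon> n powr p \<le> (B + 1) powr p"
      by (smt (verit) powr_ge_zero)
  qed
  have G_lim: "AE x in ?M. (\<lambda>n. G n x) \<longlonglongrightarrow> L * (1 + V x) * \<psi> x powr p"
    using pos
  proof eventually_elim
    case (elim x)
    have "(\<lambda>n. u x powr (p - 1) * (u x + \<delta> n) powr (1 - p)) \<longlonglongrightarrow> u x powr (p - 1) * (u x + 0) powr (1 - p)"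
      using elim by (intro tendsto_intros \<delta>) auto
    also have "u x powr (p - 1) * (u x + 0) powr (1 - p) = 1"
      using elim by (simp flip: powr_add)
    finally have 1: "(\<lambda>n. u x powr (p - 1) * (u x + \<delta> n) powr (1 - p)) \<longlonglongrightarrow> 1" .
    have "(\<lambda>n. (\<psi> x + \<epsilon> n) powr p - \<epsilon> n powr p) \<longlonglongrightarrow> (\<psi> x + 0) powr p - 0 powr p"
      using \<psi>(2)[of x] less_imp_le[OF \<epsilon>(1)] p0
      by (intro tendsto_diff tendsto_powr' tendsto_add tendsto_const \<epsilon>0) auto
    from tendsto_mult[OF tendsto_mult[OF tendsto_const[of "L * (1 + V x)"] 1] this]
    show ?case unfolding G_def by simp
  qed
  have G_bound: "AE x in ?M. norm (G n x) \<le> L * 2 * (B + 1) powr p" for n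
    using pos V
  proof eventually_elim
    case (elim x)
    have "u x powr (p - 1) * (u x + \<delta> n) powr (1 - p) \<le> (u x + \<delta> n) powr (p - 1) * (u x + \<delta> n) powr (1 - p)"
      using elim \<delta>(1)[of n] p by (intro mult_right_mono powr_mono2) auto
    also have "\<dots> = 1"
      using elim \<delta>(1)[of n] by (simp flip: powr_add)
    finally have 1: "u x powr (p - 1) * (u x + \<delta> n) powr (1 - p) \<le> 1" .
    have "G n x \<le> L * 2 * 1 * (B + 1) powr p"
      unfolding G_def using elim L \<Phi>[of x n] 1 by (intro mult_mono mult_nonneg_nonneg) auto
    moreover have "0 \<le> G n x"
      unfolding G_def using elim L \<Phi>[of x n] by (intro mult_nonneg_nonneg) auto
    ultimately show ?case by simp
  qed
  have mG[measurable]: "G n \<in> borel_measurable ?M" for n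
    unfolding G_def[abs_def] by measurable
  have iG: "integrable ?M (G n)" for n
    by (rule integrable_const_bound[OF G_bound mG])
  have "(\<lambda>n. LINT x|?M. G n x) \<longlonglongrightarrow> (LINT x|?M. L * (1 + V x) * \<psi> x powr p)"
    by (rule integral_dominated_convergence[OF _ mG _ G_lim G_bound]) auto
  also have "(LINT x|?M. L * (1 + V x) * \<psi> x powr p) = L * (1 + v)"
  proof -
    have "(LINT x|?M. L * (1 + V x) * \<psi> x powr p) = (LINT x|?M. L * (\<psi> x powr p + V x * \<psi> x powr p))"
      by (simp add: algebra_simps)
    also have "\<dots> = L * ((LINT x|?M. \<psi> x powr p) + v)"
      unfolding v_def using \<psi>p iV by simp
    finally show ?thesis using \<psi>p by simp
  qed
  finally have "(\<lambda>n. LINT x|?M. G n x) \<longlonglongrightarrow> L * (1 + v)" .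
  then have e1: "\<forall>\<^sub>F n in sequentially. L * (1 + v) - \<tau> < (LINT x|?M. G n x)"
    using \<tau> by (intro order_tendstoD(1)) auto
  have "(\<lambda>n. (p - 1) * (\<epsilon> n / \<delta> n) powr p * A) \<longlonglongrightarrow> (p - 1) * 0 powr p * A"
    unfolding \<epsilon>(3) using p0 less_imp_le[OF \<delta>(1)]
    by (intro tendsto_mult tendsto_const tendsto_powr' \<delta>(3)) auto
  then have e2: "\<forall>\<^sub>F n in sequentially. (p - 1) * (\<epsilon> n / \<delta> n) powr p * A < \<tau>"
    using \<tau> p0 by (intro order_tendstoD(2)) auto
  have e3: "\<forall>\<^sub>F n in sequentially. \<epsilon> n < \<tau>"
    using \<epsilon>0 \<tau> by (rule order_tendstoD(2))
  have "\<forall>\<^sub>F n in sequentially. L * (1 + v) - \<tau> < (LINT x|?M. G n x)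
      \<and> (p - 1) * (\<epsilon> n / \<delta> n) powr p * A < \<tau> \<and> \<epsilon> n < \<tau>"
    using e1 e2 e3 by eventually_elim simp
  from eventually_happens'[OF sequentially_bot this]
  obtain n where n: "L * (1 + v) - \<tau> < (LINT x|?M. G n x)"
    "(p - 1) * (\<epsilon> n / \<delta> n) powr p * A < \<tau>" "\<epsilon> n < \<tau>" by auto
  note pic = picone_inequality[OF \<Omega> p u pos F \<psi>(1,2) \<epsilon>(1)[of n] \<delta>(1)[of n]]
  have "(LINT x|?M. G n x) \<le> (LINT x|?M. F x * ((\<psi> x + \<epsilon> n) powr p - \<epsilon> n powr p) * (u x + \<delta> n) powr (1 - p))"
  proof (rule integral_mono_AE[OF iG pic(2)])
    show "AE x in ?M. G n x \<le> F x * ((\<psi> x + \<epsilon> n) powr p - \<epsilon> n powr p) * (u x + \<delta> n) powr (1 - p)"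
      using FV
    proof eventually_elim
      case (elim x)
      have "L * (1 + V x) * u x powr (p - 1) * (((\<psi> x + \<epsilon> n) powr p - \<epsilon> n powr p) * (u x + \<delta> n) powr (1 - p))
          \<le> F x * (((\<psi> x + \<epsilon> n) powr p - \<epsilon> n powr p) * (u x + \<delta> n) powr (1 - p))"
        using elim \<Phi>(1) by (intro mult_right_mono mult_nonneg_nonneg) auto
      then show ?case by (simp add: G_def mult_ac)
    qed
  qed
  then have "(LINT x|?M. picone_remainder p (grad \<psi> x) (((\<psi> x + \<epsilon> n) / (u x + \<delta> n)) *\<^sub>R ?X x))
      + L * v \<le> 3 * \<tau>"
    using pic(3) n(1,2) \<psi>(4) t(4) unfolding A_def by (simp add: algebra_simps)
  then show ?thesis
    using \<epsilon>(1)[of n] n(3) \<delta>(1)[of n] pic(1) iV unfolding v_def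
    by (intro exI[of _ "\<epsilon> n"] exI[of _ "\<delta> n"] conjI)
qed

text \<open>\<open>V\<close> measures the relative excess of \<open>F\<close> over the eigenvalue
  equation; its bound 1 makes it harmless in integrals. It may vanish on a set of positive measure
  as long as the gradient of \<open>u\<close> vanishes there: that is all the argument uses of the
  level set.\<close>

theorem less_first_eigenvalue_if_strict_supersolution:
  fixes \<Omega> :: "'a::euclidean_space set" and u F V :: "'a \<Rightarrow> real"
  assumes \<Omega>: "open \<Omega>" "bounded \<Omega>" and p: "p > 1" and u: "u \<in> W1p0 p \<Omega>" "\<not> (AE x in lebesgue_on \<Omega>. u x = 0)"
    and pos: "AE x in lebesgue_on \<Omega>. u x > 0"
    and F: "tested_solution p \<Omega> F u"
    and mV[measurable]: "V \<in> borel_measurable (lebesgue_on \<Omega>)"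
    and V: "AE x in lebesgue_on \<Omega>. 0 \<le> V x \<and> V x \<le> 1"
    and FV: "AE x in lebesgue_on \<Omega>. L * (1 + V x) * u x powr (p - 1) \<le> F x"
    and V0: "AE x in lebesgue_on \<Omega>. V x = 0 \<longrightarrow> wgrad \<Omega> u x = 0"
  shows "L < first_eigenvalue p \<Omega>"
proof (rule ccontr)
  assume "\<not> ?thesis"
  then have le: "first_eigenvalue p \<Omega> \<le> L" by simp
  \<comment> \<open>Positivity allows division by \<open>L\<close>, so that the small defect also
    bounds the integral of \<open>V x * \<psi> n x powr p\<close>.\<close>
  then have L: "L > 0" using first_eigenvalue_pos[OF \<Omega> p u] by linarith
  let ?M = "lebesgue_on \<Omega>" and ?X = "wgrad \<Omega> u"
  have fin: "finite_measure ?M"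
    using \<Omega> by (intro finite_measure_lebesgue_on lmeasurable_open)
  interpret finite_measure ?M by (rule fin)
  have p0: "p > 0" using p by simp
  note [measurable] = W1p0_measurable(1,2)[OF \<Omega>(1) u(1)]
  define \<tau> where "\<tau> n = 1 / real (Suc n)" for n
  have \<tau>: "\<tau> n > 0" "\<tau> n \<le> 1" "\<tau> \<longlonglongrightarrow> 0" for n
    unfolding \<tau>_def by (simp, simp, rule LIMSEQ_Suc[OF lim_1_over_n])
  define R where "R \<psi> \<epsilon> \<delta> x = picone_remainder p (grad \<psi> x) (((\<psi> x + \<epsilon>) / (u x + \<delta>)) *\<^sub>R ?X x)" for \<psi> \<epsilon> \<delta> x
  define P where "P n \<psi> \<epsilon> \<delta> \<longleftrightarrow> \<psi> \<in> test_functions \<Omega> \<and> (\<forall>x. \<psi> x \<ge> 0) \<and> (LINT x|lborel. \<psi> x powr p) = 1 \<and>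
      (LINT x|lborel. norm (grad \<psi> x) powr p) \<le> L + \<tau> n \<and> 0 < \<epsilon> \<and> \<epsilon> < \<tau> n \<and> 0 < \<delta> \<and>
      integrable ?M (R \<psi> \<epsilon> \<delta>) \<and> integrable ?M (\<lambda>x. V x * \<psi> x powr p) \<and>
      (LINT x|?M. R \<psi> \<epsilon> \<delta> x) + L * (LINT x|?M. V x * \<psi> x powr p) \<le> 3 * \<tau> n" for n \<psi> \<epsilon> \<delta>
  have "\<exists>\<psi> \<epsilon> \<delta>. P n \<psi> \<epsilon> \<delta>" for n
  proof -
    have lt: "first_eigenvalue p \<Omega> < L + \<tau> n" using le \<tau>(1)[of n] by linarith
    obtain \<psi> where \<psi>: "\<psi> \<in> test_functions \<Omega>" "\<And>x. \<psi> x \<ge> 0"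
      "(LINT x|lborel. \<psi> x powr p) = 1" "(LINT x|lborel. norm (grad \<psi> x) powr p) \<le> L + \<tau> n"
      by (rule first_eigenvalue_test_function[OF \<Omega> p u lt]) (rule that)
    from near_minimizer_defect[OF \<Omega> p u(1) pos F less_imp_le[OF L] mV V FV \<psi> \<tau>(1)]
    show ?thesis
      unfolding P_def R_def[abs_def] using \<psi> by blast
  qed
  then obtain \<psi> \<epsilon> \<delta> where all: "\<And>n. P n (\<psi> n) (\<epsilon> n) (\<delta> n)"
    by metis
  have \<psi>: "\<psi> n \<in> test_functions \<Omega>" "\<psi> n x \<ge> 0" "(LINT x|lborel. \<psi> n x powr p) = 1"
      "(LINT x|lborel. norm (grad (\<psi> n) x) powr p) \<le> L + \<tau> n"
    and \<epsilon>: "0 < \<epsilon> n" "\<epsilon> n < \<tau> n" and \<delta>: "0 < \<delta> n"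
    and iR: "integrable ?M (R (\<psi> n) (\<epsilon> n) (\<delta> n))" and iV: "integrable ?M (\<lambda>x. V x * \<psi> n x powr p)"
    and sum: "(LINT x|?M. R (\<psi> n) (\<epsilon> n) (\<delta> n) x) + L * (LINT x|?M. V x * \<psi> n x powr p) \<le> 3 * \<tau> n" for n x
    using all[of n] unfolding P_def by auto
  note s = test_functions_smooth[OF \<psi>(1)]
  note [measurable] = borel_measurable_smooth_lebesgue_on[OF s]
  define Rn where "Rn n = R (\<psi> n) (\<epsilon> n) (\<delta> n)" for n
  have Rnn: "Rn n x \<ge> 0" for n x
    unfolding Rn_def R_def by (rule picone_remainder_nonneg[OF p])
  have R0: "0 \<le> (LINT x|?M. Rn n x)" for n using Rnn by simp
  have V0': "0 \<le> (LINT x|?M. V x * \<psi> n x powr p)" for n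
  proof (rule Bochner_Integration.integral_nonneg_AE)
    show "AE x in ?M. 0 \<le> V x * \<psi> n x powr p"
      using V by eventually_elim auto
  qed
  have t3: "(\<lambda>n. 3 * \<tau> n) \<longlonglongrightarrow> 0"
    using tendsto_mult_left[OF \<tau>(3), of 3] by simp
  have limR: "(\<lambda>n. LINT x|?M. norm (Rn n x)) \<longlonglongrightarrow> 0"
  proof (rule tendsto_sandwich[OF _ _ tendsto_const t3])
    show "\<forall>\<^sub>F n in sequentially. (LINT x|?M. norm (Rn n x)) \<le> 3 * \<tau> n"
    proof (intro always_eventually allI)
      fix n
      have "0 \<le> L * (LINT x|?M. V x * \<psi> n x powr p)" using V0' L by simp
      then show "(LINT x|?M. norm (Rn n x)) \<le> 3 * \<tau> n"
        using sum[of n] Rnn by (simp add: Rn_def)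
    qed
  qed auto
  have limV: "(\<lambda>n. LINT x|?M. norm (V x * \<psi> n x powr p)) \<longlonglongrightarrow> 0"
  proof (rule tendsto_sandwich[OF _ _ tendsto_const])
    show "\<forall>\<^sub>F n in sequentially. (LINT x|?M. norm (V x * \<psi> n x powr p)) \<le> 3 * \<tau> n / L"
    proof (intro always_eventually allI)
      fix n
      have "(LINT x|?M. norm (V x * \<psi> n x powr p)) = (LINT x|?M. V x * \<psi> n x powr p)"
      proof (rule integral_cong_AE)
        show "AE x in ?M. norm (V x * \<psi> n x powr p) = V x * \<psi> n x powr p"
          using V by eventually_elim auto
      qed measurable
      moreover have "L * (LINT x|?M. V x * \<psi> n x powr p) \<le> 3 * \<tau> n"
        using sum[of n] R0[of n] by (simp add: Rn_def)
      ultimately show "(LINT x|?M. norm (V x * \<psi> n x powr p)) \<le> 3 * \<tau> n / L"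
        using L by (simp add: field_simps)
    qed
    show "(\<lambda>n. 3 * \<tau> n / L) \<longlonglongrightarrow> 0"
      using tendsto_divide[OF t3 tendsto_const[of L]] L by simp
  qed auto
  \<comment> \<open>Convergence in the mean gives convergence almost everywhere only along
    subsequences: one for the remainder, then a further one for the excess.\<close>
  obtain r1 where r1: "strict_mono r1" "AE x in ?M. (\<lambda>n. Rn (r1 n) x) \<longlonglongrightarrow> 0"
    using tendsto_L1_AE_subseq[of ?M Rn] iR limR unfolding Rn_def by blast
  obtain r2 where r2: "strict_mono r2" "AE x in ?M. (\<lambda>n. V x * \<psi> (r1 (r2 n)) x powr p) \<longlonglongrightarrow> 0"
    using tendsto_L1_AE_subseq[of ?M "\<lambda>n x. V x * \<psi> (r1 n) x powr p"] iV
      LIMSEQ_subseq_LIMSEQ[OF limV r1(1)] unfolding o_def by blast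
  define r where "r n = r1 (r2 n)" for n
  have r: "strict_mono r"
    unfolding r_def using r1(1) r2(1) by (simp add: strict_mono_def)
  have \<epsilon>0: "(\<lambda>n. \<epsilon> (r n)) \<longlonglongrightarrow> 0"
  proof (rule tendsto_sandwich[OF _ _ tendsto_const LIMSEQ_subseq_LIMSEQ[OF \<tau>(3) r]])
    show "\<forall>\<^sub>F n in sequentially. 0 \<le> \<epsilon> (r n)" using \<epsilon>(1) by (simp add: less_imp_le)
    show "\<forall>\<^sub>F n in sequentially. \<epsilon> (r n) \<le> (\<tau> \<circ> r) n" using \<epsilon>(2) by (simp add: less_imp_le)
  qed
  have g0: "AE x in ?M. (\<lambda>n. norm (grad (\<psi> (r n)) x)) \<longlonglongrightarrow> 0"
    using r1(2) r2(2) pos V V0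
  proof eventually_elim
    case (elim x)
    have Rx: "(\<lambda>n. Rn (r n) x) \<longlonglongrightarrow> 0"
      using LIMSEQ_subseq_LIMSEQ[OF elim(1) r2(1)] by (simp add: r_def o_def)
    have "(\<lambda>n. norm (((\<psi> (r n) x + \<epsilon> (r n)) / (u x + \<delta> (r n))) *\<^sub>R ?X x)) \<longlonglongrightarrow> 0"
    proof (cases "V x = 0")
      case True
      then show ?thesis using elim(5) by simp
    next
      case False
      have "(\<lambda>n. (V x * \<psi> (r n) x powr p) / V x) \<longlonglongrightarrow> 0 / V x"
        using elim(2) False unfolding r_def by (intro tendsto_divide tendsto_const) auto
      then have "(\<lambda>n. \<psi> (r n) x powr p) \<longlonglongrightarrow> 0"
        using False by simp
      then have p0': "(\<lambda>n. \<psi> (r n) x) \<longlonglongrightarrow> 0"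
        by (rule tendsto_powr_0_cancel[rotated 2]) (use p0 \<psi>(2) in auto)
      have "(\<lambda>n. (\<psi> (r n) x + \<epsilon> (r n)) / u x * norm (?X x)) \<longlonglongrightarrow> (0 + 0) / u x * norm (?X x)"
        using elim(3) by (intro tendsto_intros p0' \<epsilon>0) auto
      then have z: "(\<lambda>n. (\<psi> (r n) x + \<epsilon> (r n)) / u x * norm (?X x)) \<longlonglongrightarrow> 0" by simp
      \<comment> \<open>No limit of \<open>\<delta> (r n)\<close> is known here. Positivity is
        enough, since it only enlarges the denominator \<open>u x\<close>.\<close>
      show ?thesis
      proof (rule tendsto_sandwich[OF _ _ tendsto_const z])
        show "\<forall>\<^sub>F n in sequentially. norm (((\<psi> (r n) x + \<epsilon> (r n)) / (u x + \<delta> (r n))) *\<^sub>R ?X x)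
            \<le> (\<psi> (r n) x + \<epsilon> (r n)) / u x * norm (?X x)"
        proof (intro always_eventually allI)
          fix n
          have a: "0 \<le> \<psi> (r n) x + \<epsilon> (r n)" "0 < u x" "u x \<le> u x + \<delta> (r n)"
            using \<psi>(2)[of "r n" x] \<epsilon>(1)[of "r n"] \<delta>[of "r n"] elim(3) by auto
          then have "(\<psi> (r n) x + \<epsilon> (r n)) / (u x + \<delta> (r n)) \<le> (\<psi> (r n) x + \<epsilon> (r n)) / u x"
            by (intro divide_left_mono mult_pos_pos) auto
          then show "norm (((\<psi> (r n) x + \<epsilon> (r n)) / (u x + \<delta> (r n))) *\<^sub>R ?X x)
            \<le> (\<psi> (r n) x + \<epsilon> (r n)) / u x * norm (?X x)"
            using a by (simp only: norm_scaleR) (intro mult_right_mono, auto)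
        qed
      qed auto
    qed
    with Rx show ?case
      unfolding Rn_def R_def by (rule picone_remainder_tendsto_0[OF p])
  qed
  note t = test_functions_lebesgue_on[OF \<Omega>(1) \<psi>(1) p0]
  have gB: "(LINT x|?M. norm (grad (\<psi> n) x) powr p) \<le> L + 1" for n
    using \<psi>(4)[of n] \<tau>(2)[of n] t(4)[of n] by linarith
  have "(\<lambda>n. LINT x|?M. norm (grad (\<psi> (r n)) x)) \<longlonglongrightarrow> 0"
    by (rule L1_tendsto_0_if_AE_tendsto_0[OF fin p _ _ g0 t(2) gB]) auto
  then have g1: "(\<lambda>n. LINT x|lborel. norm (grad (\<psi> (r n)) x)) \<longlonglongrightarrow> 0"
    using test_functions_lebesgue_on(4)[OF \<Omega>(1) \<psi>(1), of 1] by simp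
  \<comment> \<open>Exponent 1, because at this point the gradients are known to tend to 0 only in
    the mean.\<close>
  obtain C where C: "C > 0" "\<And>\<phi>. \<phi> \<in> test_functions \<Omega> \<Longrightarrow>
      (\<integral>x. \<bar>\<phi> x\<bar> powr 1 \<partial>lborel) \<le> C * (\<integral>x. norm (grad \<phi> x) powr 1 \<partial>lborel)"
    by (rule poincare_inequality[OF \<Omega>(2), of 1]) auto
  have N0: "(\<lambda>n. LINT x|lborel. \<bar>\<psi> (r n) x\<bar>) \<longlonglongrightarrow> 0"
  proof (rule tendsto_sandwich[OF _ _ tendsto_const])
    show "\<forall>\<^sub>F n in sequentially. (LINT x|lborel. \<bar>\<psi> (r n) x\<bar>) \<le> C * (LINT x|lborel. norm (grad (\<psi> (r n)) x))"
      using C(2)[OF \<psi>(1)] by simp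
    show "(\<lambda>n. C * (LINT x|lborel. norm (grad (\<psi> (r n)) x))) \<longlonglongrightarrow> 0"
      using tendsto_mult_left[OF g1, of C] by simp
  qed auto
  \<comment> \<open>The radius for which the gradient term of the interpolation inequality takes at
    most half of the left-hand side; the energies are bounded by \<open>L + 1\<close>.\<close>
  define h where "h = (1 / (2 * 2 powr p * (L + 1))) powr (1 / p)"
  have h: "h > 0" "2 powr p * h powr p * (L + 1) = 1 / 2"
    using L p0 by (auto simp: h_def powr_powr)
  define \<beta> where "\<beta> = measure lborel (cball (0::'a) h)"
  have \<beta>: "\<beta> > 0"
    unfolding \<beta>_def using content_cball_pos[OF h(1), of "0::'a"] by simp
  define D where "D = measure ?M (space ?M) + 1"
  \<comment> \<open>The interpolation inequality also contains the power \<open>p - 1\<close>. On a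
    bounded domain it is controlled by the normalized power \<open>p\<close>, through
    \<open>t powr (p - 1) \<le> 1 + t powr p\<close>.\<close>
  have Q: "(LINT x|lborel. \<bar>\<psi> n x\<bar> powr (p - 1)) \<le> D" for n
  proof -
    have "(LINT x|?M. \<bar>\<psi> n x\<bar> powr (p - 1)) \<le> (LINT x|?M. 1 + \<bar>\<psi> n x\<bar> powr p)"
    proof (rule integral_mono)
      show "integrable ?M (\<lambda>x. \<bar>\<psi> n x\<bar> powr (p - 1))"
        using p by (intro test_functions_lebesgue_on(1)[OF \<Omega>(1) \<psi>(1)]) auto
      show "integrable ?M (\<lambda>x. 1 + \<bar>\<psi> n x\<bar> powr p)" using t(1) by simp
      fix x
      show "\<bar>\<psi> n x\<bar> powr (p - 1) \<le> 1 + \<bar>\<psi> n x\<bar> powr p"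
      proof (cases "\<bar>\<psi> n x\<bar> \<le> 1")
        case True
        then have "\<bar>\<psi> n x\<bar> powr (p - 1) \<le> 1" using p by (intro powr_le1) auto
        then show ?thesis by (simp add: add_increasing2)
      next
        case False
        then have "\<bar>\<psi> n x\<bar> powr (p - 1) \<le> \<bar>\<psi> n x\<bar> powr p" by (intro powr_mono) auto
        then show ?thesis by simp
      qed
    qed
    also have "\<dots> = measure ?M (space ?M) + (LINT x|?M. \<bar>\<psi> n x\<bar> powr p)"
      using t(1) by simp
    also have "(LINT x|?M. \<bar>\<psi> n x\<bar> powr p) = 1"
      using t(3) \<psi>(2,3) by (simp add: abs_of_nonneg)
    finally show ?thesis
      using test_functions_lebesgue_on(3)[OF \<Omega>(1) \<psi>(1), of "p - 1"] p by (simp add: D_def)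
  qed
  have ineq: "\<beta> \<le> \<beta> / 2 + 2 * D * (LINT x|lborel. \<bar>\<psi> (r n) x\<bar>)" for n
  proof -
    have "\<beta> * (LINT x|lborel. \<bar>\<psi> (r n) x\<bar> powr p)
      \<le> \<beta> * (2 powr p * h powr p * (LINT x|lborel. norm (grad (\<psi> (r n)) x) powr p))
        + 2 * (LINT x|lborel. \<bar>\<psi> (r n) x\<bar> powr (p - 1)) * (LINT x|lborel. \<bar>\<psi> (r n) x\<bar>)"
      unfolding \<beta>_def by (rule interpolation_inequality[OF \<psi>(1) p less_imp_le[OF h(1)]])
    also have "\<dots> \<le> \<beta> * (2 powr p * h powr p * (L + 1)) + 2 * D * (LINT x|lborel. \<bar>\<psi> (r n) x\<bar>)"
      using \<beta> gB[of "r n"] t(4)[of "r n"] Q[of "r n"]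
      by (intro add_mono mult_left_mono mult_right_mono) auto
    also have "(LINT x|lborel. \<bar>\<psi> (r n) x\<bar> powr p) = 1"
      using \<psi>(2,3) by (simp add: abs_of_nonneg)
    finally show ?thesis unfolding h(2) by simp
  qed
  have "(\<lambda>n. \<beta> / 2 + 2 * D * (LINT x|lborel. \<bar>\<psi> (r n) x\<bar>)) \<longlonglongrightarrow> \<beta> / 2 + 2 * D * 0"
    by (intro tendsto_intros N0)
  from LIMSEQ_le_const[OF this, of \<beta>] ineq have "\<beta> \<le> \<beta> / 2" by auto
  with \<beta> show False by simp
qed

theorem proposition3p2:
  fixes \<Omega> :: "'a::euclidean_space set"
    and g u :: "'a \<Rightarrow> real"
    and p l \<alpha> s m :: real
  assumes "DIM('a) \<ge> 2"
    and "smooth_bounded_domain \<Omega>"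
    and "g \<in> Linfty_space \<Omega>"
    and "AE x in lebesgue_on \<Omega>. g x \<ge> 0"
    and "1 \<le> l" and "l < p" and "\<alpha> > 0" and "s > 0" and "m \<ge> 0"
    and "weak_solution p \<Omega> (\<lambda>x t. m * t powr (l - 1) * exp (\<alpha> * t powr s) + g x) u"
    and "AE x in lebesgue_on \<Omega>. u x > 0"
  shows "m < first_eigenvalue p \<Omega> * ((p - l) / (\<alpha> * s * exp 1)) powr ((p - l) / s)"
proof -
  let ?M = "lebesgue_on \<Omega>" and ?X = "wgrad \<Omega> u"
  have \<Omega>: "open \<Omega>" "bounded \<Omega>" "\<Omega> \<noteq> {}"
    using assms(2) by (auto simp: smooth_bounded_domain_def)
  have p: "p > 1" "p > 0" and q: "p - l > 0" using assms by auto
  have u: "u \<in> W1p0 p \<Omega>" using assms(10) by (simp add: weak_solution_def)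
  note [measurable] = W1p0_measurable(1,2)[OF \<Omega>(1) u]
  define F where "F x = m * u x powr (l - 1) * exp (\<alpha> * u x powr s) + g x" for x
  \<comment> \<open>The minimum from \<open>exp_powr_lower_bound\<close> with
    \<open>q = p - l\<close>; the claim says that \<open>m * C\<close> is below the first
    eigenvalue.\<close>
  define C where "C = (\<alpha> * s * exp 1 / (p - l)) powr ((p - l) / s)"
  have C: "C > 0" using assms by (simp add: C_def)
  have C': "((p - l) / (\<alpha> * s * exp 1)) powr ((p - l) / s) = 1 / C"
    using assms by (simp add: C_def powr_divide)
  \<comment> \<open>The relative excess of the nonlinearity over
    \<open>m * C * u x powr (p - 1)\<close>, cut off at 1. The quotient does not involve
    \<open>m\<close>, so \<open>V\<close> keeps its strictness also for
    \<open>m = 0\<close>.\<close>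
  define V where "V x = min 1 (exp (\<alpha> * u x powr s) / (C * u x powr (p - l)) - 1)" for x
  have nz: "\<not> (AE x in ?M. u x = 0)"
  proof
    assume "AE x in ?M. u x = 0"
    with assms(11) have "AE x in ?M. False" by eventually_elim simp
    then have "AE x in lebesgue. x \<notin> \<Omega>"
      using \<Omega>(1) by (subst (asm) AE_restrict_space_iff) auto
    then have "negligible \<Omega>"
      unfolding negligible_iff_null_sets completion.AE_iff_null_sets by simp
    then show False using open_not_negligible \<Omega> by blast
  qed
  have F: "tested_solution p \<Omega> F u"
    unfolding tested_solution_def
  proof
    fix \<phi> assume \<phi>: "\<phi> \<in> test_functions \<Omega>"
    have w: "\<phi> \<in> W1p0 p \<Omega>" by (rule test_functions_subset_W1p0[OF \<Omega>(1) p(2) \<phi>])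
    note s = test_functions_smooth[OF \<phi>]
    have [measurable]: "wgrad \<Omega> \<phi> \<in> borel_measurable ?M" by (rule W1p0_measurable(2)[OF \<Omega>(1) w])
    note [measurable] = borel_measurable_smooth_lebesgue_on[OF s]
    \<comment> \<open>The weak equation refers to the chosen representative
      \<open>wgrad \<Omega> \<phi>\<close>, which agrees with the classical gradient almost
      everywhere.\<close>
    have "(LINT x|?M. flux p (?X x) \<bullet> grad \<phi> x) = (LINT x|?M. flux p (?X x) \<bullet> wgrad \<Omega> \<phi> x)"
    proof (rule integral_cong_AE)
      show "AE x in ?M. flux p (?X x) \<bullet> grad \<phi> x = flux p (?X x) \<bullet> wgrad \<Omega> \<phi> x"
        using wgrad_AE_eq[OF \<Omega>(1) weak_gradient_smooth[OF \<Omega>(1) s]] by eventually_elim simp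
    qed measurable
    then show "integrable ?M (\<lambda>x. F x * \<phi> x) \<and>
      (LINT x|?M. flux p (?X x) \<bullet> grad \<phi> x) = (LINT x|?M. F x * \<phi> x)"
      using assms(10) w unfolding weak_solution_def F_def flux_def by auto
  qed
  have ratio: "1 \<le> exp (\<alpha> * t powr s) / (C * t powr (p - l))" if "t > 0" for t
    using exp_powr_lower_bound(1)[OF that assms(7,8) q] C that unfolding C_def[symmetric] by simp
  have "m * C < first_eigenvalue p \<Omega>"
  proof (rule less_first_eigenvalue_if_strict_supersolution[OF \<Omega>(1,2) p(1) u nz assms(11) F])
    show "V \<in> borel_measurable ?M" unfolding V_def[abs_def] by measurable
    show "AE x in ?M. 0 \<le> V x \<and> V x \<le> 1"
      using assms(11) by eventually_elim (use ratio in \<open>auto simp: V_def\<close>)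
    show "AE x in ?M. m * C * (1 + V x) * u x powr (p - 1) \<le> F x"
      using assms(11,4)
    proof eventually_elim
      case (elim x)
      have "u x powr (p - 1) = u x powr (l - 1) * u x powr (p - l)"
        by (simp flip: powr_add)
      then have e: "C * u x powr (p - 1) * (exp (\<alpha> * u x powr s) / (C * u x powr (p - l)))
          = u x powr (l - 1) * exp (\<alpha> * u x powr s)"
        using C elim(1) by simp
      have "C * u x powr (p - 1) * (1 + V x) \<le> C * u x powr (p - 1) * (exp (\<alpha> * u x powr s) / (C * u x powr (p - l)))"
        using C by (intro mult_left_mono) (auto simp: V_def)
      then have "m * (C * u x powr (p - 1) * (1 + V x)) \<le> m * (u x powr (l - 1) * exp (\<alpha> * u x powr s))"
        unfolding e using assms(9) by (rule mult_left_mono)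
      then show ?case using elim(2) by (simp add: F_def mult_ac)
    qed
    \<comment> \<open>No excess means equality in the exponential bound, which pins
      \<open>u x\<close> to a single value; on that level set the gradient vanishes.\<close>
    show "AE x in ?M. V x = 0 \<longrightarrow> ?X x = 0"
      using assms(11) wgrad_eq_0_on_level_set[OF \<Omega>(1,2) p(1) u, of "((p - l) / (\<alpha> * s)) powr (1 / s)"]
    proof eventually_elim
      case (elim x)
      show ?case
      proof
        assume "V x = 0"
        then have "exp (\<alpha> * u x powr s) / (C * u x powr (p - l)) = 1"
          by (simp add: V_def min_def split: if_splits)
        then have "C * u x powr (p - l) = exp (\<alpha> * u x powr s)"
          using C elim(1) by (simp add: field_simps)
        then have "u x = ((p - l) / (\<alpha> * s)) powr (1 / s)"
          using exp_powr_lower_bound(2)[OF elim(1) assms(7,8) q] by (simp add: C_def)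
        with elim(2) show "?X x = 0" by simp
      qed
    qed
  qed
  then show ?thesis
    unfolding C' using C by (simp add: field_simps)
qed

end
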